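(* Let $K$ be an algebraic number field, $H$ a quaternion algebra over $K$, $\ddagger$ an orthogonal involution on $H$, and $\mathcal{O}$ an order of $H$ that is closed under $\ddagger$ but is not contained in any strictly larger order of $H$ closed under $\ddagger$. Then $SL^\ddagger(2,\mathcal{O})$ is a maximal arithmetic subgroup of $SL^\ddagger(2,H)$, in the sense that it is not contained in any strictly larger arithmetic subgroup of $SL^\ddagger(2,H)$.
   Context: A quaternion algebra over $K$ is a central simple $K$-algebra of dimension $4$. An orthogonal involution on $H$ is a $K$-linear map $\ddagger$ with $x^{\ddagger\ddagger}=x$, $(xy)^\ddagger = y^\ddagger x^\ddagger$, other than quaternion conjugation. An order of $H$ is a subring that is a finitely generated $\mathfrak{o}_K$-module ($\mathfrak{o}_K$ the ring of integers of $K$) spanning $H$ over $K$. Define $\hat{\ddagger}\begin{pmatrix} a & b \\ c & d\end{pmatrix} = \begin{pmatrix} d^\ddagger & -b^\ddagger \\ -c^\ddagger & a^\ddagger\end{pmatrix}$ and $SL^\ddagger(2,R) = \{M \in \text{Mat}(2,R) : M\hat{\ddagger}(M) = I\}$ for $\ddagger$-stable subrings $R\subseteq H$; $SL^\ddagger(2,H)$ is a linear algebraic group over $K$ and arithmetic subgroups are meant in the usual sense for algebraic groups over number fields. *)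

theory Defs
  imports "HOL-Analysis.Analysis" "HOL-Algebra.Coset"
begin

section \<open>Number fields and quaternion algebras\<close>

text \<open>The field \<open>K\<close> is a type of class \<^class>\<open>field_char_0\<close> that is finite-dimensional over the
  rationals.\<close>

definition number_field :: "'k::field_char_0 itself \<Rightarrow> bool" where
  "number_field _ \<longleftrightarrow>
     (\<exists>B :: 'k set. finite B \<and> module.span (\<lambda>q x. of_rat q * x) B = UNIV)"

definition ring_of_integers :: "'k::field_char_0 set" where
  "ring_of_integers = {x. algebraic_int x}"

locale algebra_over_field = vector_space scaleK
  for scaleK :: "'k::field \<Rightarrow> 'h::ring_1 \<Rightarrow> 'h" +
  assumes scale_mult_left: "scaleK a x * y = scaleK a (x * y)"
    and scale_mult_right: "x * scaleK a y = scaleK a (x * y)"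

definition two_sided_ideal :: "'h::ring_1 set \<Rightarrow> bool" where
  "two_sided_ideal I \<longleftrightarrow>
     0 \<in> I \<and> (\<forall>x\<in>I. \<forall>y\<in>I. x - y \<in> I) \<and> (\<forall>x\<in>I. \<forall>r. r * x \<in> I \<and> x * r \<in> I)"

locale quaternion_algebra = algebra_over_field scaleK
  for scaleK :: "'k::field_char_0 \<Rightarrow> 'h::ring_1 \<Rightarrow> 'h" +
  assumes central: "(\<And>x. z * x = x * z) \<Longrightarrow> \<exists>a. z = scaleK a 1"
    and simple: "two_sided_ideal (I :: 'h set) \<Longrightarrow> I = {0} \<or> I = UNIV"
    and dim_four: "vector_space.dim scaleK (UNIV :: 'h set) = 4"

text \<open>A quaternion basis \<open>1, i, j, ij\<close>; its four members are automatically independent when the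
  algebra has dimension \<open>4\<close>.\<close>

definition quaternion_basis ::
  "('k::field_char_0 \<Rightarrow> 'h::ring_1 \<Rightarrow> 'h) \<Rightarrow> 'h \<Rightarrow> 'h \<Rightarrow> bool" where
  "quaternion_basis scaleK i j \<longleftrightarrow>
     (\<exists>a b. a \<noteq> 0 \<and> b \<noteq> 0 \<and> i * i = scaleK a 1 \<and> j * j = scaleK b 1) \<and>
     i * j = - (j * i) \<and> module.span scaleK {1, i, j, i * j} = UNIV"

definition quaternion_conjugation ::
  "('k::field_char_0 \<Rightarrow> 'h::ring_1 \<Rightarrow> 'h) \<Rightarrow> ('h \<Rightarrow> 'h) \<Rightarrow> bool" where
  "quaternion_conjugation scaleK s \<longleftrightarrow>
     (\<exists>i j. quaternion_basis scaleK i j \<and>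
       (\<forall>t x y z. s (scaleK t 1 + scaleK x i + scaleK y j + scaleK z (i * j)) =
                  scaleK t 1 - scaleK x i - scaleK y j - scaleK z (i * j)))"

definition orthogonal_involution ::
  "('k::field_char_0 \<Rightarrow> 'h::ring_1 \<Rightarrow> 'h) \<Rightarrow> ('h \<Rightarrow> 'h) \<Rightarrow> bool" where
  "orthogonal_involution scaleK s \<longleftrightarrow>
     Vector_Spaces.linear scaleK scaleK s \<and>
     (\<forall>x. s (s x) = x) \<and> (\<forall>x y. s (x * y) = s y * s x) \<and>
     \<not> quaternion_conjugation scaleK s"


section \<open>Orders\<close>

definition finitely_generated_over_integers ::
  "('k::field_char_0 \<Rightarrow> 'h::ring_1 \<Rightarrow> 'h) \<Rightarrow> 'h set \<Rightarrow> bool" where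
  "finitely_generated_over_integers scaleK L \<longleftrightarrow>
     (\<exists>B. finite B \<and>
       L = {\<Sum>b\<in>B. scaleK (c b) b | c. \<forall>b\<in>B. c b \<in> ring_of_integers})"

definition is_order :: "('k::field_char_0 \<Rightarrow> 'h::ring_1 \<Rightarrow> 'h) \<Rightarrow> 'h set \<Rightarrow> bool" where
  "is_order scaleK R \<longleftrightarrow>
     1 \<in> R \<and> (\<forall>x\<in>R. \<forall>y\<in>R. x - y \<in> R \<and> x * y \<in> R) \<and>
     finitely_generated_over_integers scaleK R \<and> module.span scaleK R = UNIV"

definition involution_order ::
  "('k::field_char_0 \<Rightarrow> 'h::ring_1 \<Rightarrow> 'h) \<Rightarrow> ('h \<Rightarrow> 'h) \<Rightarrow> 'h set \<Rightarrow> bool" where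
  "involution_order scaleK s R \<longleftrightarrow> is_order scaleK R \<and> (\<forall>x\<in>R. s x \<in> R)"

definition maximal_involution_order ::
  "('k::field_char_0 \<Rightarrow> 'h::ring_1 \<Rightarrow> 'h) \<Rightarrow> ('h \<Rightarrow> 'h) \<Rightarrow> 'h set \<Rightarrow> bool" where
  "maximal_involution_order scaleK s R \<longleftrightarrow>
     involution_order scaleK s R \<and> (\<forall>R'. involution_order scaleK s R' \<longrightarrow> \<not> R \<subset> R')"


section \<open>The twisted special linear group\<close>

definition hat :: "('h \<Rightarrow> 'h) \<Rightarrow> 'h::ring_1^2^2 \<Rightarrow> 'h^2^2" where
  "hat s M = vector [vector [s (M$2$2), - s (M$1$2)],
                     vector [- s (M$2$1), s (M$1$1)]]"

definition SL_inv :: "('h \<Rightarrow> 'h) \<Rightarrow> 'h::ring_1 set \<Rightarrow> ('h^2^2) set" where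
  "SL_inv s R = {M. (\<forall>i j. M$i$j \<in> R) \<and> M ** hat s M = mat 1}"

definition SL_inv_group :: "('h \<Rightarrow> 'h) \<Rightarrow> ('h::ring_1^2^2) monoid" where
  "SL_inv_group s = \<lparr>carrier = SL_inv s UNIV, mult = (**), one = mat 1\<rparr>"


section \<open>Arithmetic subgroups\<close>

definition GL_group :: "('k::field^'n^'n) monoid" where
  "GL_group = \<lparr>carrier = {A. invertible A}, mult = (**), one = mat 1\<rparr>"

definition GL_integers :: "('k::field_char_0^'n^'n) set" where
  "GL_integers = {A. (\<forall>i j. A$i$j \<in> ring_of_integers) \<and>
     (\<exists>B. (\<forall>i j. B$i$j \<in> ring_of_integers) \<and> A ** B = mat 1 \<and> B ** A = mat 1)}"

definition commensurable :: "('g, 'm) monoid_scheme \<Rightarrow> 'g set \<Rightarrow> 'g set \<Rightarrow> bool" where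
  "commensurable G A B \<longleftrightarrow> subgroup A G \<and> subgroup B G \<and>
     finite (rcosets\<^bsub>G\<lparr>carrier := A\<rparr>\<^esub> (A \<inter> B)) \<and>
     finite (rcosets\<^bsub>G\<lparr>carrier := B\<rparr>\<^esub> (A \<inter> B))"

text \<open>For a linear group \<open>G \<le> GL\<^sub>n(K)\<close>: the subgroups of \<open>G\<close> that are commensurable with
  the group \<open>G \<inter> GL\<^sub>n(\<oo>\<^sub>K)\<close> of integral points.\<close>

definition arithmetic_in_GL ::
  "('k::field_char_0^'n^'n) set \<Rightarrow> ('k^'n^'n) set \<Rightarrow> bool" where
  "arithmetic_in_GL G A \<longleftrightarrow>
     A \<subseteq> G \<and> commensurable GL_group A (G \<inter> GL_integers)"

definition indexed_basis ::
  "('k::field \<Rightarrow> 'h::ring_1 \<Rightarrow> 'h) \<Rightarrow> (4 \<Rightarrow> 'h) \<Rightarrow> bool" where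
  "indexed_basis scaleK e \<longleftrightarrow>
     inj e \<and> \<not> module.dependent scaleK (range e) \<and> module.span scaleK (range e) = UNIV"

text \<open>\<open>SL_inv s UNIV\<close> is a linear algebraic group through the action of \<open>2 \<times> 2\<close> matrices over \<open>H\<close>
  on the column space \<open>H\<^sup>2\<close>, an \<open>8\<close>-dimensional \<open>K\<close>-vector space. A basis \<open>e\<close> of \<open>H\<close> yields the
  basis of \<open>H\<^sup>2\<close> indexed by \<open>2 \<times> 4\<close>, whose \<open>(p, k)\<close>-th member has \<open>p\<close>-th entry \<open>e k\<close> and other
  entry \<open>0\<close>; \<open>regular_rep scaleK e M\<close> is the \<open>8 \<times> 8\<close> matrix of \<open>M\<close> in it.\<close>

definition regular_rep ::
  "('k::field \<Rightarrow> 'h::ring_1 \<Rightarrow> 'h) \<Rightarrow> (4 \<Rightarrow> 'h) \<Rightarrow> 'h^2^2 \<Rightarrow> 'k^(2 \<times> 4)^(2 \<times> 4)" where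
  "regular_rep scaleK e M =
     (\<chi> r c. module.representation scaleK (range e) (M $ fst r $ fst c * e (snd c)) (e (snd r)))"

lemma (in algebra_over_field) regular_rep_mult:
  assumes "indexed_basis scaleK e"
  shows "regular_rep scaleK e (M ** N) = regular_rep scaleK e M ** regular_rep scaleK e N"
proof -
  from assms have e: "inj e" "independent (range e)" "span (range e) = UNIV"
    by (auto simp: indexed_basis_def)
  have lin: "Vector_Spaces.linear scaleK (*) (\<lambda>v. representation (range e) v b)" for b
    using linear_representation e by blast
  have expand: "(\<Sum>k\<in>UNIV. scaleK (representation (range e) v (e k)) (e k)) = v" for v
  proof -
    have "(\<Sum>b\<in>range e. scaleK (representation (range e) v b) b) = v"
      by (rule sum_representation_eq) (use e in auto)
    then show ?thesis
      by (simp add: sum.reindex[OF e(1)])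
  qed
  have step: "representation (range e) (a * v) b =
      (\<Sum>k\<in>UNIV. representation (range e) (a * e k) b * representation (range e) v (e k))"
    for a v b
  proof -
    have "a * v = (\<Sum>k\<in>UNIV. scaleK (representation (range e) v (e k)) (a * e k))"
      by (subst expand[of v, symmetric]) (simp add: sum_distrib_left scale_mult_right)
    then show ?thesis
      using e by (simp add: representation_sum representation_scale mult.commute)
  qed
  have "regular_rep scaleK e (M ** N) $ (p, k) $ (q, l) =
      (regular_rep scaleK e M ** regular_rep scaleK e N) $ (p, k) $ (q, l)" for p q k l
  proof -
    let ?f = "\<lambda>m k'. representation (range e) (M$p$m * e k') (e k)
               * representation (range e) (N$m$q * e l) (e k')"
    have "(\<Sum>m\<in>UNIV. M$p$m * N$m$q) * e l = (\<Sum>m\<in>UNIV. M$p$m * (N$m$q * e l))"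
      by (simp add: sum_distrib_right mult.assoc)
    then have "regular_rep scaleK e (M ** N) $ (p, k) $ (q, l) =
        (\<Sum>m\<in>UNIV. representation (range e) (M$p$m * (N$m$q * e l)) (e k))"
      using e
      by (simp add: regular_rep_def matrix_matrix_mult_def representation_sum)
    also have "\<dots> = (\<Sum>m\<in>UNIV. \<Sum>k'\<in>UNIV. ?f m k')"
      by (intro sum.cong refl step)
    also have "\<dots> = (\<Sum>(m, k')\<in>UNIV. ?f m k')"
      by (simp only: sum.cartesian_product UNIV_Times_UNIV)
    also have "\<dots> = (regular_rep scaleK e M ** regular_rep scaleK e N) $ (p, k) $ (q, l)"
      by (simp add: regular_rep_def matrix_matrix_mult_def case_prod_unfold)
    finally show ?thesis .
  qed
  then show ?thesis
    unfolding vec_eq_iff by (metis surj_pair)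
qed

lemma (in algebra_over_field) regular_rep_inj:
  assumes "indexed_basis scaleK e"
  shows "inj (regular_rep scaleK e)"
proof (rule injI)
  fix M N assume eq: "regular_rep scaleK e M = regular_rep scaleK e N"
  from assms have e: "inj e" "independent (range e)" "span (range e) = UNIV"
    by (auto simp: indexed_basis_def)
  have expand: "(\<Sum>k\<in>UNIV. scaleK (representation (range e) v (e k)) (e k)) = v" for v
  proof -
    have "(\<Sum>b\<in>range e. scaleK (representation (range e) v b) b) = v"
      by (rule sum_representation_eq) (use e in auto)
    then show ?thesis
      by (simp add: sum.reindex[OF e(1)])
  qed
  have rep: "representation (range e) (M$p$q * e l) (e k) = representation (range e) (N$p$q * e l) (e k)"
    for p q k l
    using arg_cong[OF eq, of "\<lambda>A. A $ (p, k) $ (q, l)"] by (simp add: regular_rep_def)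
  have *: "M$p$q * e l = N$p$q * e l" for p q l
  proof -
    have "M$p$q * e l = (\<Sum>k\<in>UNIV. scaleK (representation (range e) (M$p$q * e l) (e k)) (e k))"
      by (rule expand[symmetric])
    also have "\<dots> = N$p$q * e l"
      unfolding rep by (rule expand)
    finally show ?thesis .
  qed
  have "M$p$q = N$p$q" for p q
  proof -
    have "M$p$q * (\<Sum>k\<in>UNIV. scaleK (representation (range e) 1 (e k)) (e k)) =
          N$p$q * (\<Sum>k\<in>UNIV. scaleK (representation (range e) 1 (e k)) (e k))"
      unfolding sum_distrib_left scale_mult_right * ..
    then show ?thesis by (simp add: expand)
  qed
  then show "M = N" by (simp add: vec_eq_iff)
qed

text \<open>Arithmeticity does not depend on the embedding into \<open>GL\<^sub>n\<close>, in particular not on the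
  choice of \<open>e\<close>.\<close>

definition arithmetic_subgroup ::
  "('k::field_char_0 \<Rightarrow> 'h::ring_1 \<Rightarrow> 'h) \<Rightarrow> ('h \<Rightarrow> 'h) \<Rightarrow> ('h^2^2) set \<Rightarrow> bool" where
  "arithmetic_subgroup scaleK s \<Gamma> \<longleftrightarrow>
     subgroup \<Gamma> (SL_inv_group s) \<and>
     (\<exists>e. indexed_basis scaleK e \<and>
       arithmetic_in_GL (regular_rep scaleK e ` SL_inv s UNIV) (regular_rep scaleK e ` \<Gamma>))"

end

theory Submission
  imports Defs "Jordan_Normal_Form.Char_Poly"
begin

text \<open>Call \<open>R\<^sup>+ = {x \<in> R. x\<^sup>\<ddagger> = x}\<close> the fixed part of an order \<open>R\<close>. The key point is that \<open>R\<^sup>+\<close>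
  determines the maximal involution order \<open>R\<close>: an involution order \<open>R'\<close> that contains \<open>R\<^sup>+\<close> lies in
  \<open>R\<close>. Indeed, \<open>z \<in> R\<close> as soon as \<open>z\<close> has integral norm, \<open>z\<^sup>\<ddagger> \<in> R + R z\<close> and
  all \<open>trd (z w)\<close>, \<open>w \<in> R\<close>, are integral, because then \<open>R + R z\<close> is an involution order. This
  applies to \<open>z = x - x\<^sup>\<ddagger>\<close> for \<open>x \<in> R'\<close>, since the square of \<open>trd (z w)\<close> is integral, and it yields the
  integrality of \<open>2 trd (x w)\<close>; so for \<open>z = x\<close> only the primes above \<open>2\<close> matter. Over a dyadic
  valuation ring \<open>V\<close> either the products of two fixed elements already generate the localization of \<open>R\<close>,
  which is then contained in that of \<open>R'\<close>, or the fixed part is \<open>V + V u + V v\<close> with all traces and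
  norms of \<open>u, v\<close> nonunits, and maximality shows that every element of integral trace and norm lies
  in the localization of \<open>R\<close>.

  Let \<open>\<Gamma>\<close> be an arithmetic group that contains \<open>SL\<^sup>\<ddagger>(2, R)\<close>. Its entries have a common denominator, so
  the span of \<open>\<Gamma>\<close> over the integers of \<open>K\<close> is a ring that is finitely generated as a module. It contains
  the elementary matrices over \<open>R\<^sup>+\<close>, in particular all matrix units, so it is \<open>Mat(2, R')\<close> for an
  involution order \<open>R'\<close> that contains \<open>R\<^sup>+\<close>. Hence \<open>R' \<subseteq> R\<close> and \<open>\<Gamma>\<close> is \<open>SL\<^sup>\<ddagger>(2, R)\<close>.\<close>

section \<open>Algebraic integers\<close>

text \<open>Why skew differences are easy: the skew elements form the line K (i * j), so the pairing
  of \<open>x - s x\<close> with \<open>w\<close> is governed by norms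
  (\<open>skew_trace_square\<close>). Splitting 2 w into \<open>w + s w\<close> and
  \<open>w - s w\<close> costs a factor 2, and this is where dyadic places enter. The obstacle
  throughout is that the integers of K need not be a principal ideal domain: orders need not be
  free, and finite generation of submodules has to be earned. Two devices serve in place of ideal
  theory. A subgroup A of a finite-dimensional rational space has a finite quotient A / N A, even
  when A is not finitely generated; with the pigeonhole principle this yields integrality from
  bounded denominators, finite generation, finite residue rings and finite index. And the fractional
  ideal (1, u) is invertible for every u, which makes localizations at maximal ideals valuation
  rings. Over these, one value of a linear functional divides all others, and triangular bases
  result.\<close>

lemma common_multiple_exists:
  assumes "finite S" and "\<And>s. s \<in> S \<Longrightarrow> \<exists>n>0. P s (n::nat)"
    and mult: "\<And>s n m. P s n \<Longrightarrow> 0 < m \<Longrightarrow> P s (n * m)"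
  shows "\<exists>N>0. \<forall>s\<in>S. P s N"
  using assms(1,2)
proof (induction S)
  case empty
  then show ?case by auto
next
  case (insert x S)
  then obtain N n where "N > 0" "\<forall>s\<in>S. P s N" "n > 0" "P x n"
    by (metis insertCI)
  then have "0 < N * n" "\<forall>s\<in>insert x S. P s (N * n)"
    using mult by (auto intro: mult) (metis mult mult.commute)
  then show ?case by blast
qed

interpretation zmod: Modules.module "\<lambda>(n::int) (x::'a::comm_ring_1). of_int n * x"
  by standard (auto simp: algebra_simps)

text \<open>Determinant trick: multiplication by \<open>t\<close> on the generators is an integer
  matrix that has the list of generators as eigenvector, so \<open>t\<close> is a root of its monic
  characteristic polynomial. The generators may be dependent; one nonzero member makes the vector
  nonzero.\<close>

lemma algebraic_int_if_stable:
  fixes t :: "'k::field_char_0"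
  assumes "finite M" and "\<And>m. m \<in> M \<Longrightarrow> t * m \<in> zmod.span M" and "\<exists>m\<in>M. m \<noteq> 0"
  shows "algebraic_int t"
proof -
  obtain ms where ms: "set ms = M" "distinct ms"
    using finite_distinct_list[OF assms(1)] by blast
  define n where "n = length ms"
  have "\<exists>u. t * m = (\<Sum>b\<in>M. of_int (u b) * b)" if "m \<in> M" for m
    using assms(2)[OF that] unfolding zmod.span_finite[OF assms(1)] by auto
  then obtain u where u: "t * m = (\<Sum>b\<in>M. of_int (u m b) * b)" if "m \<in> M" for m
    by metis
  define A :: "int mat" where "A = Matrix.mat n n (\<lambda>(i, j). u (ms ! i) (ms ! j))"
  define A' :: "'k mat" where "A' = map_mat of_int A"
  define v where "v = Matrix.vec n (\<lambda>i. ms ! i)"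
  have A: "A \<in> carrier_mat n n" and A': "A' \<in> carrier_mat n n"
    by (auto simp: A_def A'_def)
  have inj: "bij_betw (\<lambda>i. ms ! i) {..<n} M"
    unfolding n_def using ms bij_betw_nth by blast
  have "A' *\<^sub>v v = t \<cdot>\<^sub>v v"
  proof (rule eq_vecI)
    fix i assume "i < dim_vec (t \<cdot>\<^sub>v v)"
    then have i: "i < n" by (simp add: v_def)
    then have "ms ! i \<in> M" using ms n_def by auto
    have "vec_index (A' *\<^sub>v v) i = (\<Sum>j<n. of_int (u (ms ! i) (ms ! j)) * ms ! j)"
      using i by (auto simp: A'_def A_def v_def scalar_prod_def atLeast0LessThan)
    also have "\<dots> = (\<Sum>b\<in>M. of_int (u (ms ! i) b) * b)"
      by (rule sum.reindex_bij_betw[OF inj])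
    also have "\<dots> = t * ms ! i" using u \<open>ms ! i \<in> M\<close> by simp
    finally show "vec_index (A' *\<^sub>v v) i = vec_index (t \<cdot>\<^sub>v v) i"
      using i by (simp add: v_def)
  qed (auto simp: v_def A'_def A_def)
  moreover have "v \<noteq> 0\<^sub>v n"
  proof
    assume "v = 0\<^sub>v n"
    then have "ms ! i = 0" if "i < n" for i
      using that by (metis index_vec index_zero_vec(1) v_def)
    then show False using assms(3) ms by (metis in_set_conv_nth n_def)
  qed
  ultimately have "eigenvalue A' t"
    unfolding eigenvalue_def eigenvector_def using A' by (auto simp: v_def intro!: exI[of _ v])
  then have "poly (char_poly A') t = 0"
    using eigenvalue_root_char_poly[OF A'] by simp
  moreover have "char_poly A' = of_int_poly (char_poly A)"
    unfolding A'_def by (rule of_int_hom.char_poly_hom[OF A])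
  moreover have "lead_coeff (char_poly A') = 1"
    using degree_monic_char_poly[OF A'] by simp
  ultimately show ?thesis
    by (intro algebraic_int.intros[of "char_poly A'"]) auto
qed

lemma algebraic_int_relation:
  fixes x :: "'k::field_char_0"
  assumes "algebraic_int x"
  obtains n c where "0 < n" "x ^ n = (\<Sum>i<n. of_int (c i) * x ^ i)"
proof -
  obtain p where p: "poly p x = 0" "lead_coeff p = 1" "\<forall>i. coeff p i \<in> \<int>"
    using assms unfolding algebraic_int.simps by fast
  define n where "n = degree p"
  have "0 < n"
  proof (rule ccontr)
    assume "\<not> 0 < n"
    then have "degree p = 0" by (simp add: n_def)
    then obtain a where "p = [:a:]" by (rule degree_eq_zeroE)
    then show False using p(1,2) by simp
  qed
  have "\<forall>i. \<exists>c. coeff p i = of_int c"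
    using p(3) unfolding Ints_def by blast
  then obtain c where c: "\<And>i. coeff p i = of_int (c i)" by metis
  have "0 = (\<Sum>i\<le>n. coeff p i * x ^ i)"
    using poly_altdef[of p x] unfolding p(1) n_def .
  also have "{..n} = insert n {..<n}" by auto
  also have "(\<Sum>i\<in>insert n {..<n}. coeff p i * x ^ i) = x ^ n + (\<Sum>i<n. of_int (c i) * x ^ i)"
    using p(2) by (simp add: n_def c)
  finally have "x ^ n + (\<Sum>i<n. of_int (c i) * x ^ i) = 0" by (rule sym)
  then have "x ^ n = (\<Sum>i<n. of_int (- c i) * x ^ i)"
    by (simp only: of_int_minus mult_minus_left sum_negf eq_neg_iff_add_eq_0)
  then show thesis by (rule that[OF \<open>0 < n\<close>])
qed

text \<open>The last hypothesis says that \<open>y\<close> is integral over Z[x], with unrestricted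
  powers of \<open>x\<close>. Besides sums and products this form covers square roots (with the
  square as \<open>x\<close>) and elements with an integral difference of two powers.\<close>

lemma algebraic_int_pair:
  fixes x y :: "'k::field_char_0"
  assumes "algebraic_int x" and m: "0 < m"
    and y: "y ^ m \<in> zmod.span {x ^ i * y ^ j | i j. j < m}"
  shows "algebraic_int y" "algebraic_int (x + y)" "algebraic_int (x * y)"
proof -
  obtain n c where "0 < n" and xn: "x ^ n = (\<Sum>i<n. of_int (c i) * x ^ i)"
    using algebraic_int_relation[OF assms(1)] .
  define M where "M = (\<lambda>(i, j). x ^ i * y ^ j) ` ({..<n} \<times> {..<m})"
  have fin: "finite M" by (simp add: M_def)
  have 1: "1 \<in> M" using \<open>0 < n\<close> m by (force simp: M_def)
  have mem: "x ^ i * y ^ j \<in> zmod.span M" if "j < m" for i j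
  proof (induction i rule: less_induct)
    case (less i)
    show ?case
    proof (cases "i < n")
      case True
      then show ?thesis using that by (intro zmod.span_base) (auto simp: M_def)
    next
      case False
      have "x ^ i * y ^ j = x ^ (i - n) * x ^ n * y ^ j"
        using False by (simp flip: power_add)
      also have "\<dots> = (\<Sum>k<n. of_int (c k) * (x ^ (i - n + k) * y ^ j))"
        by (subst xn) (simp add: sum_distrib_left sum_distrib_right power_add mult_ac)
      also have "\<dots> \<in> zmod.span M"
        using False by (intro zmod.span_sum zmod.span_scale less) auto
      finally show ?thesis .
    qed
  qed
  \<comment> \<open>The multipliers that preserve the module generated by the n m monomials in
    \<open>M\<close>; each of them is integral by the determinant trick.\<close>
  define Q where "Q = {z. \<forall>b\<in>zmod.span M. z * b \<in> zmod.span M}"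
  have QI: "z \<in> Q" if "\<And>b. b \<in> M \<Longrightarrow> z * b \<in> zmod.span M" for z
    unfolding Q_def
  proof safe
    fix b assume "b \<in> zmod.span M"
    then show "z * b \<in> zmod.span M"
    proof (induction rule: zmod.span_induct_alt)
      case (step c x y)
      have "z * (of_int c * x + y) = of_int c * (z * x) + z * y"
        by (simp add: algebra_simps)
      then show ?case using step that by (metis zmod.span_add zmod.span_scale)
    qed (simp add: zmod.span_zero)
  qed
  have xQ: "x \<in> Q"
  proof (rule QI)
    fix b assume "b \<in> M"
    then obtain i j where b: "b = x ^ i * y ^ j" "j < m" by (auto simp: M_def)
    then show "x * b \<in> zmod.span M" using mem[of j "Suc i"] by (simp add: mult_ac)
  qed
  then have xQ': "x ^ i * b \<in> zmod.span M" if "b \<in> zmod.span M" for b i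
    using that
  proof (induction i)
    case (Suc i)
    then have "x * (x ^ i * b) \<in> zmod.span M" using xQ by (auto simp: Q_def)
    then show ?case by (simp add: mult.assoc)
  qed simp
  have yQ: "y \<in> Q"
  proof (rule QI)
    fix b assume "b \<in> M"
    then obtain i j where b: "b = x ^ i * y ^ j" "j < m" by (auto simp: M_def)
    have yb: "y * b = x ^ i * y ^ Suc j" using b by (simp add: mult_ac)
    show "y * b \<in> zmod.span M"
    proof (cases "Suc j < m")
      case True
      then show ?thesis unfolding yb by (rule mem)
    next
      case False
      then have "Suc j = m" using b by simp
      have "{x ^ i * y ^ j | i j. j < m} \<subseteq> zmod.span M" using mem by auto
      then have "y ^ m \<in> zmod.span M"
        using y zmod.span_minimal zmod.subspace_span by blast
      then show ?thesis unfolding yb \<open>Suc j = m\<close> by (rule xQ')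
    qed
  qed
  have alg: "algebraic_int z" if "z \<in> Q" for z
    using that 1 by (intro algebraic_int_if_stable[OF fin] bexI[of _ 1]) (auto simp: Q_def zmod.span_base)
  show "algebraic_int y" using alg yQ by simp
  have "(x + y) * b \<in> zmod.span M" "x * y * b \<in> zmod.span M" if "b \<in> zmod.span M" for b
    using that xQ yQ zmod.span_add[of "x * b" M "y * b"] unfolding Q_def distrib_right mult.assoc
    by blast+
  then show "algebraic_int (x + y)" "algebraic_int (x * y)"
    unfolding atomize_all by (auto intro!: alg simp only: Q_def mem_Collect_eq)
qed

lemma algebraic_int_plus_times:
  fixes x y :: "'k::field_char_0"
  assumes "algebraic_int x" "algebraic_int y"
  shows "algebraic_int (x + y) \<and> algebraic_int (x * y)"
proof -
  obtain n c where "0 < n" and "y ^ n = (\<Sum>i<n. of_int (c i) * y ^ i)"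
    using algebraic_int_relation[OF assms(2)] .
  note this(2)
  also have "\<dots> \<in> zmod.span {x ^ i * y ^ j | i j. j < n}"
    by (intro zmod.span_sum zmod.span_scale zmod.span_base, intro CollectI, rule exI[of _ 0]) auto
  finally show ?thesis
    using algebraic_int_pair[OF assms(1) \<open>0 < n\<close>] by blast
qed

abbreviation (input) oK :: "'k::field_char_0 set" where "oK \<equiv> ring_of_integers"

lemma oK_add [intro]: "x \<in> oK \<Longrightarrow> y \<in> oK \<Longrightarrow> x + y \<in> oK"
  and oK_mult [intro]: "x \<in> oK \<Longrightarrow> y \<in> oK \<Longrightarrow> x * y \<in> oK"
  unfolding ring_of_integers_def mem_Collect_eq by (simp_all add: algebraic_int_plus_times)

lemma oK_minus [intro]: "x \<in> oK \<Longrightarrow> - x \<in> oK"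
  by (simp add: ring_of_integers_def)

lemma oK_diff [intro]: "x \<in> oK \<Longrightarrow> y \<in> oK \<Longrightarrow> x - y \<in> oK"
  using oK_add[of x "- y"] oK_minus[of y] by simp

lemma oK_0 [simp]: "0 \<in> oK" and oK_1 [simp]: "1 \<in> oK"
  and oK_of_int [simp]: "of_int n \<in> oK" and oK_of_nat [simp]: "of_nat m \<in> oK"
  and oK_numeral [simp]: "numeral w \<in> oK"
  by (simp_all add: ring_of_integers_def int_imp_algebraic_int)

lemma oK_power: "x \<in> oK \<Longrightarrow> x ^ n \<in> oK"
  by (induction n) auto

lemma monomial_in_span: "j < m \<Longrightarrow> x ^ i * y ^ j \<in> zmod.span {x ^ i * y ^ j | i j. j < m}"
  by (rule zmod.span_base) blast

lemma oK_sqrt: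
  assumes "x ^ 2 \<in> oK" shows "x \<in> oK"
proof -
  have "x ^ 2 \<in> zmod.span {(x ^ 2) ^ i * x ^ j | i j. j < 2}"
    using monomial_in_span[OF pos2, of "x ^ 2" 1 x] unfolding power_0 power_one_right mult_1_right .
  moreover have "algebraic_int (x ^ 2)" using assms by (simp only: ring_of_integers_def mem_Collect_eq)
  ultimately have "algebraic_int x" using algebraic_int_pair(1)[of "x ^ 2" 2 x] pos2 by blast
  then show ?thesis by (simp only: ring_of_integers_def mem_Collect_eq)
qed

text \<open>\<open>x\<close> is a root of X^j - X^i + c with c integral, hence integral over Z[c].
  Pigeonhole arguments on powers produce such differences.\<close>

lemma oK_if_power_diff:
  assumes "x ^ i - x ^ j \<in> oK" "i < j" shows "x \<in> oK"
proof -
  define c where "c = x ^ i - x ^ j"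
  have "x ^ i \<in> zmod.span {c ^ k * x ^ l | k l. l < j}"
    using monomial_in_span[OF assms(2), of c 0 x] unfolding power_0 mult_1 .
  moreover have "c \<in> zmod.span {c ^ k * x ^ l | k l. l < j}"
    using monomial_in_span[of 0 j c 1 x] assms(2) unfolding power_0 power_one_right mult_1_right by fast
  ultimately have "x ^ i - c \<in> zmod.span {c ^ k * x ^ l | k l. l < j}"
    by (rule zmod.span_diff)
  moreover have "x ^ i - c = x ^ j" by (simp add: c_def)
  ultimately have "x ^ j \<in> zmod.span {c ^ k * x ^ l | k l. l < j}" by (simp only:)
  moreover have "algebraic_int c" using assms by (simp only: c_def ring_of_integers_def mem_Collect_eq)
  moreover have "0 < j" using assms(2) by simp
  ultimately have "algebraic_int x" by (rule algebraic_int_pair(1)[rotated 2])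
  then show ?thesis by (simp only: ring_of_integers_def mem_Collect_eq)
qed

section \<open>Finite quotients of subgroups of rational vector spaces\<close>

text \<open>The aim is that A / N A is finite for every subgroup A of a finite-dimensional rational
  space. No finite generation is assumed, so this applies to the integers of a number field before
  anything about their structure is known.\<close>

locale rat_space = Vector_Spaces.vector_space scale
  for scale :: "rat \<Rightarrow> 'v::ab_group_add \<Rightarrow> 'v"
begin

definition subgroup_set :: "'v set \<Rightarrow> bool" where
  "subgroup_set A \<longleftrightarrow> 0 \<in> A \<and> (\<forall>x\<in>A. \<forall>y\<in>A. x - y \<in> A)"

lemma subgroup_set_add:
  assumes "subgroup_set A" "x \<in> A" "y \<in> A" shows "x + y \<in> A"
proof -
  have "0 - y \<in> A" using assms unfolding subgroup_set_def by blast
  then have "x - (0 - y) \<in> A" using assms unfolding subgroup_set_def by blast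
  then show ?thesis by simp
qed

lemma subgroup_set_uminus: "subgroup_set A \<Longrightarrow> x \<in> A \<Longrightarrow> - x \<in> A"
  unfolding subgroup_set_def by (metis diff_0)

lemma subgroup_set_scale:
  assumes "subgroup_set A" "x \<in> A" shows "scale (of_int n) x \<in> A"
proof -
  have "scale (of_nat m) x \<in> A" for m
    by (induction m) (use assms in \<open>auto simp: subgroup_set_def scale_left_distrib intro: subgroup_set_add[OF assms(1)]\<close>)
  then show ?thesis
    using subgroup_set_uminus[OF assms(1)] by (cases n rule: int_cases2) (auto simp del: of_nat_Suc)
qed

lemma subgroup_set_sum: "subgroup_set A \<Longrightarrow> (\<And>i. i \<in> I \<Longrightarrow> f i \<in> A) \<Longrightarrow> sum f I \<in> A"
  by (induction I rule: infinite_finite_induct) (auto simp: subgroup_set_add subgroup_set_def)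

text \<open>Linear independence of the images of \<open>S\<close> in A / p A over the field with p
  elements, expressed by integer coefficients.\<close>

definition indep_mod :: "'v set \<Rightarrow> nat \<Rightarrow> 'v set \<Rightarrow> bool" where
  "indep_mod A p S \<longleftrightarrow> finite S \<and> S \<subseteq> A \<and>
     (\<forall>c a. a \<in> A \<longrightarrow> (\<Sum>s\<in>S. scale (of_int (c s)) s) = scale (of_nat p) a \<longrightarrow> (\<forall>s\<in>S. int p dvd c s))"

text \<open>Descent: all coefficients of a relation with value 0 are divisible by p, and dividing by
  p gives another such relation with smaller coefficients.\<close>

lemma indep_mod_relation:
  assumes "subgroup_set A" "indep_mod A p S" "1 < p"
    and "(\<Sum>s\<in>S. scale (of_int (c s)) s) = 0" "t \<in> S"
  shows "c t = 0"
  using assms(4)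
proof (induction "nat \<bar>c t\<bar>" arbitrary: c rule: less_induct)
  case less
  have "0 \<in> A" using assms(1) by (simp add: subgroup_set_def)
  then have "int p dvd c s" if "s \<in> S" for s
    using assms(2) less.prems that unfolding indep_mod_def by (metis scale_zero_right)
  then have c: "c s = int p * (c s div int p)" if "s \<in> S" for s
    using that by simp
  define d where "d s = c s div int p" for s
  have "scale (of_nat p) (\<Sum>s\<in>S. scale (of_int (d s)) s) = (\<Sum>s\<in>S. scale (of_int (c s)) s)"
    unfolding scale_sum_right
  proof (rule sum.cong)
    fix s assume "s \<in> S"
    show "scale (of_nat p) (scale (of_int (d s)) s) = scale (of_int (c s)) s"
      using c[OF \<open>s \<in> S\<close>] unfolding d_def scale_scale
      by (metis of_int_mult of_int_of_nat_eq)
  qed simp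
  then have "(\<Sum>s\<in>S. scale (of_int (d s)) s) = 0"
    using less.prems assms(3) by simp
  moreover have "nat \<bar>d t\<bar> < nat \<bar>c t\<bar>" if "c t \<noteq> 0"
  proof -
    have ct: "c t = int p * d t" using c[OF assms(5)] by (simp add: d_def)
    then have "d t \<noteq> 0" using that by auto
    moreover have "\<bar>c t\<bar> = int p * \<bar>d t\<bar>" using ct by (simp add: abs_mult)
    moreover have "1 * \<bar>d t\<bar> < int p * \<bar>d t\<bar>"
      using assms(3) \<open>d t \<noteq> 0\<close> by (intro mult_strict_right_mono) auto
    ultimately show ?thesis by simp
  qed
  ultimately show ?case
    using less.hyps[of d] c[OF assms(5)] by (cases "c t = 0") (auto simp: d_def)
qed

lemma indep_mod_independent:
  assumes "subgroup_set A" "indep_mod A p S" "1 < p"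
  shows "independent S"
proof
  assume "dependent S"
  moreover have fin: "finite S" using assms(2) by (simp add: indep_mod_def)
  ultimately obtain u t where u: "(\<Sum>s\<in>S. scale (u s) s) = 0" "t \<in> S" "u t \<noteq> 0"
    by (auto simp: dependent_finite)
  have "\<exists>N>0. \<forall>s\<in>S. of_nat N * u s \<in> \<int>"
  proof (rule common_multiple_exists[OF fin])
    fix s
    obtain a b where "quotient_of (u s) = (a, b)" by fastforce
    then have "b > 0" "u s = of_int a / of_int b"
      by (auto dest: quotient_of_denom_pos quotient_of_div)
    then have "of_nat (nat b) * u s = of_int a" by simp
    then have "of_nat (nat b) * u s \<in> \<int>" by (simp only: Ints_of_int)
    then show "\<exists>n>0. of_nat n * u s \<in> \<int>"
      using \<open>b > 0\<close> by (metis zero_less_nat_eq)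
  next
    fix s n m assume "of_nat n * u s \<in> \<int>"
    then have "of_nat m * (of_nat n * u s) \<in> \<int>" by (rule Ints_mult[OF Ints_of_nat])
    then show "of_nat (n * m) * u s \<in> \<int>" by (simp add: mult_ac)
  qed
  then obtain N :: nat where N: "N > 0" "\<forall>s\<in>S. of_nat N * u s \<in> \<int>" by blast
  then have "\<forall>s\<in>S. \<exists>c. of_nat N * u s = of_int c" by (auto simp: Ints_def)
  then obtain c where c: "\<And>s. s \<in> S \<Longrightarrow> of_nat N * u s = of_int (c s)" by metis
  have "(\<Sum>s\<in>S. scale (of_int (c s)) s) = (\<Sum>s\<in>S. scale (of_nat N) (scale (u s) s))"
    by (rule sum.cong) (auto simp: c[symmetric])
  also have "\<dots> = 0" using u(1) by (simp add: scale_sum_right[symmetric] del: scale_scale)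
  finally have "c t = 0" using indep_mod_relation[OF assms] u(2) by blast
  then show False using c[OF u(2)] u(3) N(1) by simp
qed

text \<open>Independence modulo p implies independence over the rationals, so the rational dimension
  bounds the size of sets independent modulo p, and one of maximal size spans A / p A.\<close>

lemma finite_quotient_prime:
  assumes "finite B" "span B = UNIV" "subgroup_set A" "prime p"
  shows "\<exists>F. finite F \<and> F \<subseteq> A \<and> (\<forall>x\<in>A. \<exists>f\<in>F. \<exists>y\<in>A. x = f + scale (of_nat p) y)"
proof -
  have p1: "1 < p" using assms(4) prime_gt_1_nat by blast
  have bound: "card S \<le> card B" if "indep_mod A p S" for S
    using independent_span_bound[OF assms(1) indep_mod_independent[OF assms(3) that p1]] assms(2)
    by auto
  have "indep_mod A p {}" by (simp add: indep_mod_def)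
  then have "\<exists>S. indep_mod A p S \<and> (\<forall>T. indep_mod A p T \<longrightarrow> card T \<le> card S)"
    using ex_has_greatest_nat[of "indep_mod A p" "{}" card "Suc (card B)"] bound
    by (simp add: less_Suc_eq_le)
  then obtain S where S: "indep_mod A p S" and max: "\<And>T. indep_mod A p T \<Longrightarrow> card T \<le> card S" by blast
  have finS: "finite S" and SA: "S \<subseteq> A" using S by (auto simp: indep_mod_def)
  have Aint: "scale (of_int n) x \<in> A" if "x \<in> A" for n x using subgroup_set_scale[OF assms(3) that] .
  have comb: "\<exists>c. \<exists>a\<in>A. x = (\<Sum>s\<in>S. scale (of_int (c s)) s) + scale (of_nat p) a" if "x \<in> A" for x
  proof (cases "x \<in> S")
    case True
    have "x = (\<Sum>s\<in>S. scale (of_int (if s = x then 1 else 0)) s) + scale (of_nat p) 0"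
      using True finS by (simp add: if_distrib[of of_int] if_distrib[of "\<lambda>c. scale c _"] cong: if_cong)
    moreover have "0 \<in> A" using assms(3) by (simp add: subgroup_set_def)
    ultimately show ?thesis by (intro exI[of _ "\<lambda>s. if s = x then 1 else 0"] bexI[of _ 0])
  next
    case False
    then have "\<not> indep_mod A p (insert x S)"
      using max[of "insert x S"] finS by auto
    then obtain c a s where a: "a \<in> A" and rel: "(\<Sum>s\<in>insert x S. scale (of_int (c s)) s) = scale (of_nat p) a"
      and s: "s \<in> insert x S" "\<not> int p dvd c s"
      using finS SA \<open>x \<in> A\<close> unfolding indep_mod_def by auto
    have rel': "scale (of_int (c x)) x + (\<Sum>s\<in>S. scale (of_int (c s)) s) = scale (of_nat p) a"
      using rel False finS by simp
    have "\<not> int p dvd c x"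
    proof
      assume "int p dvd c x"
      then obtain m where m: "c x = int p * m" by blast
      have "(\<Sum>s\<in>S. scale (of_int (c s)) s) = scale (of_nat p) (a - scale (of_int m) x)"
        using rel' by (simp add: m scale_right_diff_distrib algebra_simps)
      moreover have "a - scale (of_int m) x \<in> A"
        using a Aint[OF \<open>x \<in> A\<close>] assms(3) by (simp add: subgroup_set_def)
      ultimately have "\<forall>s\<in>S. int p dvd c s"
        using S unfolding indep_mod_def by blast
      then show False using s \<open>int p dvd c x\<close> by blast
    qed
    then have "coprime (c x) (int p)"
      using assms(4) by (metis coprime_commute prime_imp_coprime prime_nat_int_transfer)
    \<comment> \<open>Bezout inverts \<open>c x\<close> modulo p, so the relation can be solved for
      \<open>x\<close>.\<close>
    then obtain m k where mk: "m * c x + k * int p = 1"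
      by (metis bezout_int coprime_imp_gcd_eq_1)
    define T where "T = (\<Sum>s\<in>S. scale (of_int (- (m * c s))) s)"
    have T: "T = - scale (of_int m) (\<Sum>s\<in>S. scale (of_int (c s)) s)"
      by (simp add: T_def scale_sum_right sum_negf)
    have "x = scale (of_int (m * c x + k * int p)) x" by (simp add: mk)
    also have "\<dots> = scale (of_int m) (scale (of_int (c x)) x) + scale (of_nat p) (scale (of_int k) x)"
      by (simp add: scale_left_distrib mult.commute)
    also have "scale (of_int (c x)) x = scale (of_nat p) a - (\<Sum>s\<in>S. scale (of_int (c s)) s)"
      using rel' by (simp add: algebra_simps)
    finally have "x = T + scale (of_nat p) (scale (of_int m) a + scale (of_int k) x)"
      unfolding T by (simp add: scale_right_diff_distrib scale_right_distrib algebra_simps)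
    moreover have "scale (of_int m) a + scale (of_int k) x \<in> A"
      using subgroup_set_add[OF assms(3)] Aint a \<open>x \<in> A\<close> by blast
    ultimately show ?thesis unfolding T_def by (intro exI[of _ "\<lambda>s. - (m * c s)"] bexI)
  qed
  define F where "F = (\<lambda>c. \<Sum>s\<in>S. scale (of_int (c s)) s) ` (Pi\<^sub>E S (\<lambda>_. {0..<int p}))"
  have "finite F" unfolding F_def using finS by (intro finite_imageI finite_PiE) auto
  moreover have "F \<subseteq> A"
    unfolding F_def using SA Aint by (auto intro!: subgroup_set_sum[OF assms(3)])
  moreover have "\<exists>f\<in>F. \<exists>y\<in>A. x = f + scale (of_nat p) y" if "x \<in> A" for x
  proof -
    obtain c a where a: "a \<in> A" and x: "x = (\<Sum>s\<in>S. scale (of_int (c s)) s) + scale (of_nat p) a"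
      using comb[OF \<open>x \<in> A\<close>] by blast
    define d where "d = restrict (\<lambda>s. c s mod int p) S"
    have "d \<in> Pi\<^sub>E S (\<lambda>_. {0..<int p})" using p1 by (auto simp: d_def)
    moreover have "x = (\<Sum>s\<in>S. scale (of_int (d s)) s) +
       scale (of_nat p) (a + (\<Sum>s\<in>S. scale (of_int (c s div int p)) s))"
    proof -
      have "(\<Sum>s\<in>S. scale (of_int (c s)) s) =
          (\<Sum>s\<in>S. scale (of_int (d s)) s + scale (of_nat p) (scale (of_int (c s div int p)) s))"
      proof (rule sum.cong)
        fix s assume s: "s \<in> S"
        have "of_int (c s) = (of_int (d s + int p * (c s div int p)) :: rat)"
          using s by (simp add: d_def)
        then show "scale (of_int (c s)) s = scale (of_int (d s)) s + scale (of_nat p) (scale (of_int (c s div int p)) s)"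
          by (simp add: scale_left_distrib)
      qed simp
      then show ?thesis
        unfolding x by (simp add: sum.distrib scale_right_distrib scale_sum_right del: scale_scale)
    qed
    moreover have "a + (\<Sum>s\<in>S. scale (of_int (c s div int p)) s) \<in> A"
      using a SA Aint by (intro subgroup_set_add[OF assms(3)] subgroup_set_sum[OF assms(3)]) auto
    ultimately show ?thesis unfolding F_def by blast
  qed
  ultimately show ?thesis by blast
qed

lemma finite_quotient:
  assumes "finite B" "span B = UNIV" "subgroup_set A" "0 < N"
  shows "\<exists>F. finite F \<and> F \<subseteq> A \<and> (\<forall>x\<in>A. \<exists>f\<in>F. \<exists>y\<in>A. x = f + scale (of_nat N) y)"
  using assms(4)
proof (induction N rule: less_induct)
  case (less N)
  show ?case
  proof (cases "N = 1")
    case True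
    then show ?thesis
      using assms(3) by (intro exI[of _ "{0}"]) (auto simp: subgroup_set_def)
  next
    case False
    then obtain p where p: "prime p" "p dvd N" using prime_factor_nat by blast
    then obtain M where M: "N = p * M" by blast
    then have "0 < M" using less.prems by (cases M) auto
    have "M < N" using prime_gt_1_nat[OF p(1)] \<open>0 < M\<close> unfolding M by simp
    then obtain F where F: "finite F" "F \<subseteq> A" "\<forall>x\<in>A. \<exists>f\<in>F. \<exists>y\<in>A. x = f + scale (of_nat M) y"
      using less.IH[OF \<open>M < N\<close> \<open>0 < M\<close>] by blast
    obtain E where E: "finite E" "E \<subseteq> A" "\<forall>x\<in>A. \<exists>f\<in>E. \<exists>y\<in>A. x = f + scale (of_nat p) y"
      using finite_quotient_prime[OF assms(1-3) p(1)] by blast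
    \<comment> \<open>Representatives modulo p M: a digit modulo p, then p times a representative
      modulo M.\<close>
    define G where "G = (\<lambda>(e, f). e + scale (of_nat p) f) ` (E \<times> F)"
    have "finite G" using E F by (simp add: G_def)
    moreover have "G \<subseteq> A"
    proof
      fix x assume "x \<in> G"
      then obtain e f where "e \<in> A" "f \<in> A" "x = e + scale (of_nat p) f"
        using E(2) F(2) by (auto simp: G_def)
      then show "x \<in> A"
        using subgroup_set_add[OF assms(3)] subgroup_set_scale[OF assms(3), of f "int p"] by simp
    qed
    moreover have "\<exists>f\<in>G. \<exists>y\<in>A. x = f + scale (of_nat N) y" if "x \<in> A" for x
    proof -
      obtain e y where e: "e \<in> E" "y \<in> A" "x = e + scale (of_nat p) y" using E(3) \<open>x \<in> A\<close> by blast
      obtain f z where f: "f \<in> F" "z \<in> A" "y = f + scale (of_nat M) z" using F(3) e(2) by blast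
      have "x = (e + scale (of_nat p) f) + scale (of_nat N) z"
        unfolding e(3) f(3) M by (simp add: scale_right_distrib add.assoc)
      moreover have "e + scale (of_nat p) f \<in> G" using e f by (auto simp: G_def)
      ultimately show ?thesis using f(2) by blast
    qed
    ultimately show ?thesis by blast
  qed
qed

end

section \<open>Number fields\<close>

interpretation ratK: rat_space "\<lambda>q (x::'k::field_char_0). of_rat q * x"
  by standard (auto simp: algebra_simps of_rat_add of_rat_mult)

definition is_subring :: "'k::comm_ring_1 set \<Rightarrow> bool" where
  "is_subring A \<longleftrightarrow> 0 \<in> A \<and> 1 \<in> A \<and> (\<forall>x\<in>A. \<forall>y\<in>A. x + y \<in> A \<and> x * y \<in> A \<and> - x \<in> A)"

lemma is_subring_oK: "is_subring oK"
  by (auto simp: is_subring_def)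

lemma number_field_algebraic:
  assumes "number_field TYPE('k::field_char_0)" shows "algebraic (x::'k)"
proof -
  obtain B :: "'k set" where B: "finite B" "ratK.span B = UNIV"
    using assms unfolding number_field_def by blast
  define n where "n = card B"
  show ?thesis
  \<comment> \<open>Two equal powers already give an equation; otherwise the powers are distinct and
    can be counted against the dimension.\<close>
  proof (cases "inj_on (\<lambda>i. x ^ i) {..n}")
    case False
    then obtain i j where ij: "i \<noteq> j" "x ^ i = x ^ j" by (auto simp: inj_on_def)
    let ?p = "monom (1::'k) i - monom 1 j"
    have "coeff ?p i = 1" using ij by simp
    then have "?p \<noteq> 0" by (metis coeff_0 zero_neq_one)
    moreover have "poly ?p x = 0" using ij by (simp add: poly_monom)
    ultimately show ?thesis
      by (intro algebraicI'[of ?p]) auto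
  next
    case True
    let ?S = "(\<lambda>i. x ^ i) ` {..n}"
    have "card ?S = Suc n" using True by (simp add: card_image)
    then have "ratK.dependent ?S"
      using ratK.independent_span_bound[OF B(1), of ?S] B(2) n_def by auto
    then obtain u v where u: "(\<Sum>v\<in>?S. of_rat (u v) * v) = 0" "v \<in> ?S" "u v \<noteq> 0"
      by (auto simp: ratK.dependent_finite)
    then obtain k where k: "k \<le> n" "v = x ^ k" by auto
    define p where "p = (\<Sum>i\<le>n. monom (of_rat (u (x ^ i)) :: 'k) i)"
    have c: "coeff p i = (if i \<le> n then of_rat (u (x ^ i)) else 0)" for i
      by (simp add: p_def coeff_sum)
    have "coeff p k \<noteq> 0" using k u by (simp add: c)
    then have "p \<noteq> 0" by auto
    moreover have "poly p x = 0"
      using u(1) True by (simp add: p_def poly_sum poly_monom sum.reindex)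
    ultimately show ?thesis
      by (intro algebraicI'[of p]) (auto simp: c)
  qed
qed

lemma gcd_list_in_subgroup:
  fixes I :: "int set"
  assumes "0 \<in> I" and "\<And>x y. x \<in> I \<Longrightarrow> y \<in> I \<Longrightarrow> x + y \<in> I" and "\<And>x c. x \<in> I \<Longrightarrow> c * x \<in> I"
  shows "set xs \<subseteq> I \<Longrightarrow> gcd_list xs \<in> I"
proof (induction xs)
  case (Cons a xs)
  obtain u v where "u * a + v * gcd_list xs = gcd a (gcd_list xs)" using bezout_int by blast
  moreover have "u * a + v * gcd_list xs \<in> I" using Cons assms by auto
  ultimately show ?case by simp
qed (use assms in auto)

text \<open>The partial Horner values \<open>b i\<close> of a primitive integer polynomial at a root \<open>u\<close> are integral,
  and the coefficients are the \<open>b i - u * b (i - 1)\<close>. So the ideal generated by the \<open>b i\<close> is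
  inverse to \<open>(1, u)\<close>.\<close>

lemma integers_Pruefer:
  assumes "algebraic (u::'k::field_char_0)"
  obtains p q where "p \<in> oK" "q \<in> oK" "p * u \<in> oK" "q * u \<in> oK" "p + q * u = 1"
proof -
  obtain f :: "int poly" where f: "f \<noteq> 0" "poly (of_int_poly f) u = 0"
    using assms by (rule algebraicE')
  \<comment> \<open>Content 1 is what will put 1 into the subgroup \<open>T\<close> below.\<close>
  define g where "g = primitive_part f"
  have "f = Polynomial.smult (content f) g" by (simp add: g_def)
  then have "poly (of_int_poly f) u = of_int (content f) * poly (of_int_poly g) u"
    by (metis of_int_hom.map_poly_hom_smult poly_smult)
  moreover have "content f \<noteq> 0" using f(1) by simp
  ultimately have root: "poly (of_int_poly g) u = 0" using f(2) by simp
  have "g \<noteq> 0" using f(1) by (simp add: g_def)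
  have content: "content g = 1" using f(1) by (simp add: g_def)
  define n where "n = degree g"
  define c where "c i = coeff g i" for i
  have sum0: "(\<Sum>j\<le>n. of_int (c j) * u ^ j) = 0"
    using root by (simp add: poly_altdef n_def c_def)
  have "n \<noteq> 0"
  proof
    assume "n = 0"
    then have "c 0 = 0" using sum0 by simp
    then show False using \<open>g \<noteq> 0\<close> \<open>n = 0\<close> by (metis c_def leading_coeff_0_iff n_def)
  qed
  define b where "b i = (\<Sum>j\<le>i. of_int (c (n - i + j)) * u ^ j)" for i
  have b_Suc: "b (Suc i) = of_int (c (n - Suc i)) + u * b i" if "i < n" for i
  proof -
    have "n - Suc i + Suc j = n - i + j" for j using that by simp
    then have "(\<Sum>j\<le>i. of_int (c (n - Suc i + Suc j)) * u ^ Suc j) = u * (\<Sum>j\<le>i. of_int (c (n - i + j)) * u ^ j)"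
      unfolding sum_distrib_left by (intro sum.cong refl) (simp only: power_Suc mult_ac)
    then show ?thesis
      unfolding b_def sum.atMost_Suc_shift by (simp only: add_0_right power_0 mult_1_right)
  qed
  \<comment> \<open>The whole polynomial vanishes at \<open>u\<close>, so its top part equals minus
    its bottom part. This keeps each b i u^k inside the span of 1, ..., u^(n - 1).\<close>
  have b_top: "b i * u ^ (n - i) = - (\<Sum>j<n - i. of_int (c j) * u ^ j)" if "i \<le> n" for i
  proof -
    have "(\<Sum>j\<le>n. of_int (c j) * u ^ j) = (\<Sum>j<n - i. of_int (c j) * u ^ j) + (\<Sum>j=n - i..n. of_int (c j) * u ^ j)"
    proof -
      have "{..n} = {..<n - i} \<union> {n - i..n}" using that by auto
      then show ?thesis by (simp add: sum.union_disjoint[symmetric] ivl_disj_int)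
    qed
    also have "(\<Sum>j=n - i..n. of_int (c j) * u ^ j) = (\<Sum>j\<le>i. of_int (c (j + (n - i))) * u ^ (j + (n - i)))"
      using sum.shift_bounds_cl_nat_ivl[of "\<lambda>j. of_int (c j) * u ^ j" 0 "n - i" i] that
      by (simp add: atMost_atLeast0)
    also have "\<dots> = b i * u ^ (n - i)"
      unfolding b_def sum_distrib_right
      by (intro sum.cong refl) (simp only: power_add mult_ac add.commute)
    finally show ?thesis using sum0 by (simp add: eq_neg_iff_add_eq_0 add.commute)
  qed
  define M where "M = (\<lambda>k. u ^ k) ` {..<n}"
  have b_int: "b i \<in> oK" if i: "i < n" for i
  proof -
    have "b i * u ^ k \<in> zmod.span M" if k: "k < n" for k
    proof (cases "i + k < n")
      case True
      have "b i * u ^ k = (\<Sum>j\<le>i. of_int (c (n - i + j)) * u ^ (j + k))"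
        by (simp add: b_def sum_distrib_right power_add mult.assoc)
      also have "\<dots> \<in> zmod.span M"
        using True by (intro zmod.span_sum zmod.span_scale zmod.span_base) (auto simp: M_def)
      finally show ?thesis .
    next
      case False
      then have "k = (n - i) + (k - (n - i))" by simp
      then have "b i * u ^ k = b i * u ^ (n - i) * u ^ (k - (n - i))"
        by (metis mult.assoc power_add)
      also have "\<dots> = - (\<Sum>j<n - i. of_int (c j) * u ^ (j + (k - (n - i))))"
        using b_top[of i] i by (simp add: sum_distrib_right power_add mult.assoc)
      also have "\<dots> \<in> zmod.span M"
        using False k by (intro zmod.span_neg zmod.span_sum zmod.span_scale zmod.span_base) (auto simp: M_def)
      finally show ?thesis .
    qed
    then have "algebraic_int (b i)"
      using \<open>n \<noteq> 0\<close> by (intro algebraic_int_if_stable[of M] bexI[of _ 1]) (auto simp: M_def image_iff intro: bexI[of _ 0])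
    then show ?thesis by (simp add: ring_of_integers_def)
  qed
  have bu_int: "b i * u \<in> oK" if i: "i < n" for i
  proof (cases "Suc i < n")
    case True
    have "b i * u = b (Suc i) - of_int (c (n - Suc i))" using b_Suc[OF i] by (simp add: mult.commute)
    then show ?thesis using b_int[OF True] by auto
  next
    case False
    then have "n - i = 1" using i by simp
    then have "b i * u = - of_int (c 0)" using b_top[of i] i by simp
    then show ?thesis by auto
  qed
  \<comment> \<open>The product of the fractional ideals (1, u) and {p. p and p u are integral}. It
    contains every coefficient of \<open>g\<close>, hence also their gcd 1.\<close>
  define T where "T = {p + q * u | p q. p \<in> oK \<and> q \<in> oK \<and> p * u \<in> oK \<and> q * u \<in> oK}"
  have TI: "p \<in> oK \<Longrightarrow> q \<in> oK \<Longrightarrow> p * u \<in> oK \<Longrightarrow> q * u \<in> oK \<Longrightarrow> p + q * u \<in> T" for p q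
    unfolding T_def by blast
  have T_add: "x + y \<in> T" if xy: "x \<in> T" "y \<in> T" for x y
  proof -
    obtain p q p' q' where *: "p \<in> oK" "q \<in> oK" "p * u \<in> oK" "q * u \<in> oK" "x = p + q * u"
      "p' \<in> oK" "q' \<in> oK" "p' * u \<in> oK" "q' * u \<in> oK" "y = p' + q' * u"
      using xy unfolding T_def by blast
    then have "(p + p') + (q + q') * u \<in> T" by (intro TI) (auto simp: distrib_right)
    then show ?thesis using * by (simp add: algebra_simps)
  qed
  have T_mult: "of_int m * x \<in> T" if x: "x \<in> T" for m x
  proof -
    obtain p q where *: "p \<in> oK" "q \<in> oK" "p * u \<in> oK" "q * u \<in> oK" "x = p + q * u"
      using x unfolding T_def by blast
    then have "(of_int m * p) + (of_int m * q) * u \<in> T" by (intro TI) (auto simp: mult.assoc)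
    then show ?thesis using * by (simp add: algebra_simps)
  qed
  have c_T: "of_int (c k) \<in> T" if k: "k \<le> n" for k
  proof -
    consider "k = n" | "k = 0" | "0 < k" "k < n" using k by linarith
    then show ?thesis
    proof cases
      case 1
      have "of_int (c k) = b 0 + 0 * u" by (simp add: b_def 1)
      then show ?thesis using TI[of "b 0" 0] b_int[of 0] bu_int[of 0] \<open>n \<noteq> 0\<close> by simp
    next
      case 2
      have "b (n - 1) * u = - of_int (c 0)" using b_top[of "n - 1"] \<open>n \<noteq> 0\<close> by simp
      then have "of_int (c k) = 0 + - b (n - 1) * u" by (simp add: 2)
      moreover have "0 + - b (n - 1) * u \<in> T"
        using b_int[of "n - 1"] bu_int[of "n - 1"] \<open>n \<noteq> 0\<close> by (intro TI) auto
      ultimately show ?thesis by (simp only:)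
    next
      case 3
      define i where "i = n - k - 1"
      have i: "i < n" "Suc i < n" "n - Suc i = k" using 3 by (auto simp: i_def)
      have "of_int (c k) = b (Suc i) + - b i * u" using b_Suc[OF i(1)] i by (simp add: mult.commute)
      moreover have "b (Suc i) + - b i * u \<in> T"
        using b_int bu_int i by (intro TI) auto
      ultimately show ?thesis by (simp only:)
    qed
  qed
  have "0 + 0 * u \<in> T" by (rule TI) auto
  then have "gcd_list (coeffs g) \<in> {m. of_int m \<in> T}"
    by (intro gcd_list_in_subgroup) (auto simp: T_add T_mult coeffs_def c_T[unfolded c_def] n_def[symmetric])
  then have "1 \<in> T" using content by (simp add: content_def)
  then show ?thesis using that unfolding T_def by (smt (verit, best) mem_Collect_eq)
qed

text \<open>The leading coefficient a of an integer equation of degree n clears the denominator: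
  multiplying the equation by a^(n - 1) makes it monic in a u.\<close>

lemma denominator_exists:
  assumes "algebraic (u::'k::field_char_0)"
  shows "\<exists>n>0. of_nat n * u \<in> oK"
proof -
  obtain f :: "int poly" where f: "f \<noteq> 0" "poly (of_int_poly f) u = 0"
    using assms by (rule algebraicE')
  define n where "n = degree f"
  define a where "a = lead_coeff f"
  define c where "c i = coeff f i" for i
  have "a \<noteq> 0" using f by (simp add: a_def)
  have sum0: "(\<Sum>j\<le>n. of_int (c j) * u ^ j) = 0"
    using f(2) by (simp add: poly_altdef n_def c_def)
  have "n \<noteq> 0"
  proof
    assume "n = 0"
    then have "c 0 = 0" using sum0 by simp
    then show False using \<open>f \<noteq> 0\<close> \<open>n = 0\<close> by (metis c_def leading_coeff_0_iff n_def)
  qed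
  define M where "M = (\<lambda>k. (of_int a * u) ^ k) ` {..<n}"
  let ?v = "of_int a * u"
  have "?v ^ Suc k \<in> zmod.span M" if "k < n" for k
  proof (cases "Suc k < n")
    case True
    then show ?thesis by (intro zmod.span_base) (simp add: M_def del: power_Suc)
  next
    case False
    then have k: "Suc k = n" using that by simp
    have "{..n} = insert n {..<n}" by auto
    then have "of_int a * u ^ n + (\<Sum>j<n. of_int (c j) * u ^ j) = 0"
      using sum0 by (simp add: a_def c_def n_def)
    then have "of_int a ^ (n - 1) * (of_int a * u ^ n + (\<Sum>j<n. of_int (c j) * u ^ j)) = 0" by simp
    moreover have "of_int a ^ (n - 1) * (of_int a * u ^ n) = ?v ^ n"
      using k by (auto simp: power_mult_distrib)
    ultimately have "?v ^ n = - (\<Sum>j<n. of_int (a ^ (n - 1)) * (of_int (c j) * u ^ j))"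
      by (simp add: distrib_left sum_distrib_left eq_neg_iff_add_eq_0)
    also have "(\<Sum>j<n. of_int (a ^ (n - 1)) * (of_int (c j) * u ^ j)) = (\<Sum>j<n. of_int (a ^ (n - 1 - j) * c j) * ?v ^ j)"
    proof (rule sum.cong)
      fix j assume "j \<in> {..<n}"
      then have "n - 1 = (n - 1 - j) + j" by auto
      then have "a ^ (n - 1) = a ^ (n - 1 - j) * a ^ j" by (metis power_add)
      then show "of_int (a ^ (n - 1)) * (of_int (c j) * u ^ j) = of_int (a ^ (n - 1 - j) * c j) * ?v ^ j"
        by (simp add: power_mult_distrib mult_ac)
    qed simp
    also have "- \<dots> \<in> zmod.span M"
      by (intro zmod.span_neg zmod.span_sum zmod.span_scale zmod.span_base) (auto simp: M_def)
    finally show ?thesis by (simp only: k)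
  qed
  then have "algebraic_int ?v"
    using \<open>n \<noteq> 0\<close> by (intro algebraic_int_if_stable[of M] bexI[of _ 1])
      (auto simp: M_def image_iff intro: bexI[of _ 0])
  then have v: "?v \<in> oK" by (simp add: ring_of_integers_def)
  have "\<bar>a\<bar> = sgn a * a" by (simp add: abs_sgn mult.commute)
  then have "(of_nat (nat \<bar>a\<bar>) :: 'k) = of_int (sgn a) * of_int a"
    by (metis abs_ge_zero of_int_mult of_int_of_nat_eq nat_0_le)
  then have "of_nat (nat \<bar>a\<bar>) * u = of_int (sgn a) * ?v" by (simp only: mult.assoc)
  then have "of_nat (nat \<bar>a\<bar>) * u \<in> oK" using oK_mult[OF oK_of_int v] by (simp only:)
  then show ?thesis using \<open>a \<noteq> 0\<close> by (intro exI[of _ "nat \<bar>a\<bar>"] conjI) simp_all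
qed

lemma common_denominator:
  assumes "number_field TYPE('k::field_char_0)" "finite (X :: 'k set)"
  shows "\<exists>N>0. \<forall>x\<in>X. of_nat N * x \<in> oK"
proof (rule common_multiple_exists[OF assms(2)])
  show "\<exists>n>0. of_nat n * x \<in> oK" for x :: 'k
    using denominator_exists number_field_algebraic[OF assms(1)] by blast
  show "of_nat (n * m) * x \<in> oK" if "of_nat n * x \<in> oK" for n m and x :: 'k
    using oK_mult[OF oK_of_nat[of m] that] by (simp add: mult_ac)
qed

lemma finite_quotient_oK:
  assumes "number_field TYPE('k::field_char_0)" "0 < N"
  obtains F :: "('k::field_char_0) set" where "finite F" "F \<subseteq> oK" "\<And>x. x \<in> oK \<Longrightarrow> \<exists>f\<in>F. \<exists>y\<in>oK. x = f + of_nat N * y"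
proof -
  obtain B :: "'k set" where B: "finite B" "ratK.span B = UNIV"
    using assms unfolding number_field_def by blast
  have "ratK.subgroup_set (oK :: 'k set)" by (auto simp: ratK.subgroup_set_def)
  from ratK.finite_quotient[OF B this assms(2)] show ?thesis using that by auto
qed

lemma pigeonhole_mod:
  fixes x :: "nat \<Rightarrow> 'a"
  assumes "finite F" "\<And>i. \<exists>f\<in>F. P (x i) f"
  shows "\<exists>i j f. i < j \<and> f \<in> F \<and> P (x i) f \<and> P (x j) f"
proof -
  obtain h where h: "\<And>i. h i \<in> F \<and> P (x i) (h i)" using assms(2) by metis
  have "finite (range h)" using h assms(1) by (meson finite_subset image_subsetI)
  then have "\<not> inj h" using finite_imageD infinite_UNIV_nat by blast
  then obtain i j where "h i = h j" "i \<noteq> j" by (auto simp: inj_def)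
  then show ?thesis using h by (metis nat_neq_iff)
qed

text \<open>There are finitely many residues modulo N times the integers, so two of the elements N
  u^m are congruent, and dividing by N shows that u^i - u^j is integral.\<close>

lemma integral_if_powers_bounded:
  assumes nf: "number_field TYPE('k::field_char_0)" and N: "0 < N" "\<And>m. of_nat N * (u::'k) ^ m \<in> oK"
  shows "u \<in> oK"
proof -
  obtain F :: "'k set" where F: "finite F" "\<And>x. x \<in> oK \<Longrightarrow> \<exists>f\<in>F. \<exists>y\<in>oK. x = f + of_nat N * y"
    using finite_quotient_oK[OF nf N(1)] by metis
  have "\<exists>i j f. i < j \<and> f \<in> F \<and> (\<exists>y\<in>oK. of_nat N * u ^ i = f + of_nat N * y)
      \<and> (\<exists>y\<in>oK. of_nat N * u ^ j = f + of_nat N * y)"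
    by (rule pigeonhole_mod[OF F(1), of "\<lambda>x f. \<exists>y\<in>oK. x = f + of_nat N * y" "\<lambda>i. of_nat N * u ^ i"])
      (rule F(2)[OF N(2)])
  then obtain i j f y z where ij: "i < j" and yz: "y \<in> oK" "z \<in> oK"
    "of_nat N * u ^ i = f + of_nat N * y" "of_nat N * u ^ j = f + of_nat N * z" by blast
  have "of_nat N * (u ^ i - u ^ j) = of_nat N * (y - z)"
    using yz by (simp add: right_diff_distrib)
  then have "u ^ i - u ^ j = y - z" using N(1) by simp
  then show ?thesis using oK_if_power_diff[OF _ ij, of u] yz by auto
qed

section \<open>Quaternion algebras with orthogonal involution\<close>

context quaternion_algebra
begin

lemma finite_basis: obtains B where "finite_dimensional_vector_space scaleK B"
proof -
  obtain B where B: "B \<subseteq> UNIV" "independent B" "UNIV \<subseteq> span B" "card B = dim (UNIV :: 'h set)"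
    using basis_exists[of UNIV] by blast
  then have "finite B" using dim_four card.infinite by fastforce
  then have "finite_dimensional_vector_space scaleK B"
    using B by unfold_locales auto
  then show thesis by (rule that)
qed

lemma span_lt_4:
  assumes "finite S" "card S < 4" shows "span S \<noteq> UNIV"
  using dim_le_card'[OF assms(1)] assms(2) dim_four dim_span[of S] by (metis not_le)

lemma independent_span_eq_UNIV:
  assumes "independent S" "card S = 4" shows "span S = UNIV"
proof -
  obtain B where "finite_dimensional_vector_space scaleK B" by (rule finite_basis)
  then interpret fd: finite_dimensional_vector_space scaleK B .
  show ?thesis
    using fd.card_ge_dim_independent[of S UNIV] assms dim_four by auto
qed

lemma four_independent:
  assumes "\<And>a b c d. scaleK a w0 + scaleK b w1 + scaleK c w2 + scaleK d w3 = 0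
    \<Longrightarrow> a = 0 \<and> b = 0 \<and> c = 0 \<and> d = 0"
  shows "independent {w0, w1, w2, w3}" "w0 \<notin> {w1, w2, w3}" "w1 \<notin> {w2, w3}" "w2 \<noteq> w3"
proof -
  have "w0 \<noteq> w1" using assms[of 1 "-1" 0 0] by auto
  moreover have "w0 \<noteq> w2" using assms[of 1 0 "-1" 0] by auto
  moreover have "w0 \<noteq> w3" using assms[of 1 0 0 "-1"] by auto
  moreover have "w1 \<noteq> w2" using assms[of 0 1 "-1" 0] by auto
  moreover have "w1 \<noteq> w3" using assms[of 0 1 0 "-1"] by auto
  moreover have "w2 \<noteq> w3" using assms[of 0 0 1 "-1"] by auto
  ultimately show ne: "w0 \<notin> {w1, w2, w3}" "w1 \<notin> {w2, w3}" "w2 \<noteq> w3" by auto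
  show "independent {w0, w1, w2, w3}"
  proof
    assume "dependent {w0, w1, w2, w3}"
    then obtain u v where u: "(\<Sum>v\<in>{w0, w1, w2, w3}. scaleK (u v) v) = 0"
      "v \<in> {w0, w1, w2, w3}" "u v \<noteq> 0"
      by (auto simp: dependent_finite)
    moreover have "(\<Sum>v\<in>{w0, w1, w2, w3}. scaleK (u v) v)
        = scaleK (u w0) w0 + scaleK (u w1) w1 + scaleK (u w2) w2 + scaleK (u w3) w3"
      using ne by (simp add: add.assoc)
    ultimately have "u w0 = 0 \<and> u w1 = 0 \<and> u w2 = 0 \<and> u w3 = 0" using assms by simp
    then show False using u(2,3) by blast
  qed
qed

lemma four_span_eq_UNIV:
  assumes "\<And>a b c d. scaleK a w0 + scaleK b w1 + scaleK c w2 + scaleK d w3 = 0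
    \<Longrightarrow> a = 0 \<and> b = 0 \<and> c = 0 \<and> d = 0"
  shows "span {w0, w1, w2, w3} = UNIV"
proof (rule independent_span_eq_UNIV)
  note ind = four_independent[of w0 w1 w2 w3, OF assms]
  show "independent {w0, w1, w2, w3}" by (rule ind(1))
  show "card {w0, w1, w2, w3} = 4"
    using ind(2-4) by simp
qed

lemma scaleK_one_mult: "scaleK a 1 * x = scaleK a x" "x * scaleK a 1 = scaleK a x"
  by (simp_all add: scale_mult_left scale_mult_right)

lemma subspace_left_mult: "subspace W \<Longrightarrow> subspace {v. z * v \<in> W}"
  by (auto simp: subspace_def distrib_left scale_mult_right)

lemma subspace_commutant: "subspace {v. x * v = v * x}"
  by (auto simp: subspace_def distrib_left distrib_right scale_mult_right scale_mult_left)

lemma exists_noncommuting: "(\<And>a. x \<noteq> scaleK a 1) \<Longrightarrow> \<exists>y. x * y \<noteq> y * x"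
  using central by blast

text \<open>If \<open>1, x, x\<^sup>2\<close> were independent, the commutant of \<open>x\<close> would have codimension \<open>1\<close>, so
  all commutators \<open>x z - z x\<close> would be multiples of a single \<open>d = x y - y x\<close>; then \<open>K d + K y d\<close>
  is a two-sided ideal.\<close>

lemma quadratic: "\<exists>t n. x * x = scaleK t x + scaleK n 1"
proof (rule ccontr)
  assume neg: "\<not> ?thesis"
  have x_not_scalar: "x \<noteq> scaleK a 1" for a
  proof
    assume "x = scaleK a 1"
    then have "x * x = scaleK 0 x + scaleK (a * a) 1" by (simp add: scaleK_one_mult)
    then show False using neg by blast
  qed
  have x: "x \<notin> span {1}" using x_not_scalar by (auto simp: span_singleton)
  have xx: "x * x \<notin> span {1, x}"
  proof
    assume "x * x \<in> span {1, x}"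
    then obtain k where "x * x - scaleK k x \<in> span {1}" using span_breakdown_eq[of "x * x" x "{1}"]
      by (auto simp: insert_commute)
    then obtain l where "x * x - scaleK k x = scaleK l 1" by (auto simp: span_singleton)
    then have "x * x = scaleK k x + scaleK l 1" by (simp add: algebra_simps)
    then show False using neg by blast
  qed
  define W where "W = span {1, x, x * x}"
  have comm: "x * w = w * x" if "w \<in> W" for w
  proof -
    have "W \<subseteq> {v. x * v = v * x}"
      unfolding W_def by (rule span_minimal[OF _ subspace_commutant]) (auto simp: mult.assoc)
    then show ?thesis using that by blast
  qed
  obtain y where y: "x * y \<noteq> y * x" using exists_noncommuting[OF x_not_scalar] by blast
  then have "y \<notin> W" using comm by blast
  have ind: "independent {y, x * x, x, 1}"
  proof -
    have "independent {x, 1}"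
      using x by (intro independent_insertI[of x "{1}"] independent_insertI[of 1 "{}"])
        (simp_all add: independent_empty)
    then have "independent {x * x, x, 1}"
      using xx by (intro independent_insertI[of "x * x" "{x, 1}"]) (simp_all add: insert_commute)
    then show ?thesis
      using \<open>y \<notin> W\<close>
      by (intro independent_insertI[of y "{x * x, x, 1}"]) (simp_all add: W_def insert_commute)
  qed
  have card: "card {y, x * x, x, 1} = 4"
  proof -
    have "y \<noteq> x * x" "y \<noteq> x" "y \<noteq> 1" using \<open>y \<notin> W\<close> by (auto simp: W_def span_base)
    moreover have "x * x \<noteq> x" "x * x \<noteq> 1" using xx by (metis insertI1 insertI2 span_base)+
    moreover have "x \<noteq> 1" using x by (auto simp: span_base)
    ultimately show ?thesis by simp
  qed
  have decomp: "\<exists>w\<in>W. \<exists>h. z = w + scaleK h y" for z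
  proof -
    have "z \<in> span (insert y {1, x, x * x})"
    proof -
      have "{y, x * x, x, 1} = insert y {1, x, x * x}" by auto
      then show ?thesis using independent_span_eq_UNIV[OF ind card] by simp
    qed
    then obtain h where "z - scaleK h y \<in> W"
      unfolding W_def span_breakdown_eq[of z y "{1, x, x * x}"] by blast
    then show ?thesis by (metis diff_add_cancel)
  qed
  define d where "d = x * y - y * x"
  have "d \<noteq> 0" using y by (simp add: d_def)
  have bracket: "\<exists>h. x * z - z * x = scaleK h d" for z
  proof -
    obtain w h where w: "w \<in> W" and z: "z = w + scaleK h y" using decomp by blast
    have "x * z - z * x = scaleK h d"
      by (simp add: z comm[OF w] d_def distrib_left distrib_right scale_mult_right scale_mult_left
          scale_right_diff_distrib)
    then show ?thesis ..
  qed
  define I where "I = span {d, y * d}"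
  have dI: "d \<in> I" and ydI: "y * d \<in> I" by (auto simp: I_def span_base)
  have I_sub: "subspace I" by (simp add: I_def)
  \<comment> \<open>The bracket of \<open>x\<close> with \<open>x * y\<close> is
    \<open>x * d\<close>, so \<open>d\<close> is an eigenvector of left multiplication by
    \<open>x\<close>.\<close>
  obtain b where xd: "x * d = scaleK b d"
    using bracket[of "x * y"] by (auto simp: d_def right_diff_distrib mult.assoc)
  \<comment> \<open>The bracket with \<open>x\<close> is a derivation: that of y z is d z plus y
    times that of z. Both brackets are multiples of \<open>d\<close>, which leaves d z in the span
    of d and y d.\<close>
  have dz: "d * z \<in> I" for z
  proof -
    obtain h where h: "x * z - z * x = scaleK h d" using bracket by blast
    obtain m where m: "x * (y * z) - (y * z) * x = scaleK m d" using bracket by blast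
    have "x * (y * z) - (y * z) * x = d * z + y * (x * z - z * x)"
      by (simp add: d_def algebra_simps)
    then have "d * z = scaleK m d - scaleK h (y * d)"
      unfolding m h by (simp add: scale_mult_right)
    then show ?thesis using dI ydI I_sub by (simp add: subspace_diff subspace_scale)
  qed
  have xyd: "x * (y * d) \<in> I"
  proof -
    have "x * (y * d) = y * (x * d) + d * d" by (simp add: d_def algebra_simps)
    also have "\<dots> \<in> I" unfolding xd scale_mult_right
      using dI ydI I_sub dz by (simp add: subspace_add subspace_scale)
    finally show ?thesis .
  qed
  have xI: "x * v \<in> I" if "v \<in> I" for v
  proof -
    have "I \<subseteq> {v. x * v \<in> I}"
      unfolding I_def by (rule span_minimal[OF _ subspace_left_mult])
        (use xd xyd dI I_sub in \<open>auto simp: I_def[symmetric] subspace_scale\<close>)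
    then show ?thesis using that by blast
  qed
  have WI: "w * v \<in> I" if "w \<in> W" "v \<in> I" for w v
  proof -
    have "W \<subseteq> {w. w * v \<in> I}"
      unfolding W_def
    proof (rule span_minimal)
      show "{1, x, x * x} \<subseteq> {w. w * v \<in> I}" using xI that(2) by (auto simp: mult.assoc)
      show "subspace {w. w * v \<in> I}"
        using I_sub by (auto simp: subspace_def distrib_right scale_mult_left)
    qed
    then show ?thesis using that by blast
  qed
  have yyd: "y * (y * d) \<in> I"
  proof -
    obtain w h where w: "w \<in> W" and z: "y * y = w + scaleK h y" using decomp by blast
    have "y * (y * d) = w * d + scaleK h (y * d)"
      by (simp add: mult.assoc[symmetric] z distrib_right scale_mult_left)
    then show ?thesis using WI[OF w dI] ydI I_sub by (simp add: subspace_add subspace_scale)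
  qed
  have yI: "y * v \<in> I" if "v \<in> I" for v
  proof -
    have "I \<subseteq> {v. y * v \<in> I}"
      unfolding I_def by (rule span_minimal[OF _ subspace_left_mult])
        (use yyd ydI in \<open>auto simp: I_def[symmetric] I_sub\<close>)
    then show ?thesis using that by blast
  qed
  have left: "z * v \<in> I" if "v \<in> I" for z v
  proof -
    obtain w h where w: "w \<in> W" and z: "z = w + scaleK h y" using decomp by blast
    have "z * v = w * v + scaleK h (y * v)" by (simp add: z distrib_right scale_mult_left)
    then show ?thesis using WI[OF w that] yI[OF that] I_sub by (simp add: subspace_add subspace_scale)
  qed
  have right: "v * z \<in> I" if "v \<in> I" for z v
  proof -
    have "I \<subseteq> {v. v * z \<in> I}"
      unfolding I_def
    proof (rule span_minimal)
      show "{d, y * d} \<subseteq> {v. v * z \<in> span {d, y * d}}"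
        using dz yI by (auto simp: I_def[symmetric] mult.assoc)
      show "subspace {v. v * z \<in> span {d, y * d}}"
        using I_sub by (auto simp: I_def[symmetric] subspace_def distrib_right scale_mult_left)
    qed
    then show ?thesis using that by blast
  qed
  have "two_sided_ideal I"
    unfolding two_sided_ideal_def using left right I_sub
    by (auto simp: subspace_0 subspace_diff)
  then have "I = UNIV" using simple dI \<open>d \<noteq> 0\<close> by blast
  moreover have "card {d, y * d} < 4" by (simp add: card_insert_if)
  ultimately show False using span_lt_4[of "{d, y * d}"] by (simp add: I_def)
qed

text \<open>Trace zero, expressed before there is a trace: the square is scalar, and the second
  conjunct excludes the nonzero scalars, whose squares are scalar too.\<close>

definition pure :: "'h \<Rightarrow> bool" where
  "pure v \<longleftrightarrow> (\<exists>a. v * v = scaleK a 1) \<and> (\<forall>a. v = scaleK a 1 \<longrightarrow> v = 0)"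

lemma pure_0 [simp]: "pure 0"
  by (auto simp: pure_def intro: exI[of _ 0])

lemma pure_decomp: "\<exists>a v. pure v \<and> x = scaleK a 1 + v"
proof (cases "\<exists>a. x = scaleK a 1")
  case True
  then show ?thesis using pure_0 by (metis add_0_right)
next
  case False
  obtain t n where tn: "x * x = scaleK t x + scaleK n 1" using quadratic by blast
  define v where "v = x - scaleK (t / 2) 1"
  have "v * v = x * x - scaleK (t / 2) x - scaleK (t / 2) x + scaleK (t / 2 * (t / 2)) 1"
    unfolding v_def
    by (simp add: left_diff_distrib right_diff_distrib scaleK_one_mult scale_right_diff_distrib algebra_simps)
  also have "scaleK (t / 2) x + scaleK (t / 2) x = scaleK t x"
    by (simp flip: scale_left_distrib)
  then have "x * x - scaleK (t / 2) x - scaleK (t / 2) x + scaleK (t / 2 * (t / 2)) 1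
      = scaleK (n + t / 2 * (t / 2)) 1"
    unfolding tn by (simp add: scale_left_distrib algebra_simps)
  finally have "v * v = scaleK (n + t / 2 * (t / 2)) 1" .
  moreover have "v \<noteq> scaleK a 1" for a
  proof
    assume "v = scaleK a 1"
    then have "x = scaleK (a + t / 2) 1" by (simp add: v_def scale_left_distrib algebra_simps)
    then show False using False by blast
  qed
  ultimately have "pure v" by (auto simp: pure_def)
  moreover have "x = scaleK (t / 2) 1 + v" by (simp add: v_def)
  ultimately show ?thesis by blast
qed

lemma pure_scale: assumes "pure v" shows "pure (scaleK c v)"
proof -
  obtain a where "v * v = scaleK a 1" using assms by (auto simp: pure_def)
  then have "scaleK c v * scaleK c v = scaleK (c * c * a) 1"
    by (simp add: scale_mult_left scale_mult_right)
  moreover have "scaleK c v = 0" if "scaleK c v = scaleK b 1" for b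
  proof (cases "c = 0")
    case False
    then have "v = scaleK (b / c) 1"
      using arg_cong[OF that, of "scaleK (1 / c)"] by simp
    then show ?thesis using assms by (auto simp: pure_def)
  qed simp
  ultimately show ?thesis by (auto simp: pure_def)
qed

text \<open>This turns the pure elements into a quadratic space. The squares of \<open>v + w\<close>
  and \<open>v - w\<close> add up to a scalar; for \<open>w\<close> outside K + K v and nonzero
  \<open>v\<close> this forces the linear coefficients of their quadratic equations to vanish. For
  \<open>w\<close> in K + K v it is a computation.\<close>

lemma pure_anticommutator:
  assumes "pure v" "pure w"
  shows "\<exists>c. v * w + w * v = scaleK c 1"
proof -
  obtain a where a: "v * v = scaleK a 1" using assms(1) by (auto simp: pure_def)
  obtain b where b: "w * w = scaleK b 1" using assms(2) by (auto simp: pure_def)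
  show ?thesis
  proof (cases "\<exists>c d. w = scaleK c 1 + scaleK d v")
    case True
    then obtain c d where w: "w = scaleK c 1 + scaleK d v" by blast
    define C D where "C = scaleK c 1" and "D = scaleK d v"
    have "C * C = scaleK (c * c) 1" "C * D = scaleK (c * d) v" "D * C = scaleK (c * d) v"
      "D * D = scaleK (d * d * a) 1"
      by (simp_all add: C_def D_def scale_mult_left scale_mult_right a)
    moreover have "w * w = C * C + D * D + (C * D + D * C)"
      unfolding w C_def[symmetric] D_def[symmetric] by (simp add: distrib_left distrib_right)
    moreover have "scaleK (c * d) v + scaleK (c * d) v = scaleK (2 * c * d) v"
      by (metis mult_2 mult.assoc scale_left_distrib)
    ultimately have "scaleK b 1 = scaleK (c * c) 1 + scaleK (d * d * a) 1 + scaleK (2 * c * d) v"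
      using b by simp
    then have "scaleK (2 * c * d) v = scaleK (b - (c * c + d * d * a)) 1"
      by (simp add: scale_left_diff_distrib scale_left_distrib)
    then have "scaleK (2 * c * d) v = 0"
      using pure_scale[OF assms(1), of "2 * c * d"] by (auto simp: pure_def)
    then consider "v = 0" | "c = 0" | "d = 0" by auto
    then show ?thesis
    proof cases
      case 1
      then show ?thesis by (intro exI[of _ 0]) simp
    next
      case 2
      then have "v * w + w * v = scaleK (2 * d * a) 1"
        by (simp add: w scale_mult_left scale_mult_right a scale_left_distrib[symmetric])
      then show ?thesis ..
    next
      case 3
      then have "w = 0" using w assms(2) by (auto simp: pure_def)
      then show ?thesis by (intro exI[of _ 0]) simp
    qed
  next
    case False
    obtain t n where tn: "(v + w) * (v + w) = scaleK t (v + w) + scaleK n 1" using quadratic by blast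
    obtain t' n' where tn': "(v - w) * (v - w) = scaleK t' (v - w) + scaleK n' 1" using quadratic by blast
    have sum: "scaleK (t + t') v + scaleK (t - t') w = scaleK (2 * a + 2 * b - n - n') 1"
    proof -
      have "(v + w) * (v + w) + (v - w) * (v - w) = scaleK (2 * a + 2 * b) 1"
      proof -
        have "(v + w) * (v + w) + (v - w) * (v - w) = v * v + v * v + (w * w + w * w)"
          by (simp add: algebra_simps)
        then show ?thesis by (simp add: a b scale_left_distrib[symmetric])
      qed
      then show ?thesis unfolding tn tn'
        by (simp add: scale_left_distrib scale_left_diff_distrib scale_right_distrib scale_right_diff_distrib algebra_simps)
    qed
    have "t - t' = 0"
    proof (rule ccontr)
      assume ne: "t - t' \<noteq> 0"
      have "scaleK (t - t') w = scaleK (2 * a + 2 * b - n - n') 1 - scaleK (t + t') v"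
        using sum by (simp add: algebra_simps)
      then have "scaleK (1 / (t - t')) (scaleK (t - t') w) =
          scaleK (1 / (t - t')) (scaleK (2 * a + 2 * b - n - n') 1 - scaleK (t + t') v)" by simp
      then have "w = scaleK ((2 * a + 2 * b - n - n') / (t - t')) 1 + scaleK (- ((t + t') / (t - t'))) v"
        using ne by (simp add: scale_right_diff_distrib)
      then show False using False by blast
    qed
    then have "scaleK (t + t') v = scaleK (2 * a + 2 * b - n - n') 1" using sum by simp
    then have "scaleK (t + t') v = 0"
      using pure_scale[OF assms(1), of "t + t'"] by (auto simp: pure_def)
    then consider "v = 0" | "t + t' = 0" by auto
    then show ?thesis
    proof cases
      case 1
      then show ?thesis by (intro exI[of _ 0]) simp
    next
      case 2
      with \<open>t - t' = 0\<close> have "t = 0" by (simp add: add_eq_0_iff2)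
      have "(v + w) * (v + w) = v * v + w * w + (v * w + w * v)" by (simp add: algebra_simps)
      then have "v * w + w * v = scaleK (n - a - b) 1"
        using tn a b \<open>t = 0\<close> by (simp add: scale_left_diff_distrib algebra_simps)
      then show ?thesis ..
    qed
  qed
qed

lemma pure_add:
  assumes "pure v" "pure w" shows "pure (v + w)"
proof -
  obtain a where a: "v * v = scaleK a 1" using assms(1) by (auto simp: pure_def)
  obtain b where b: "w * w = scaleK b 1" using assms(2) by (auto simp: pure_def)
  obtain c where c: "v * w + w * v = scaleK c 1" using pure_anticommutator[OF assms] by blast
  have "(v + w) * (v + w) = v * v + w * w + (v * w + w * v)" by (simp add: algebra_simps)
  then have "(v + w) * (v + w) = scaleK (a + b + c) 1"
    by (simp add: a b c scale_left_distrib)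
  moreover have "v + w = 0" if e: "v + w = scaleK d 1" for d
  proof -
    have w: "w = scaleK d 1 - v" using e by (simp add: algebra_simps)
    have "w * w = scaleK (d * d + a) 1 - scaleK (2 * d) v"
      unfolding w by (simp add: left_diff_distrib right_diff_distrib scaleK_one_mult a scale_left_distrib)
        (simp add: scale_left_distrib[symmetric] algebra_simps)
    then have "scaleK (2 * d) v = scaleK (d * d + a - b) 1"
      unfolding b by (simp add: scale_left_diff_distrib algebra_simps)
    then have "scaleK (2 * d) v = 0"
      using pure_scale[OF assms(1), of "2 * d"] by (auto simp: pure_def)
    then consider "d = 0" | "v = 0" by auto
    then show ?thesis
    proof cases
      case 2
      then have "w = 0" using w assms(2) by (auto simp: pure_def)
      then show ?thesis using 2 by simp
    qed (use e in simp)
  qed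
  ultimately show ?thesis unfolding pure_def by blast
qed

lemma pure_uminus: "pure v \<Longrightarrow> pure (- v)"
  using pure_scale[of v "- 1"] by simp

lemma pure_diff: "pure v \<Longrightarrow> pure w \<Longrightarrow> pure (v - w)"
  using pure_add[OF _ pure_uminus, of v w] by simp

text \<open>An element orthogonal to all pure ones has square 0 and anticommutes with them, so the
  left ideal H v is two-sided. Simplicity leaves v = 0 or 1 = x v, and the latter gives v = x v v =
  0.\<close>

lemma pure_nondegenerate:
  assumes "pure v" and orth: "\<And>w. pure w \<Longrightarrow> v * w + w * v = 0"
  shows "v = 0"
proof -
  have "v * v + v * v = 0" using orth[OF assms(1)] .
  moreover obtain a where "v * v = scaleK a 1" using assms(1) by (auto simp: pure_def)
  ultimately have "scaleK (a + a) 1 = 0" by (metis scale_left_distrib)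
  then have vv: "v * v = 0" using \<open>v * v = scaleK a 1\<close> by simp
  define I where "I = range (\<lambda>x. x * v)"
  have right: "\<exists>y. v * x = y * v" for x
  proof -
    obtain a w where w: "pure w" "x = scaleK a 1 + w" using pure_decomp by blast
    have "v * w = - (w * v)" using orth[OF w(1)] by (simp add: eq_neg_iff_add_eq_0)
    then have "v * x = (scaleK a 1 - w) * v"
      by (simp add: w(2) distrib_left left_diff_distrib scaleK_one_mult)
    then show ?thesis ..
  qed
  have "two_sided_ideal I"
    unfolding two_sided_ideal_def
  proof (intro conjI ballI allI)
    show "0 \<in> I" unfolding I_def by (metis mult_zero_left rangeI)
    show "x - y \<in> I" if "x \<in> I" "y \<in> I" for x y
      using that unfolding I_def by (auto simp flip: left_diff_distrib)
    show "r * x \<in> I" if "x \<in> I" for x r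
      using that unfolding I_def by (auto simp flip: mult.assoc)
    show "x * r \<in> I" if "x \<in> I" for x r
    proof -
      obtain z where "x = z * v" using \<open>x \<in> I\<close> unfolding I_def by blast
      moreover obtain y where "v * r = y * v" using right by blast
      ultimately have "x * r = (z * y) * v" by (simp add: mult.assoc)
      then show ?thesis unfolding I_def by blast
    qed
  qed
  then consider "I = {0}" | "I = UNIV" using simple by blast
  then show ?thesis
  proof cases
    case 1
    moreover have "1 * v \<in> I" unfolding I_def by blast
    ultimately show ?thesis by simp
  next
    case 2
    then obtain x where "1 = x * v" unfolding I_def by blast
    then have "v = x * (v * v)" by (metis mult.assoc mult_1)
    then show ?thesis by (simp add: vv)
  qed
qed

lemma anisotropic_exists:
  fixes v w :: 'h
  assumes "v * w + w * v \<noteq> 0"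
  shows "\<exists>u\<in>{v, w, v + w}. u * u \<noteq> 0"
proof (rule ccontr)
  assume "\<not> ?thesis"
  then have "v * v = 0" "w * w = 0" "(v + w) * (v + w) = 0" by auto
  moreover have "(v + w) * (v + w) = v * v + w * w + (v * w + w * v)" by (simp add: algebra_simps)
  ultimately show False using assms by simp
qed

text \<open>Multiplying the relation by \<open>i\<close> on the left and on the right and comparing
  separates the terms that commute with \<open>i\<close> from those that anticommute;
  \<open>j\<close> then splits both halves again.\<close>

lemma quaternion_span:
  assumes a: "i * i = scaleK a 1" "a \<noteq> 0" and b: "j * j = scaleK b 1" "b \<noteq> 0" and ij: "i * j = - (j * i)"
    and rel: "scaleK w0 1 + scaleK w1 i + scaleK w2 j + scaleK w3 (i * j) = 0"
  shows "w0 = 0 \<and> w1 = 0 \<and> w2 = 0 \<and> w3 = 0"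
proof -
  have ji: "j * i = - (i * j)" using ij by simp
  have iij: "i * (i * j) = scaleK a j" by (simp add: mult.assoc[symmetric] a scaleK_one_mult)
  have iji: "i * j * i = - scaleK a j"
    by (metis iij ij minus_mult_right mult.assoc minus_minus)
  have ijj: "i * j * j = scaleK b i" by (simp add: mult.assoc b scaleK_one_mult)
  have jij: "j * (i * j) = - scaleK b i"
    by (metis ijj ji minus_mult_left mult.assoc minus_minus)
  have r1: "scaleK w0 i + scaleK (w1 * a) 1 + scaleK w2 (i * j) + scaleK (w3 * a) j = 0"
    using arg_cong[OF rel, of "\<lambda>z. i * z"]
    by (simp add: distrib_left scale_mult_right a iij)
  have r2: "scaleK w0 i + scaleK (w1 * a) 1 - scaleK w2 (i * j) - scaleK (w3 * a) j = 0"
    using arg_cong[OF rel, of "\<lambda>z. z * i"]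
    by (simp add: distrib_right scale_mult_left a ji iji)
  have two: "x + y = 0 \<Longrightarrow> x - y = 0 \<Longrightarrow> x = 0 \<and> y = 0" for x y :: 'h
  proof -
    assume xy: "x + y = 0" "x - y = 0"
    have "scaleK 2 x = x + x" by (metis one_add_one scale_left_distrib scale_one)
    also have "\<dots> = (x + y) + (x - y)" by simp
    finally show ?thesis using xy by simp
  qed
  have "scaleK w0 i + scaleK (w1 * a) 1 = 0" and e2: "scaleK w2 (i * j) + scaleK (w3 * a) j = 0"
    using two[of "scaleK w0 i + scaleK (w1 * a) 1" "scaleK w2 (i * j) + scaleK (w3 * a) j"] r1 r2
    by (simp_all add: algebra_simps)
  then have r3: "scaleK (w1 * a) 1 + scaleK w0 i = 0" by (simp add: add.commute)
  have "scaleK (w1 * a) j + scaleK w0 (i * j) = 0" "scaleK (w1 * a) j - scaleK w0 (i * j) = 0"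
    using arg_cong[OF r3, of "\<lambda>z. z * j"] arg_cong[OF r3, of "\<lambda>z. j * z"]
    by (simp_all add: distrib_left distrib_right scale_mult_right scale_mult_left ji)
  then have z1: "scaleK (w1 * a) j = 0" "scaleK w0 (i * j) = 0" using two by blast+
  have "scaleK (w2 * b) i + scaleK (w3 * a * b) 1 = 0" "scaleK (w3 * a * b) 1 - scaleK (w2 * b) i = 0"
    using arg_cong[OF e2, of "\<lambda>z. z * j"] arg_cong[OF e2, of "\<lambda>z. j * z"]
    by (simp_all add: distrib_left distrib_right scale_mult_right scale_mult_left ijj jij b algebra_simps)
  then have z2: "scaleK (w3 * a * b) 1 = 0" "scaleK (w2 * b) i = 0"
    using two[of "scaleK (w3 * a * b) 1" "scaleK (w2 * b) i"] by (simp_all add: add.commute)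
  have "i \<noteq> 0" "j \<noteq> 0" using a b by auto
  moreover have "i * j \<noteq> 0" using iij a \<open>j \<noteq> 0\<close> by auto
  ultimately show ?thesis using z1 z2 a b by auto
qed

text \<open>The fixed pure quaternions and the skew ones are orthogonal, so both subspaces are nondegenerate.
  Given an anisotropic fixed \<open>l\<close> and an anisotropic skew \<open>m\<close>, the product \<open>l m\<close> is fixed, and
  \<open>l, l m\<close> is the required basis. Without fixed pure quaternions the involution is conjugation.\<close>

lemma orthogonal_involution_basis:
  assumes "orthogonal_involution scaleK s"
  obtains i j a b where "a \<noteq> 0" "b \<noteq> 0" "i * i = scaleK a 1" "j * j = scaleK b 1" "i * j = - (j * i)"
    "s i = i" "s j = j"
proof -
  have lin: "Vector_Spaces.linear scaleK scaleK s" and inv: "\<And>x. s (s x) = x"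
    and anti: "\<And>x y. s (x * y) = s y * s x" and nc: "\<not> quaternion_conjugation scaleK s"
    using assms unfolding orthogonal_involution_def by blast+
  interpret s: Vector_Spaces.linear scaleK scaleK s by (rule lin)
  have s1: "s 1 = 1" using anti[of "s 1" 1] inv by simp
  have s_scalar: "s (scaleK a 1) = scaleK a 1" for a by (simp add: s.scale s1)
  have s_pure: "pure (s v)" if "pure v" for v
  proof -
    obtain a where a: "v * v = scaleK a 1" using \<open>pure v\<close> by (auto simp: pure_def)
    have "s v * s v = scaleK a 1" using a anti[of v v] by (simp add: s_scalar)
    moreover have "s v = 0" if e: "s v = scaleK c 1" for c
    proof -
      have "v = scaleK c 1" using e inv s_scalar by metis
      then have "v = 0" using \<open>pure v\<close> by (auto simp: pure_def)
      then show ?thesis by (simp add: s.zero)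
    qed
    ultimately show ?thesis unfolding pure_def by blast
  qed
  have nondeg: "\<exists>w. pure w \<and> v * w + w * v \<noteq> 0" if "pure v" "v \<noteq> 0" for v
    using pure_nondegenerate[OF that(1)] that(2) by blast
  have two: "x = y" if "x + x = y + y" for x y :: 'h
  proof -
    have "scaleK 2 x = x + x" "scaleK 2 y = y + y" by (metis one_add_one scale_left_distrib scale_one)+
    then have "scaleK 2 x = scaleK 2 y" using that by (simp only:)
    then show ?thesis by simp
  qed
  have two0: "x = 0" if "x + x = 0" for x :: 'h using two[of x 0] that by simp
  have orth: "v * w + w * v = 0" if "pure v" "pure w" "s v = v" "s w = - w" for v w
  proof -
    obtain c where c: "v * w + w * v = scaleK c 1" using pure_anticommutator \<open>pure v\<close> \<open>pure w\<close> by blast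
    have "s (v * w + w * v) = - (v * w + w * v)"
      by (simp add: s.add anti that add.commute)
    then have "(v * w + w * v) + (v * w + w * v) = 0"
      unfolding c s_scalar by (simp only: eq_neg_iff_add_eq_0)
    then show ?thesis by (rule two0)
  qed
  have aniso_in: "\<exists>u. pure u \<and> s u = scaleK e u \<and> u * u \<noteq> 0"
    if v: "pure v" "v \<noteq> 0" "s v = scaleK e v" and e: "e = 1 \<or> e = -1" for v e
  proof -
    obtain w where w: "pure w" "v * w + w * v \<noteq> 0" using nondeg[OF v(1,2)] by blast
    \<comment> \<open>Twice the projections of \<open>w\<close> to the eigenspace of
      \<open>e\<close> and to the opposite one. The second is orthogonal to \<open>v\<close>, so the
      first is not.\<close>
    define w1 w2 where "w1 = w + scaleK e (s w)" and "w2 = w - scaleK e (s w)"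
    have w12: "w + w = w1 + w2" by (simp add: w1_def w2_def)
    have p: "pure w1" "pure w2" unfolding w1_def w2_def
      using w(1) s_pure by (auto intro!: pure_add pure_diff pure_scale)
    have sw1: "s w1 = scaleK e w1" and sw2: "s w2 = - scaleK e w2"
      unfolding w1_def w2_def using e by (auto simp: s.add s.diff s.scale s.neg inv)
    have "v * w2 + w2 * v = 0"
    proof (cases "e = 1")
      case True
      then show ?thesis using orth[OF v(1) p(2)] v(3) sw2 by simp
    next
      case False
      then have "e = -1" using e by simp
      then show ?thesis using orth[OF p(2) v(1)] v(3) sw2 by (simp add: add.commute)
    qed
    moreover have "(v * w + w * v) + (v * w + w * v) = (v * w1 + w1 * v) + (v * w2 + w2 * v)"
    proof -
      have "(v * w + w * v) + (v * w + w * v) = v * (w + w) + (w + w) * v" by (simp add: algebra_simps)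
      then show ?thesis unfolding w12 by (simp add: algebra_simps)
    qed
    ultimately have "v * w1 + w1 * v \<noteq> 0" using w(2) two0[of "v * w + w * v"] by auto
    then obtain u where u: "u \<in> {v, w1, v + w1}" "u * u \<noteq> 0" using anisotropic_exists by blast
    then consider "u = v" | "u = w1" | "u = v + w1" by blast
    then have "pure u" "s u = scaleK e u"
      by (cases, simp_all only: v(1) p(1) pure_add v(3) sw1 s.add scale_right_distrib)+
    then show ?thesis using u(2) by blast
  qed
  have not_id: "\<exists>x. s x \<noteq> x"
  proof (rule ccontr)
    assume "\<not> ?thesis"
    then have "z * x = x * z" for x z :: 'h using anti[of x z] by simp
    then have "\<exists>a. z = scaleK a 1" for z using central by blast
    then have "span {1} = UNIV" by (auto simp: span_singleton)
    then show False using span_lt_4[of "{1}"] by simp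
  qed
  then obtain x where x: "s x \<noteq> x" by blast
  obtain a0 v0 where v0: "pure v0" "x = scaleK a0 1 + v0" using pure_decomp by blast
  have "s v0 \<noteq> v0" using x unfolding v0(2) by (auto simp: s.add s_scalar)
  then have "pure (v0 - s v0)" "v0 - s v0 \<noteq> 0" "s (v0 - s v0) = scaleK (-1) (v0 - s v0)"
    using v0(1) by (auto simp: pure_diff s_pure s.diff inv)
  then obtain m where m: "pure m" "s m = - m" "m * m \<noteq> 0"
    using aniso_in[of "v0 - s v0" "-1"] by auto
  show thesis
  proof (cases "\<exists>v. pure v \<and> v \<noteq> 0 \<and> s v = v")
    case True
    then obtain l where l: "pure l" "s l = l" "l * l \<noteq> 0"
      using aniso_in[of _ 1] by auto
    obtain a where a: "l * l = scaleK a 1" using l by (auto simp: pure_def)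
    obtain c where c: "m * m = scaleK c 1" using m by (auto simp: pure_def)
    have lm: "l * m = - (m * l)" using orth[OF l(1) m(1) l(2) m(2)] by (simp add: eq_neg_iff_add_eq_0)
    have ml: "m * l = - (l * m)" using lm by simp
    have llm: "l * (l * m) = scaleK a m" by (simp add: a mult.assoc[symmetric] scaleK_one_mult)
    have lml: "l * m * l = - scaleK a m"
    proof -
      have "l * m * l = - (l * (l * m))" by (simp add: ml mult.assoc)
      then show ?thesis by (simp add: llm)
    qed
    have "(l * m) * (l * m) = scaleK (- (a * c)) 1"
    proof -
      have "(l * m) * (l * m) = (l * m * l) * m" by (simp add: mult.assoc)
      then show ?thesis by (simp add: lml c scale_mult_left)
    qed
    moreover have "l * (l * m) = - (l * m * l)" by (simp add: llm lml)
    moreover have "s (l * m) = l * m" by (simp add: anti l(2) m(2) ml)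
    ultimately show thesis using that[of a "- (a * c)" l "l * m"] a c l m by auto
  next
    case False
    have s_neg: "s v = - v" if "pure v" for v
    proof -
      have "s (v + s v) = v + s v" by (simp add: s.add inv add.commute)
      moreover have "pure (v + s v)" using that s_pure pure_add by blast
      ultimately have "v + s v = 0" using False by blast
      then show ?thesis by (simp add: eq_neg_iff_add_eq_0 add.commute)
    qed
    \<comment> \<open>Orthogonalization against \<open>m\<close>: as m m = a, the coefficient c / (2
      a) cancels an anticommutator c. The resulting \<open>y\<close> may be isotropic, so a
      \<open>z\<close> that pairs nontrivially with \<open>y\<close> is orthogonalized as well; one
      of y, z, y + z is then anisotropic.\<close>
    obtain a where a: "m * m = scaleK a 1" using m by (auto simp: pure_def)
    then have a0: "a \<noteq> 0" using m by auto
    have "\<exists>y. pure y \<and> m * y + y * m = 0 \<and> y \<noteq> 0"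
    proof -
      have "span {1, m} \<noteq> UNIV" by (rule span_lt_4) (auto simp: card_insert_if)
      then obtain x where x: "x \<notin> span {1, m}" by blast
      obtain b v where v: "pure v" "x = scaleK b 1 + v" using pure_decomp by blast
      obtain c where c: "m * v + v * m = scaleK c 1" using pure_anticommutator m(1) v(1) by blast
      define y where "y = v - scaleK (c / (2 * a)) m"
      have "pure y" unfolding y_def using v m by (intro pure_diff pure_scale)
      moreover have "m * y + y * m = 0"
      proof -
        have 0: "c - (c / (2 * a) * a + c / (2 * a) * a) = 0" using a0 by (simp add: field_simps)
        have "m * y + y * m = (m * v + v * m) - (scaleK (c / (2 * a)) (m * m) + scaleK (c / (2 * a)) (m * m))"
          by (simp add: y_def scale_mult_left scale_mult_right algebra_simps)
        also have "\<dots> = scaleK (c - (c / (2 * a) * a + c / (2 * a) * a)) 1"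
          by (simp only: c a scale_left_diff_distrib scale_left_distrib scale_scale)
        finally show ?thesis unfolding 0 by simp
      qed
      moreover have "y \<noteq> 0"
      proof
        assume "y = 0"
        then have "x = scaleK b 1 + scaleK (c / (2 * a)) m" by (simp add: v(2) y_def)
        moreover have "scaleK b 1 + scaleK (c / (2 * a)) m \<in> span {1, m}"
          by (intro span_add span_scale span_base) simp_all
        ultimately have "x \<in> span {1, m}" by simp
        then show False using x by blast
      qed
      ultimately show ?thesis by blast
    qed
    then obtain y where y: "pure y" "m * y + y * m = 0" "y \<noteq> 0" by blast
    obtain w where w: "pure w" "y * w + w * y \<noteq> 0" using nondeg[OF y(1,3)] by blast
    obtain c where c: "m * w + w * m = scaleK c 1" using pure_anticommutator m(1) w(1) by blast
    define z where "z = w - scaleK (c / (2 * a)) m"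
    have pz: "pure z" unfolding z_def using w m by (intro pure_diff pure_scale)
    have mz: "m * z + z * m = 0"
    proof -
      have 0: "c - (c / (2 * a) * a + c / (2 * a) * a) = 0" using a0 by (simp add: field_simps)
      have "m * z + z * m = (m * w + w * m) - (scaleK (c / (2 * a)) (m * m) + scaleK (c / (2 * a)) (m * m))"
        by (simp add: z_def scale_mult_left scale_mult_right algebra_simps)
      also have "\<dots> = scaleK (c - (c / (2 * a) * a + c / (2 * a) * a)) 1"
        by (simp only: c a scale_left_diff_distrib scale_left_distrib scale_scale)
      finally show ?thesis unfolding 0 by simp
    qed
    have "y * z + z * y = (y * w + w * y) - scaleK (c / (2 * a)) (m * y + y * m)"
      by (simp add: z_def scale_mult_left scale_mult_right scale_right_distrib algebra_simps)
    then have "y * z + z * y \<noteq> 0" using y w by simp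
    then obtain j where j: "j \<in> {y, z, y + z}" "j * j \<noteq> 0" using anisotropic_exists by blast
    have "pure j" using j(1) y(1) pz pure_add by auto
    have "m * j + j * m = 0" using j(1) y(2) mz by (auto simp: distrib_left distrib_right algebra_simps)
    then have mj: "m * j = - (j * m)" by (simp add: eq_neg_iff_add_eq_0)
    obtain b where b: "j * j = scaleK b 1" using \<open>pure j\<close> by (auto simp: pure_def)
    have b0: "b \<noteq> 0" using b j(2) by auto
    have "span {1, m, j, m * j} = UNIV"
      using quaternion_span[OF a a0 b b0 mj] by (intro four_span_eq_UNIV) auto
    then have "quaternion_basis scaleK m j"
      unfolding quaternion_basis_def using a a0 b b0 mj by blast
    moreover have "s (scaleK t 1 + scaleK x m + scaleK y j + scaleK z (m * j)) =
        scaleK t 1 - scaleK x m - scaleK y j - scaleK z (m * j)" for t x y z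
      by (simp add: s.add s.diff s.neg s.scale s1 s_neg[OF m(1)] s_neg[OF \<open>pure j\<close>] anti mj)
    ultimately have "quaternion_conjugation scaleK s"
      unfolding quaternion_conjugation_def by blast
    then show thesis using nc by blast
  qed
qed

end

section \<open>Quaternion coordinates\<close>

text \<open>Normal form of an orthogonal involution: \<open>i\<close> and \<open>j\<close> are
  fixed, so \<open>i * j\<close> spans the skew elements, the coordinate \<open>c3\<close> below
  detects them, and the fixed part has dimension 3.\<close>

locale involution_quaternion = quaternion_algebra scaleK
  for scaleK :: "'k::field_char_0 \<Rightarrow> 'h::ring_1 \<Rightarrow> 'h" +
  fixes s :: "'h \<Rightarrow> 'h" and i j :: 'h and a b :: 'k
  assumes s_linear: "Vector_Spaces.linear scaleK scaleK s"
    and s_s [simp]: "s (s x) = x" and s_mult: "s (x * y) = s y * s x"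
    and a0: "a \<noteq> 0" and b0: "b \<noteq> 0"
    and ii: "i * i = scaleK a 1" and jj: "j * j = scaleK b 1" and ij_ji: "i * j = - (j * i)"
    and s_i: "s i = i" and s_j: "s j = j"
    and number_field: "number_field TYPE('k)"
begin

definition quat :: "'k \<Rightarrow> 'k \<Rightarrow> 'k \<Rightarrow> 'k \<Rightarrow> 'h" where
  "quat x0 x1 x2 x3 = scaleK x0 1 + scaleK x1 i + scaleK x2 j + scaleK x3 (i * j)"

lemma quat_surj: "\<exists>x0 x1 x2 x3. x = quat x0 x1 x2 x3"
proof -
  have "span {1, i, j, i * j} = UNIV"
    using quaternion_span[OF ii a0 jj b0 ij_ji] by (intro four_span_eq_UNIV)
  then have "x \<in> span {1, i, j, i * j}" by simp
  then obtain x0 x1 x2 x3 where "x - scaleK x0 1 - scaleK x1 i - scaleK x2 j - scaleK x3 (i * j) = 0"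
    by (auto simp: span_breakdown_eq)
  then have "x = quat x0 x1 x2 x3" by (simp add: quat_def algebra_simps)
  then show ?thesis by blast
qed

lemma quat_eq_iff [simp]:
  "quat x0 x1 x2 x3 = quat y0 y1 y2 y3 \<longleftrightarrow> x0 = y0 \<and> x1 = y1 \<and> x2 = y2 \<and> x3 = y3"
proof
  assume "quat x0 x1 x2 x3 = quat y0 y1 y2 y3"
  then have "scaleK (x0 - y0) 1 + scaleK (x1 - y1) i + scaleK (x2 - y2) j + scaleK (x3 - y3) (i * j) = 0"
    by (simp add: quat_def scale_left_diff_distrib algebra_simps)
  from quaternion_span[OF ii a0 jj b0 ij_ji this]
  show "x0 = y0 \<and> x1 = y1 \<and> x2 = y2 \<and> x3 = y3" by simp
qed simp

definition "c0 x = (THE x0. \<exists>x1 x2 x3. x = quat x0 x1 x2 x3)"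
definition "c1 x = (THE x1. \<exists>x0 x2 x3. x = quat x0 x1 x2 x3)"
definition "c2 x = (THE x2. \<exists>x0 x1 x3. x = quat x0 x1 x2 x3)"
definition "c3 x = (THE x3. \<exists>x0 x1 x2. x = quat x0 x1 x2 x3)"

lemma coords_quat [simp]:
  "c0 (quat x0 x1 x2 x3) = x0" "c1 (quat x0 x1 x2 x3) = x1"
  "c2 (quat x0 x1 x2 x3) = x2" "c3 (quat x0 x1 x2 x3) = x3"
  by (simp_all add: c0_def c1_def c2_def c3_def)

lemma quat_coords: "quat (c0 x) (c1 x) (c2 x) (c3 x) = x"
  using quat_surj[of x] by auto

lemma quat_induct: "(\<And>x0 x1 x2 x3. P (quat x0 x1 x2 x3)) \<Longrightarrow> P x"
  using quat_coords[of x] by metis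

lemma quat_add: "quat x0 x1 x2 x3 + quat y0 y1 y2 y3 = quat (x0 + y0) (x1 + y1) (x2 + y2) (x3 + y3)"
  by (simp add: quat_def scale_left_distrib)

lemma quat_scale: "scaleK r (quat x0 x1 x2 x3) = quat (r * x0) (r * x1) (r * x2) (r * x3)"
  by (simp add: quat_def scale_right_distrib)

lemma quat_one: "1 = quat 1 0 0 0" and quat_zero: "0 = quat 0 0 0 0"
  and quat_i: "i = quat 0 1 0 0" and quat_j: "j = quat 0 0 1 0" and quat_k: "i * j = quat 0 0 0 1"
  by (simp_all add: quat_def)

lemma quat_minus: "- quat x0 x1 x2 x3 = quat (- x0) (- x1) (- x2) (- x3)"
  by (simp add: quat_def)

lemma quat_diff: "quat x0 x1 x2 x3 - quat y0 y1 y2 y3 = quat (x0 - y0) (x1 - y1) (x2 - y2) (x3 - y3)"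
  by (simp add: quat_def scale_left_diff_distrib)

lemma quat_mult: "quat x0 x1 x2 x3 * quat y0 y1 y2 y3 =
  quat (x0 * y0 + a * x1 * y1 + b * x2 * y2 - a * b * x3 * y3)
       (x0 * y1 + x1 * y0 - b * x2 * y3 + b * x3 * y2)
       (x0 * y2 + x2 * y0 + a * x1 * y3 - a * x3 * y1)
       (x0 * y3 + x3 * y0 + x1 * y2 - x2 * y1)"
proof -
  have ji: "j * i = - (i * j)" using ij_ji by simp
  define k where "k = i * j"
  have ik: "i * k = scaleK a j" by (simp add: k_def mult.assoc[symmetric] ii scaleK_one_mult)
  have kj: "k * j = scaleK b i" by (simp add: k_def mult.assoc jj scaleK_one_mult)
  have ki: "k * i = - scaleK a j"
  proof -
    have "k * i = - (i * k)" by (simp add: k_def mult.assoc ji)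
    then show ?thesis by (simp add: ik)
  qed
  have jk: "j * k = - scaleK b i"
  proof -
    have "j * k = - (k * j)" by (simp add: k_def mult.assoc[symmetric] ji)
    then show ?thesis by (simp add: kj)
  qed
  have kk: "k * k = - scaleK (a * b) 1"
  proof -
    have "k * k = (k * i) * j" by (simp add: k_def mult.assoc)
    then show ?thesis by (simp add: ki jj scale_mult_left)
  qed
  show ?thesis
    unfolding quat_def k_def[symmetric] distrib_left distrib_right scale_mult_left scale_mult_right
      ii jj ik kj ki jk kk ji k_def[symmetric] mult_1_left mult_1_right scale_scale scale_minus_right
      scale_left_distrib scale_left_diff_distrib
    by (simp only: scale_right_distrib scale_minus_right scale_scale mult_ac add_ac diff_conv_add_uminus
        minus_add_distrib minus_minus)
qed

lemma s_quat: "s (quat x0 x1 x2 x3) = quat x0 x1 x2 (- x3)"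
proof -
  interpret s: Vector_Spaces.linear scaleK scaleK s by (rule s_linear)
  have "s 1 = 1" using s_mult[of "s 1" 1] by simp
  moreover have "s (i * j) = - (i * j)"
  proof -
    have "s (i * j) = j * i" by (simp only: s_mult s_i s_j)
    then show ?thesis by (simp only: ij_ji minus_minus)
  qed
  ultimately show ?thesis by (simp add: quat_def s.add s.scale s_i s_j)
qed

lemmas quat_ops = quat_add quat_scale quat_minus quat_diff quat_mult s_quat

lemma coords_add: "c0 (x + y) = c0 x + c0 y" "c1 (x + y) = c1 x + c1 y"
    "c2 (x + y) = c2 x + c2 y" "c3 (x + y) = c3 x + c3 y"
  and coords_diff: "c0 (x - y) = c0 x - c0 y" "c1 (x - y) = c1 x - c1 y"
    "c2 (x - y) = c2 x - c2 y" "c3 (x - y) = c3 x - c3 y"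
  and coords_mult: "c0 (x * y) = c0 x * c0 y + a * c1 x * c1 y + b * c2 x * c2 y - a * b * c3 x * c3 y"
    "c1 (x * y) = c0 x * c1 y + c1 x * c0 y - b * c2 x * c3 y + b * c3 x * c2 y"
    "c2 (x * y) = c0 x * c2 y + c2 x * c0 y + a * c1 x * c3 y - a * c3 x * c1 y"
    "c3 (x * y) = c0 x * c3 y + c3 x * c0 y + c1 x * c2 y - c2 x * c1 y"
  by (induction x rule: quat_induct, induction y rule: quat_induct, simp add: quat_ops)+

lemma coords_uminus: "c0 (- x) = - c0 x" "c1 (- x) = - c1 x" "c2 (- x) = - c2 x" "c3 (- x) = - c3 x"
  and coords_scale: "c0 (scaleK r x) = r * c0 x" "c1 (scaleK r x) = r * c1 x"
    "c2 (scaleK r x) = r * c2 x" "c3 (scaleK r x) = r * c3 x"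
  and coords_s: "c0 (s x) = c0 x" "c1 (s x) = c1 x" "c2 (s x) = c2 x" "c3 (s x) = - c3 x"
  by (induction x rule: quat_induct, simp add: quat_ops)+

lemma coords_const: "c0 1 = 1" "c1 1 = 0" "c2 1 = 0" "c3 1 = 0" "c0 0 = 0" "c1 0 = 0" "c2 0 = 0" "c3 0 = 0"
  "c0 i = 0" "c1 i = 1" "c2 i = 0" "c3 i = 0" "c0 j = 0" "c1 j = 0" "c2 j = 1" "c3 j = 0"
  by (simp_all only: coords_quat[of 1 0 0 0, folded quat_one] coords_quat[of 0 0 0 0, folded quat_zero]
    coords_quat[of 0 1 0 0, folded quat_i] coords_quat[of 0 0 1 0, folded quat_j])

lemmas coords = coords_add coords_diff coords_mult coords_uminus coords_scale coords_s coords_const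

lemma coords_eqI: "c0 x = c0 y \<Longrightarrow> c1 x = c1 y \<Longrightarrow> c2 x = c2 y \<Longrightarrow> c3 x = c3 y \<Longrightarrow> x = y"
  by (metis quat_coords)

lemma s_add: "s (x + y) = s x + s y" and s_diff: "s (x - y) = s x - s y"
  and s_scale: "s (scaleK r x) = scaleK r (s x)" and s_one [simp]: "s 1 = 1" and s_zero [simp]: "s 0 = 0"
  and s_uminus: "s (- x) = - s x"
  by (rule coords_eqI; simp add: coords)+

definition "trd x = 2 * c0 x"
definition "nrd x = c0 x ^ 2 - a * c1 x ^ 2 - b * c2 x ^ 2 + a * b * c3 x ^ 2"

lemma nrd_mult: "nrd (x * y) = nrd x * nrd y"
  by (simp add: nrd_def coords power2_eq_square algebra_simps)

lemma nrd_one [simp]: "nrd 1 = 1" and nrd_scale: "nrd (scaleK r x) = r ^ 2 * nrd x"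
  and nrd_s: "nrd (s x) = nrd x" and nrd_add: "nrd (x + y) = nrd x + nrd y + trd x * trd y - trd (x * y)"
  by (simp_all add: nrd_def trd_def coords power2_eq_square algebra_simps)

lemma nrd_power: "nrd (x ^ n) = nrd x ^ n"
  by (induction n) (simp_all add: nrd_mult)

lemma trd_add: "trd (x + y) = trd x + trd y" and trd_diff: "trd (x - y) = trd x - trd y"
  and trd_scale: "trd (scaleK r x) = r * trd x" and trd_one: "trd 1 = 2" and trd_s: "trd (s x) = trd x"
  and trd_commute: "trd (x * y) = trd (y * x)"
  by (simp_all add: trd_def coords algebra_simps)

lemma square_eq: "x * x = scaleK (trd x) x - scaleK (nrd x) 1"
  by (rule coords_eqI; simp add: trd_def nrd_def coords power2_eq_square algebra_simps)

text \<open>The polarized Cayley-Hamilton identity. It moves \<open>z\<close> to the right of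
  \<open>x\<close> at the cost of terms with trace coefficients, which is what makes R + R z closed
  under multiplication.\<close>

lemma swap_eq: "z * x = scaleK (trd (z * x)) 1 - scaleK (trd z * trd x) 1 + scaleK (trd z) x + scaleK (trd x) z - x * z"
  by (rule coords_eqI; simp add: trd_def coords algebra_simps)

section \<open>Lattices and orders\<close>

text \<open>The coefficient ring is a parameter: the integers of K for orders, a valuation ring for
  localized orders.\<close>

definition rsub :: "'k set \<Rightarrow> 'h set \<Rightarrow> bool" where
  "rsub A M \<longleftrightarrow> 0 \<in> M \<and> (\<forall>x\<in>M. \<forall>y\<in>M. x + y \<in> M) \<and> (\<forall>c\<in>A. \<forall>x\<in>M. scaleK c x \<in> M)"

definition rspan :: "'k set \<Rightarrow> 'h set \<Rightarrow> 'h set" where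
  "rspan A B = {\<Sum>b\<in>B. scaleK (c b) b | c. \<forall>b\<in>B. c b \<in> A}"

lemma
  assumes "is_subring A" "rsub A M"
  shows rsub_0: "0 \<in> M" and rsub_add: "x \<in> M \<Longrightarrow> y \<in> M \<Longrightarrow> x + y \<in> M"
    and rsub_scale: "c \<in> A \<Longrightarrow> x \<in> M \<Longrightarrow> scaleK c x \<in> M"
    and rsub_uminus: "x \<in> M \<Longrightarrow> - x \<in> M" and rsub_diff: "x \<in> M \<Longrightarrow> y \<in> M \<Longrightarrow> x - y \<in> M"
proof -
  show 1: "0 \<in> M" and 2: "x \<in> M \<Longrightarrow> y \<in> M \<Longrightarrow> x + y \<in> M"
    and 3: "c \<in> A \<Longrightarrow> x \<in> M \<Longrightarrow> scaleK c x \<in> M" for x y c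
    using assms unfolding rsub_def by blast+
  have "-1 \<in> A" using assms(1) unfolding is_subring_def by blast
  then show 4: "x \<in> M \<Longrightarrow> - x \<in> M" for x
    using 3[of "-1"] by simp
  show "x \<in> M \<Longrightarrow> y \<in> M \<Longrightarrow> x - y \<in> M"
    using 2[of x "- y"] 4 by simp
qed

lemma rsub_sum: "is_subring A \<Longrightarrow> rsub A M \<Longrightarrow> (\<And>x. x \<in> I \<Longrightarrow> f x \<in> M) \<Longrightarrow> sum f I \<in> M"
  by (induction I rule: infinite_finite_induct) (auto simp: rsub_0 rsub_add)

lemma rsub_rspan:
  assumes A: "is_subring A" shows "rsub A (rspan A B)"
  unfolding rsub_def
proof (intro conjI ballI)
  show "0 \<in> rspan A B"
    unfolding rspan_def using A by (intro CollectI exI[of _ "\<lambda>_. 0"]) (simp add: is_subring_def)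
next
  fix x y assume "x \<in> rspan A B" "y \<in> rspan A B"
  then obtain c d where *: "\<forall>b\<in>B. c b \<in> A" "\<forall>b\<in>B. d b \<in> A"
    "x = (\<Sum>b\<in>B. scaleK (c b) b)" "y = (\<Sum>b\<in>B. scaleK (d b) b)" unfolding rspan_def by blast
  then have "x + y = (\<Sum>b\<in>B. scaleK (c b + d b) b)"
    by (simp add: scale_left_distrib sum.distrib)
  then show "x + y \<in> rspan A B"
    unfolding rspan_def using * A by (intro CollectI exI[of _ "\<lambda>b. c b + d b"]) (auto simp: is_subring_def)
next
  fix r :: 'k and x assume "r \<in> A" "x \<in> rspan A B"
  then obtain c where *: "\<forall>b\<in>B. c b \<in> A" "x = (\<Sum>b\<in>B. scaleK (c b) b)" unfolding rspan_def by blast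
  then have "scaleK r x = (\<Sum>b\<in>B. scaleK (r * c b) b)" by (simp add: scale_sum_right)
  then show "scaleK r x \<in> rspan A B"
    unfolding rspan_def using * \<open>r \<in> A\<close> A
    by (intro CollectI exI[of _ "\<lambda>b. r * c b"]) (auto simp: is_subring_def)
qed

lemma rspan_base:
  assumes "is_subring A" "finite B" "x \<in> B" shows "x \<in> rspan A B"
proof -
  have "x = (\<Sum>b\<in>B. scaleK (if b = x then 1 else 0) b)"
    using assms by (simp add: if_distrib[of "\<lambda>c. scaleK c _"] cong: if_cong)
  then show ?thesis
    unfolding rspan_def using assms(1)
    by (intro CollectI exI[of _ "\<lambda>b. if b = x then 1 else 0"]) (auto simp: is_subring_def)
qed

lemma rspan_minimal: "is_subring A \<Longrightarrow> rsub A M \<Longrightarrow> B \<subseteq> M \<Longrightarrow> rspan A B \<subseteq> M"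
  unfolding rspan_def by (auto intro!: rsub_sum rsub_scale)

abbreviation osub :: "'h set \<Rightarrow> bool" where "osub \<equiv> rsub oK"
abbreviation ospan :: "'h set \<Rightarrow> 'h set" where "ospan \<equiv> rspan oK"

lemmas osub_def = rsub_def[of oK] and ospan_def = rspan_def[of oK]
lemmas osub_0 = rsub_0[OF is_subring_oK] and osub_add = rsub_add[OF is_subring_oK]
  and osub_scale = rsub_scale[OF is_subring_oK] and osub_uminus = rsub_uminus[OF is_subring_oK]
  and osub_diff = rsub_diff[OF is_subring_oK] and osub_sum = rsub_sum[OF is_subring_oK]
  and osub_ospan = rsub_rspan[OF is_subring_oK] and ospan_base = rspan_base[OF is_subring_oK]
  and ospan_minimal = rspan_minimal[OF is_subring_oK]
lemmas osubD = osub_0 osub_add osub_scale osub_uminus osub_diff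

lemma finitely_generated_iff: "finitely_generated_over_integers scaleK L \<longleftrightarrow> (\<exists>B. finite B \<and> L = ospan B)"
  by (simp add: finitely_generated_over_integers_def ospan_def)

lemma order_generators:
  assumes "is_order scaleK R" obtains B where "finite B" "R = ospan B"
  using assms unfolding is_order_def finitely_generated_iff by blast

lemma order_osub: "is_order scaleK R \<Longrightarrow> osub R"
  using order_generators osub_ospan by metis

lemma order_mult: "is_order scaleK R \<Longrightarrow> x \<in> R \<Longrightarrow> y \<in> R \<Longrightarrow> x * y \<in> R"
  and order_one: "is_order scaleK R \<Longrightarrow> 1 \<in> R"
  by (auto simp: is_order_def)

lemma order_power: "is_order scaleK R \<Longrightarrow> x \<in> R \<Longrightarrow> x ^ n \<in> R"
  by (induction n) (auto simp: order_one order_mult)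

section \<open>Integrality of norms and traces on orders\<close>

lemma order_coords_bounded:
  assumes "is_order scaleK R"
  shows "\<exists>N>0. \<forall>x\<in>R. of_nat N * c0 x \<in> oK \<and> of_nat N * c1 x \<in> oK \<and> of_nat N * c2 x \<in> oK \<and> of_nat N * c3 x \<in> oK"
proof -
  obtain B where B: "finite B" "R = ospan B" using order_generators[OF assms] .
  obtain N where N: "N > 0" "\<forall>x \<in> c0 ` B \<union> c1 ` B \<union> c2 ` B \<union> c3 ` B. of_nat N * x \<in> oK"
    using common_denominator[OF number_field, of "c0 ` B \<union> c1 ` B \<union> c2 ` B \<union> c3 ` B"] B(1) by auto
  let ?M = "{x. of_nat N * c0 x \<in> oK \<and> of_nat N * c1 x \<in> oK \<and> of_nat N * c2 x \<in> oK \<and> of_nat N * c3 x \<in> oK}"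
  have "osub ?M"
    unfolding osub_def by (auto simp: coords distrib_left mult.left_commute)
  then have "R \<subseteq> ?M" unfolding B(2) using N(2) by (intro ospan_minimal) auto
  then show ?thesis using N(1) by blast
qed

text \<open>The powers of \<open>x\<close> stay in \<open>R\<close>, where coordinates have bounded
  denominators. So the powers of \<open>nrd x\<close> have bounded denominators, which forces
  integrality.\<close>

lemma nrd_integral:
  assumes R: "is_order scaleK R" and x: "x \<in> R" shows "nrd x \<in> oK"
proof -
  obtain N where N: "N > 0" "\<forall>x\<in>R. of_nat N * c0 x \<in> oK \<and> of_nat N * c1 x \<in> oK \<and> of_nat N * c2 x \<in> oK \<and> of_nat N * c3 x \<in> oK"
    using order_coords_bounded[OF R] by blast
  obtain M where M: "M > 0" "\<forall>x\<in>{a, b, a * b}. of_nat M * x \<in> oK"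
    using common_denominator[OF number_field, of "{a, b, a * b}"] by auto
  \<comment> \<open>\<open>M\<close> clears the structure constants and \<open>N\<close> the
    coordinates, which enter squared.\<close>
  have "of_nat (M * N * N) * nrd y \<in> oK" if "y \<in> R" for y
  proof -
    define u0 u1 u2 u3 where u: "u0 = of_nat N * c0 y" "u1 = of_nat N * c1 y" "u2 = of_nat N * c2 y"
      "u3 = of_nat N * c3 y"
    define m1 m2 m3 where m: "m1 = of_nat M * a" "m2 = of_nat M * b" "m3 = of_nat M * (a * b)"
    have "u0 \<in> oK" "u1 \<in> oK" "u2 \<in> oK" "u3 \<in> oK" "m1 \<in> oK" "m2 \<in> oK" "m3 \<in> oK"
      using N(2) M(2) that unfolding u m by blast+
    then have "of_nat M * u0 * u0 - m1 * u1 * u1 - m2 * u2 * u2 + m3 * u3 * u3 \<in> oK"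
      by (intro oK_add oK_diff oK_mult oK_of_nat)
    also have "of_nat M * u0 * u0 - m1 * u1 * u1 - m2 * u2 * u2 + m3 * u3 * u3 = of_nat (M * N * N) * nrd y"
      by (simp add: u m nrd_def power2_eq_square algebra_simps)
    finally show ?thesis .
  qed
  from this[OF order_power[OF R x]] have "of_nat (M * N * N) * nrd x ^ m \<in> oK" for m
    unfolding nrd_power .
  moreover have "0 < M * N * N" using N(1) M(1) by simp
  ultimately show ?thesis by (rule integral_if_powers_bounded[OF number_field, rotated])
qed

lemma trd_integral:
  assumes R: "is_order scaleK R" and x: "x \<in> R" shows "trd x \<in> oK"
proof -
  have "1 + x \<in> R" using osub_add[OF order_osub[OF R] order_one[OF R] x] .
  then have "nrd (1 + x) - nrd x - 1 \<in> oK"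
    using nrd_integral[OF R] x by (intro oK_diff) auto
  then show ?thesis by (simp add: nrd_add trd_one)
qed

lemma order_contains_multiple:
  assumes "span M = UNIV" "osub M" shows "\<exists>n>0. scaleK (of_nat n) x \<in> M"
proof -
  have "x \<in> span M" using assms by simp
  then obtain t u where t: "finite t" "t \<subseteq> M" "x = (\<Sum>v\<in>t. scaleK (u v) v)"
    unfolding span_explicit by blast
  obtain n where n: "n > 0" "\<forall>y\<in>u ` t. of_nat n * y \<in> oK"
    using common_denominator[OF number_field, of "u ` t"] t(1) by auto
  have "scaleK (of_nat n) x = (\<Sum>v\<in>t. scaleK (of_nat n * u v) v)"
    by (simp add: t(3) scale_sum_right)
  also have "\<dots> \<in> M"
    using n t by (intro osub_sum[OF assms(2)] osub_scale[OF assms(2)]) auto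
  finally show ?thesis using n(1) by blast
qed

text \<open>Under these hypotheses \<open>R + R z\<close> is a ring, because \<open>z x + x z\<close> lies in \<open>R + R z\<close> for \<open>x\<close> in \<open>R\<close>.\<close>

lemma maximal_absorbs:
  assumes max: "maximal_involution_order scaleK s R" and n: "nrd z \<in> oK" and t: "\<And>w. w \<in> R \<Longrightarrow> trd (z * w) \<in> oK"
    and sz: "\<exists>r\<in>R. \<exists>r'\<in>R. s z = r + r' * z"
  shows "z \<in> R"
proof -
  have R: "is_order scaleK R" and sR: "\<And>x. x \<in> R \<Longrightarrow> s x \<in> R"
    and maxR: "\<And>R'. is_order scaleK R' \<Longrightarrow> (\<And>x. x \<in> R' \<Longrightarrow> s x \<in> R') \<Longrightarrow> \<not> R \<subset> R'"
    using max unfolding maximal_involution_order_def involution_order_def by blast+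
  note sub = osubD[OF order_osub[OF R]]
  define S where "S = {r + r' * z | r r'. r \<in> R \<and> r' \<in> R}"
  have SI: "r \<in> R \<Longrightarrow> r' \<in> R \<Longrightarrow> r + r' * z \<in> S" for r r' unfolding S_def by blast
  have SE: "\<exists>r r'. r \<in> R \<and> r' \<in> R \<and> x = r + r' * z" if "x \<in> S" for x
    using that unfolding S_def by blast
  have RS: "r \<in> S" if "r \<in> R" for r using SI[OF that sub(1)] by simp
  have zS: "z \<in> S" using SI[OF sub(1) order_one[OF R]] by simp
  have S_add: "x + y \<in> S" if xy: "x \<in> S" "y \<in> S" for x y
  proof -
    obtain p q where p: "p \<in> R" "q \<in> R" "x = p + q * z" using SE[OF xy(1)] by blast
    obtain p' q' where p': "p' \<in> R" "q' \<in> R" "y = p' + q' * z" using SE[OF xy(2)] by blast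
    have "x + y = (p + p') + (q + q') * z" by (simp add: p p' algebra_simps)
    then show ?thesis using SI sub(2) p p' by metis
  qed
  have S_left: "r * x \<in> S" if r: "r \<in> R" and x: "x \<in> S" for r x
  proof -
    obtain p q where p: "p \<in> R" "q \<in> R" "x = p + q * z" using SE[OF x] by blast
    have "r * x = r * p + (r * q) * z" by (simp add: p algebra_simps)
    then show ?thesis using SI order_mult[OF R] r p by metis
  qed
  have scalar: "scaleK c 1 \<in> R" if "c \<in> oK" for c using sub(3)[OF that order_one[OF R]] .
  have S_scale: "scaleK c x \<in> S" if "c \<in> oK" "x \<in> S" for c x
    using S_left[OF scalar[OF that(1)] that(2)] by (simp add: scaleK_one_mult)
  have oS: "osub S"
    unfolding osub_def using RS[OF sub(1)] S_add S_scale by blast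
  note subS = osubD[OF oS]
  have tz: "trd z \<in> oK" using t[OF order_one[OF R]] by simp
  have oneS: "1 \<in> S" using RS[OF order_one[OF R]] .
  have zx: "z * x \<in> S" if x: "x \<in> R" for x
    by (subst swap_eq) (intro subS(2,5) S_scale oK_mult oneS RS[OF x] zS t[OF x] tz trd_integral[OF R x]
      S_left[OF x zS])
  have zz: "z * z \<in> S"
    by (subst square_eq) (intro subS(5) S_scale tz n zS oneS)
  have S_right_R: "x * r \<in> S" if xr: "x \<in> S" "r \<in> R" for x r
  proof -
    obtain p q where p: "p \<in> R" "q \<in> R" "x = p + q * z" using SE[OF xr(1)] by blast
    have "x * r = p * r + q * (z * r)" by (simp add: p algebra_simps)
    then show ?thesis using S_add RS order_mult[OF R] S_left zx xr p by metis
  qed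
  have S_right_z: "x * z \<in> S" if x: "x \<in> S" for x
  proof -
    obtain p q where p: "p \<in> R" "q \<in> R" "x = p + q * z" using SE[OF x] by blast
    have "x * z = p * z + q * (z * z)" by (simp add: p algebra_simps)
    then show ?thesis using S_add S_left zz zS p by metis
  qed
  have S_mult: "x * y \<in> S" if xy: "x \<in> S" "y \<in> S" for x y
  proof -
    obtain p q where p: "p \<in> R" "q \<in> R" "y = p + q * z" using SE[OF xy(2)] by blast
    have "x * y = x * p + (x * q) * z" by (simp add: p algebra_simps)
    then show ?thesis
      using S_add[OF S_right_R[OF xy(1) p(1)] S_right_z[OF S_right_R[OF xy(1) p(2)]]] by simp
  qed
  have szS: "s z \<in> S"
  proof -
    obtain p q where "p \<in> R" "q \<in> R" "s z = p + q * z" using sz by (elim bexE)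
    then show ?thesis using SI by (simp only:)
  qed
  have S_s: "s x \<in> S" if x: "x \<in> S" for x
  proof -
    obtain p q where p: "p \<in> R" "q \<in> R" "x = p + q * z" using SE[OF x] by blast
    have "s x = s p + s z * s q" by (simp add: p s_add s_mult)
    then show ?thesis
      using S_add[OF RS[OF sR[OF p(1)]] S_mult[OF szS RS[OF sR[OF p(2)]]]] by simp
  qed
  obtain B where B: "finite B" "R = ospan B" using order_generators[OF R] .
  have "S = ospan (B \<union> (\<lambda>b. b * z) ` B)" (is "S = ospan ?C")
  proof
    have fin: "finite ?C" using B(1) by simp
    show "ospan ?C \<subseteq> S"
      using B ospan_base[OF B(1)] RS S_right_z by (intro ospan_minimal[OF oS]) auto
    have 1: "R \<subseteq> ospan ?C"
      unfolding B(2) using ospan_base[OF fin] by (intro ospan_minimal[OF osub_ospan]) auto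
    have "R \<subseteq> {x. x * z \<in> ospan ?C}"
      unfolding B(2)
    proof (rule ospan_minimal)
      show "B \<subseteq> {x. x * z \<in> ospan ?C}" using ospan_base[OF fin] by auto
      show "osub {x. x * z \<in> ospan ?C}"
        using osubD[OF osub_ospan[of ?C]] by (auto simp: osub_def distrib_right scale_mult_left)
    qed
    then have 2: "x * z \<in> ospan ?C" if "x \<in> R" for x using that by blast
    show "S \<subseteq> ospan ?C"
    proof
      fix x assume "x \<in> S"
      from SE[OF this] obtain p q where p: "p \<in> R" "q \<in> R" "x = p + q * z" by (elim exE conjE)
      show "x \<in> ospan ?C"
        unfolding p(3) by (rule osub_add[OF osub_ospan subsetD[OF 1 p(1)] 2[OF p(2)]])
    qed
  qed
  then have "finitely_generated_over_integers scaleK S"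
    using B(1) unfolding finitely_generated_iff
    by (intro exI[of _ "B \<union> (\<lambda>b. b * z) ` B"] conjI) (simp, assumption)
  moreover have "span S = UNIV"
  proof -
    have "span R \<subseteq> span S" using RS by (intro span_mono) auto
    then show ?thesis using R by (auto simp: is_order_def)
  qed
  ultimately have "is_order scaleK S"
    unfolding is_order_def using RS[OF order_one[OF R]] subS(5) S_mult by blast
  then have "\<not> R \<subset> S" using maxR S_s by blast
  then show ?thesis using RS zS by blast
qed

section \<open>Finite generation of lattices\<close>

sublocale ratH: rat_space "\<lambda>q x. scaleK (of_rat q) x"
  by standard (auto simp: scale_right_distrib scale_left_distrib of_rat_add of_rat_mult)

lemma finite_rational_basis: obtains B where "finite B" "ratH.span B = UNIV"
proof -
  obtain B :: "'k set" where B: "finite B" "ratK.span B = UNIV"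
    using number_field unfolding number_field_def by blast
  define C where "C = (\<lambda>(c, e). scaleK c e) ` (B \<times> {1, i, j, i * j})"
  have "finite C" using B by (simp add: C_def)
  have *: "scaleK c e \<in> ratH.span C" if "e \<in> {1, i, j, i * j}" for c e
  proof -
    have "c \<in> ratK.span B" using B by simp
    then show ?thesis
    proof (induction rule: ratK.span_induct_alt)
      case (step q c d)
      have "scaleK c e \<in> ratH.span C" using step(1) that by (intro ratH.span_base) (auto simp: C_def)
      then have "scaleK (of_rat q) (scaleK c e) + scaleK d e \<in> ratH.span C"
        by (intro ratH.span_add step(2)) (rule ratH.span_scale)
      then show ?case by (simp add: scale_left_distrib)
    qed (simp add: ratH.span_zero)
  qed
  have "x \<in> ratH.span C" for x
    by (induction x rule: quat_induct) (unfold quat_def, intro ratH.span_add *, simp_all)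
  then have "ratH.span C = UNIV" by blast
  then show thesis using \<open>finite C\<close> that by blast
qed

lemma finite_quotient_osub:
  assumes "osub M" "0 < N"
  obtains F where "finite F" "F \<subseteq> M" "\<And>x. x \<in> M \<Longrightarrow> \<exists>f\<in>F. \<exists>y\<in>M. x = f + scaleK (of_nat N) y"
proof -
  obtain B where B: "finite B" "ratH.span B = UNIV" by (rule finite_rational_basis)
  have "ratH.subgroup_set M"
    unfolding ratH.subgroup_set_def using osub_0[OF assms(1)] osub_diff[OF assms(1)] by blast
  from ratH.finite_quotient[OF B this assms(2)] show ?thesis using that by auto
qed

text \<open>Some multiple n R lies in M, and N M lies in R. Modulo n N M there are finitely many
  classes, and n N M is inside n R; so class representatives together with n times the generators of
  \<open>R\<close> generate \<open>M\<close>.\<close>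

lemma finitely_generated_if_sandwiched:
  assumes M: "osub M" "span M = UNIV" and R: "is_order scaleK R"
    and N: "0 < N" "\<And>x. x \<in> M \<Longrightarrow> scaleK (of_nat N) x \<in> R"
  shows "finitely_generated_over_integers scaleK M"
proof -
  obtain B where B: "finite B" "R = ospan B" using order_generators[OF R] .
  have "\<exists>n>0. \<forall>b\<in>B. scaleK (of_nat n) b \<in> M"
  proof (rule common_multiple_exists[OF B(1)])
    show "\<exists>n>0. scaleK (of_nat n) b \<in> M" for b by (rule order_contains_multiple[OF M(2,1)])
    show "scaleK (of_nat (n * m)) b \<in> M" if "scaleK (of_nat n) b \<in> M" for b n m
      using osub_scale[OF M(1) oK_of_nat[of m] that] by (simp add: mult.commute)
  qed
  then obtain n where n: "n > 0" "\<forall>b\<in>B. scaleK (of_nat n) b \<in> M" by blast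
  obtain F where F: "finite F" "F \<subseteq> M" "\<And>x. x \<in> M \<Longrightarrow> \<exists>f\<in>F. \<exists>y\<in>M. x = f + scaleK (of_nat (n * N)) y"
    using finite_quotient_osub[OF M(1), of "n * N"] n(1) N(1) by (metis nat_0_less_mult_iff)
  define C where "C = F \<union> (\<lambda>b. scaleK (of_nat n) b) ` B"
  have fin: "finite C" using F B by (simp add: C_def)
  have "M = ospan C"
  proof
    show "ospan C \<subseteq> M" using F n by (intro ospan_minimal[OF M(1)]) (auto simp: C_def)
    have nR: "R \<subseteq> {x. scaleK (of_nat n) x \<in> ospan C}"
      unfolding B(2)
    proof (rule ospan_minimal)
      show "B \<subseteq> {x. scaleK (of_nat n) x \<in> ospan C}" using ospan_base[OF fin] by (auto simp: C_def)
      show "osub {x. scaleK (of_nat n) x \<in> ospan C}"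
        using osubD[OF osub_ospan[of C]]
        by (auto simp: osub_def scale_right_distrib) (metis mult.commute scale_scale)
    qed
    show "M \<subseteq> ospan C"
    proof
      fix x assume "x \<in> M"
      then obtain f y where f: "f \<in> F" "y \<in> M" "x = f + scaleK (of_nat (n * N)) y" using F(3) by blast
      have "scaleK (of_nat n) (scaleK (of_nat N) y) \<in> ospan C" using nR N(2)[OF f(2)] by blast
      moreover have "f \<in> ospan C" using ospan_base[OF fin] f(1) by (simp add: C_def)
      ultimately show "x \<in> ospan C" unfolding f(3) using osub_add[OF osub_ospan] by simp
    qed
  qed
  then show ?thesis unfolding finitely_generated_iff using fin by blast
qed

end

section \<open>Dyadic valuation rings\<close>

text \<open>\<open>V\<close> is a localization of the ring of integers at a prime above \<open>2\<close>, and \<open>p\<close> is a uniformizer.\<close>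

locale dyadic_valuation =
  fixes V :: "'k::field_char_0 set" and p :: 'k
  assumes V_subring: "is_subring V" and oK_subset: "oK \<subseteq> V"
    and V_total: "x \<notin> V \<Longrightarrow> 1 / x \<in> V"
    and p_in: "p \<in> V" and p_nonzero: "p \<noteq> 0" and p_nonunit: "1 / p \<notin> V"
    and p_divides: "x \<in> V \<Longrightarrow> x = 0 \<or> 1 / x \<notin> V \<Longrightarrow> x / p \<in> V"
    and two_nonunit: "2 / p \<in> V"
    and square_residue: "x \<in> V \<Longrightarrow> \<exists>y\<in>V. (x - y ^ 2) / p \<in> V"
    and V_denominator: "finite X \<Longrightarrow> X \<subseteq> V \<Longrightarrow> \<exists>q\<in>oK. q \<noteq> 0 \<and> 1 / q \<in> V \<and> (\<forall>x\<in>X. q * x \<in> oK)"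
begin

lemma V_0 [simp]: "0 \<in> V" and V_1 [simp]: "1 \<in> V"
  and V_add: "x \<in> V \<Longrightarrow> y \<in> V \<Longrightarrow> x + y \<in> V" and V_mult: "x \<in> V \<Longrightarrow> y \<in> V \<Longrightarrow> x * y \<in> V"
  and V_uminus: "x \<in> V \<Longrightarrow> - x \<in> V"
  using V_subring unfolding is_subring_def by blast+

lemma V_diff: "x \<in> V \<Longrightarrow> y \<in> V \<Longrightarrow> x - y \<in> V"
  using V_add[of x "- y"] V_uminus by simp

definition pideal :: "nat \<Rightarrow> 'k set" where
  "pideal n = {x. x / p ^ n \<in> V}"

lemma pideal_0: "x \<in> pideal 0 \<longleftrightarrow> x \<in> V" and pideal_1: "x \<in> pideal 1 \<longleftrightarrow> x / p \<in> V"
  by (simp_all add: pideal_def)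

lemma pideal_add: "x \<in> pideal n \<Longrightarrow> y \<in> pideal n \<Longrightarrow> x + y \<in> pideal n"
  and pideal_diff: "x \<in> pideal n \<Longrightarrow> y \<in> pideal n \<Longrightarrow> x - y \<in> pideal n"
  and pideal_uminus: "x \<in> pideal n \<Longrightarrow> - x \<in> pideal n"
  using V_add[of "x / p ^ n" "y / p ^ n"] V_diff[of "x / p ^ n" "y / p ^ n"] V_uminus[of "x / p ^ n"]
  by (simp_all add: pideal_def add_divide_distrib diff_divide_distrib)

lemma pideal_mult: "x \<in> pideal m \<Longrightarrow> y \<in> pideal n \<Longrightarrow> x * y \<in> pideal (m + n)"
  using V_mult[of "x / p ^ m" "y / p ^ n"] by (simp add: pideal_def power_add)

lemma pideal_Suc: "x \<in> pideal (Suc n) \<Longrightarrow> x \<in> pideal n"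
  using V_mult[of p "x / p ^ Suc n"] p_in p_nonzero by (simp add: pideal_def)

lemma pideal_V: "x \<in> V \<Longrightarrow> y \<in> pideal n \<Longrightarrow> x * y \<in> pideal n"
  using pideal_mult[of x 0 y n] by (simp add: pideal_0)

lemma pideal_sub_V: "x \<in> pideal n \<Longrightarrow> x \<in> V"
  by (induction n) (use pideal_0 pideal_Suc in blast)+

lemma unit_or_pideal: "x \<in> V \<Longrightarrow> x \<notin> pideal 1 \<Longrightarrow> x \<noteq> 0 \<and> 1 / x \<in> V"
  using p_divides[of x] unfolding pideal_1 by fastforce

lemma one_notin_pideal: "1 \<notin> pideal 1"
  using p_nonunit unfolding pideal_1 .

lemma pideal_cancel_unit:
  assumes "x \<in> V" "x \<notin> pideal 1" "x * y \<in> pideal n" shows "y \<in> pideal n"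
  using pideal_V[of "1 / x" "x * y" n] unit_or_pideal[OF assms(1,2)] assms(3) by simp

lemma pideal_square: "x \<in> V \<Longrightarrow> x * x \<in> pideal 1 \<Longrightarrow> x \<in> pideal 1"
  using pideal_cancel_unit[of x x 1] by blast

lemma V_square: "x * x \<in> V \<Longrightarrow> x \<in> V"
  using V_mult[of "x * x" "1 / x"] V_total[of x] by (cases "x = 0") auto

lemma two_pideal: "2 \<in> pideal 1"
  using two_nonunit unfolding pideal_1 .

text \<open>Divisibility in a valuation ring is total, so one of finitely many field elements has
  least valuation. They may lie outside \<open>V\<close>; dividing by \<open>c\<close> brings them
  into it.\<close>

lemma max_coefficient:
  assumes "finite X" "\<exists>x\<in>X. x \<noteq> 0" shows "\<exists>c\<in>X. c \<noteq> 0 \<and> (\<forall>x\<in>X. x / c \<in> V)"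
  using assms
proof (induction X)
  case (insert y X)
  show ?case
  proof (cases "\<exists>x\<in>X. x \<noteq> 0")
    case True
    then obtain c where c: "c \<in> X" "c \<noteq> 0" "\<forall>x\<in>X. x / c \<in> V" using insert by blast
    show ?thesis
    proof (cases "y / c \<in> V")
      case True
      then show ?thesis using c by blast
    next
      case False
      then have "y \<noteq> 0" "c / y \<in> V" using V_total[of "y / c"] by auto
      moreover have "x / y \<in> V" if "x \<in> X" for x
        using V_mult[of "x / c" "c / y"] c that \<open>c / y \<in> V\<close> by simp
      ultimately show ?thesis by (intro bexI[of _ y]) auto
    qed
  next
    case False
    then show ?thesis using insert.prems by (intro bexI[of _ y]) auto
  qed
qed simp

end

section \<open>Construction of the dyadic valuation\<close>

lemma maximal_ideal_exists:
  assumes D: "D \<subseteq> (oK :: 'k::field_char_0 set)" "0 \<in> D" "1 \<notin> D"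
    "\<And>x y. x \<in> D \<Longrightarrow> y \<in> D \<Longrightarrow> x + y \<in> D" "\<And>r x. r \<in> oK \<Longrightarrow> x \<in> D \<Longrightarrow> r * x \<in> D"
  shows "\<exists>M. D \<subseteq> M \<and> M \<subseteq> oK \<and> 1 \<notin> M \<and> (\<forall>x\<in>M. \<forall>y\<in>M. x + y \<in> M) \<and> (\<forall>r\<in>oK. \<forall>x\<in>M. r * x \<in> M)
    \<and> (\<forall>q\<in>oK. q \<notin> M \<longrightarrow> (\<exists>r\<in>oK. 1 - q * r \<in> M))"
proof -
  define P where "P I \<longleftrightarrow> D \<subseteq> I \<and> I \<subseteq> oK \<and> 1 \<notin> I \<and> (\<forall>x\<in>I. \<forall>y\<in>I. x + y \<in> I) \<and> (\<forall>r\<in>oK. \<forall>x\<in>I. r * x \<in> I)"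
    for I :: "'k set"
  have "P D" unfolding P_def using D by blast
  have "\<exists>M\<in>Collect P. \<forall>X\<in>Collect P. M \<subseteq> X \<longrightarrow> X = M"
  proof (rule subset_Zorn_nonempty)
    show "Collect P \<noteq> {}" using \<open>P D\<close> by blast
    fix \<C> assume ne: "\<C> \<noteq> {}" and ch: "subset.chain (Collect P) \<C>"
    then have PC: "P I" if "I \<in> \<C>" for I using that unfolding subset.chain_def by blast
    have "x + y \<in> \<Union>\<C>" if xy: "x \<in> \<Union>\<C>" "y \<in> \<Union>\<C>" for x y
    proof -
      obtain I J where I: "I \<in> \<C>" "x \<in> I" and J: "J \<in> \<C>" "y \<in> J" using xy by blast
      then have "I \<subseteq> J \<or> J \<subseteq> I" using ch unfolding subset.chain_def by blast
      then consider "x \<in> J" | "y \<in> I" using I J by blast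
      then show ?thesis
        using I J PC unfolding P_def by cases blast+
    qed
    moreover have "r * x \<in> \<Union>\<C>" if "r \<in> oK" "x \<in> \<Union>\<C>" for r x
      using that PC unfolding P_def by blast
    moreover have "D \<subseteq> \<Union>\<C>" "\<Union>\<C> \<subseteq> oK" "1 \<notin> \<Union>\<C>" using ne PC unfolding P_def by blast+
    ultimately show "\<Union>\<C> \<in> Collect P" unfolding P_def by blast
  qed
  then obtain M where M: "P M" and max: "\<And>X. P X \<Longrightarrow> M \<subseteq> X \<Longrightarrow> X = M" by blast
  have "\<exists>r\<in>oK. 1 - q * r \<in> M" if q: "q \<in> oK" "q \<notin> M" for q
  proof -
    define J where "J = {m + q * r | m r. m \<in> M \<and> r \<in> oK}"
    have JI: "m \<in> M \<Longrightarrow> r \<in> oK \<Longrightarrow> m + q * r \<in> J" for m r unfolding J_def by blast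
    have M0: "0 \<in> M" using M D unfolding P_def by blast
    have "M \<subseteq> J" using JI[OF _ oK_0] by auto
    have "q \<in> J" using JI[OF M0 oK_1] by simp
    then have "\<not> P J" using max[OF _ \<open>M \<subseteq> J\<close>] q(2) by blast
    have "x + y \<in> J" if xy: "x \<in> J" "y \<in> J" for x y
    proof -
      obtain m r where 1: "m \<in> M" "r \<in> oK" "x = m + q * r" using xy(1) unfolding J_def by blast
      obtain m' r' where 2: "m' \<in> M" "r' \<in> oK" "y = m' + q * r'" using xy(2) unfolding J_def by blast
      have "(m + m') + q * (r + r') \<in> J" using 1 2 M by (intro JI) (auto simp: P_def)
      then show ?thesis by (simp add: 1 2 algebra_simps)
    qed
    moreover have "c * x \<in> J" if cx: "c \<in> oK" "x \<in> J" for c x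
    proof -
      obtain m r where 1: "m \<in> M" "r \<in> oK" "x = m + q * r" using cx(2) unfolding J_def by blast
      have "c * m + q * (c * r) \<in> J" using 1 cx M by (intro JI) (auto simp: P_def)
      then show ?thesis by (simp add: 1 algebra_simps)
    qed
    moreover have "D \<subseteq> J" using \<open>M \<subseteq> J\<close> M unfolding P_def by blast
    moreover have "J \<subseteq> oK" using M q unfolding P_def J_def by auto
    ultimately have "1 \<in> J" using \<open>\<not> P J\<close> unfolding P_def by blast
    then obtain m r where "m \<in> M" "r \<in> oK" "1 = m + q * r" unfolding J_def by blast
    then have "1 - q * r \<in> M" by (metis add_diff_cancel_right')
    then show ?thesis using \<open>r \<in> oK\<close> by blast
  qed
  then show ?thesis using M unfolding P_def by (intro exI[of _ M]) simp
qed

text \<open>The denominators of \<open>t\<close> form an ideal \<open>D\<close> that contains 2 but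
  not 1. A maximal ideal above \<open>D\<close> is dyadic, and \<open>t\<close> stays outside the
  localization there.\<close>

lemma dyadic_valuation_exists:
  assumes nf: "number_field TYPE('k::field_char_0)" and t: "(t::'k) \<notin> oK" "2 * t \<in> oK"
  obtains V p where "dyadic_valuation V p" "t \<notin> V"
proof -
  define D where "D = {x\<in>oK. x * t \<in> oK}"
  have "D \<subseteq> oK" "0 \<in> D" "1 \<notin> D" using t by (auto simp: D_def)
  moreover have "x \<in> D \<Longrightarrow> y \<in> D \<Longrightarrow> x + y \<in> D" for x y by (auto simp: D_def distrib_right)
  moreover have "r \<in> oK \<Longrightarrow> x \<in> D \<Longrightarrow> r * x \<in> D" for r x by (auto simp: D_def mult.assoc)
  ultimately have "\<exists>M. D \<subseteq> M \<and> M \<subseteq> oK \<and> 1 \<notin> M \<and> (\<forall>x\<in>M. \<forall>y\<in>M. x + y \<in> M) \<and> (\<forall>r\<in>oK. \<forall>x\<in>M. r * x \<in> M)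
    \<and> (\<forall>q\<in>oK. q \<notin> M \<longrightarrow> (\<exists>r\<in>oK. 1 - q * r \<in> M))"
    by (rule maximal_ideal_exists)
  then obtain M where DM: "D \<subseteq> M" and M': "M \<subseteq> oK" "1 \<notin> M" "\<forall>x\<in>M. \<forall>y\<in>M. x + y \<in> M"
      "\<forall>r\<in>oK. \<forall>x\<in>M. r * x \<in> M" "\<forall>q\<in>oK. q \<notin> M \<longrightarrow> (\<exists>r\<in>oK. 1 - q * r \<in> M)"
    by (elim exE conjE)
  have M: "M \<subseteq> oK" "1 \<notin> M" "\<And>x y. x \<in> M \<Longrightarrow> y \<in> M \<Longrightarrow> x + y \<in> M"
    "\<And>r x. r \<in> oK \<Longrightarrow> x \<in> M \<Longrightarrow> r * x \<in> M"
    and Mmax: "\<And>q. q \<in> oK \<Longrightarrow> q \<notin> M \<Longrightarrow> \<exists>r\<in>oK. 1 - q * r \<in> M"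
    using M' by simp_all
  have "0 \<in> D" "2 \<in> D" using t by (simp_all add: D_def)
  then have M0: "0 \<in> M" and "2 \<in> M" using DM by (simp_all only: subsetD)
  have prime: "q * q' \<notin> M" if q: "q \<in> oK" "q \<notin> M" "q' \<in> oK" "q' \<notin> M" for q q'
  proof
    assume "q * q' \<in> M"
    obtain r where r: "r \<in> oK" "1 - q * r \<in> M" using Mmax[OF q(1,2)] by blast
    obtain r' where r': "r' \<in> oK" "1 - q' * r' \<in> M" using Mmax[OF q(3,4)] by blast
    have "(1 - q * r) + ((q * r) * (1 - q' * r') + (r * r') * (q * q')) \<in> M"
      by (rule M(3)[OF r(2) M(3)[OF M(4)[OF oK_mult[OF q(1) r(1)] r'(2)]
        M(4)[OF oK_mult[OF r(1) r'(1)] \<open>q * q' \<in> M\<close>]]])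
    then show False using M(2) by (simp add: algebra_simps)
  qed
  define V where "V = {x. \<exists>q\<in>oK. q \<notin> M \<and> q * x \<in> oK}"
  have VI: "x \<in> V" if "q \<in> oK" "q \<notin> M" "q * x \<in> oK" for q x using that unfolding V_def by blast
  have VE: "\<exists>q. q \<in> oK \<and> q \<notin> M \<and> q * x \<in> oK" if "x \<in> V" for x using that unfolding V_def by blast
  have oV: "x \<in> V" if "x \<in> oK" for x using VI[of 1 x] that M(2) by simp
  have V_add: "x + y \<in> V" and V_mult: "x * y \<in> V" if xy: "x \<in> V" "y \<in> V" for x y
  proof -
    obtain q where q: "q \<in> oK" "q \<notin> M" "q * x \<in> oK" using VE[OF xy(1)] by blast
    obtain q' where q': "q' \<in> oK" "q' \<notin> M" "q' * y \<in> oK" using VE[OF xy(2)] by blast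
    have qq: "q * q' \<in> oK" "q * q' \<notin> M" using q q' prime by auto
    have "q' * (q * x) + q * (q' * y) \<in> oK" using q q' by auto
    then have "(q * q') * (x + y) \<in> oK" by (simp add: algebra_simps)
    then show "x + y \<in> V" by (rule VI[OF qq])
    have "(q * x) * (q' * y) \<in> oK" using q q' by auto
    then have "(q * q') * (x * y) \<in> oK" by (simp add: algebra_simps)
    then show "x * y \<in> V" by (rule VI[OF qq])
  qed
  have V_uminus: "- x \<in> V" if "x \<in> V" for x
    using V_mult[OF oV[OF oK_minus[OF oK_1]] that] by simp
  have V_diff: "x - y \<in> V" if "x \<in> V" "y \<in> V" for x y
    using V_add[OF that(1) V_uminus[OF that(2)]] by simp
  have V_unit: "1 / q \<in> V" "q \<noteq> 0" if q: "q \<in> oK" "q \<notin> M" for q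
  proof -
    show "q \<noteq> 0" using q M0 by blast
    then show "1 / q \<in> V" using VI[OF q, of "1 / q"] by simp
  qed
  have V_power: "x ^ n \<in> V" if "x \<in> V" for x n
    by (induction n) (use that oV V_mult in auto)
  \<comment> \<open>Uses p + q x = 1 from the invertibility of (1, x). As p x is integral, p lies in
    \<open>M\<close> when x is outside \<open>V\<close>; then q x is outside \<open>M\<close> and is
    a denominator of 1 / x.\<close>
  have V_total: "1 / x \<in> V" if x: "x \<notin> V" for x
  proof -
    obtain p q where pq: "p \<in> oK" "q \<in> oK" "p * x \<in> oK" "q * x \<in> oK" "p + q * x = 1"
      using integers_Pruefer[OF number_field_algebraic[OF nf]] by metis
    have "p \<in> M" using VI[of p x] pq x by blast
    then have "q * x \<notin> M" using M(2) M(3)[of p "q * x"] pq(5) by auto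
    moreover have "x \<noteq> 0" using x oV by auto
    ultimately show ?thesis using VI[of "q * x" "1 / x"] pq by simp
  qed
  have two_nonunit: "1 / 2 \<notin> V"
  proof
    assume "1 / 2 \<in> V"
    then obtain q where q: "q \<in> oK" "q \<notin> M" "q * (1 / 2) \<in> oK" using VE by blast
    then have "(q * (1 / 2)) * 2 \<in> M" using M(4)[OF q(3) \<open>2 \<in> M\<close>] by simp
    then show False using q(2) by simp
  qed
  define N where "N = {x \<in> V. x = 0 \<or> 1 / x \<notin> V}"
  have N_mult: "x * y \<in> N" if x: "x \<in> V" and y: "y \<in> N" for x y
  proof -
    have "1 / (x * y) \<notin> V" if "x * y \<noteq> 0"
    proof
      assume "1 / (x * y) \<in> V"
      then have "x * (1 / (x * y)) \<in> V" using x V_mult by blast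
      then show False using that y by (simp add: N_def)
    qed
    then show ?thesis using V_mult x y by (auto simp: N_def)
  qed
  have "2 \<in> N" using oV two_nonunit by (auto simp: N_def)
  obtain F :: "'k set" where F': "finite F" "F \<subseteq> oK"
      "\<And>x. x \<in> oK \<Longrightarrow> \<exists>f\<in>F. \<exists>y\<in>oK. x = f + of_nat 2 * y"
    using finite_quotient_oK[OF nf pos2] by metis
  then have F: "finite F" "F \<subseteq> oK" "\<And>x. x \<in> oK \<Longrightarrow> \<exists>f\<in>F. \<exists>y\<in>oK. x = f + 2 * y"
    by (simp_all only: of_nat_numeral)
  \<comment> \<open>\<open>F\<close> represents \<open>V\<close> modulo 2 as well. Two powers of the
    denominator q agree modulo 2 and q is a unit of \<open>V\<close>, so some q^(l + 1) is 1 modulo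
    2 V. Then q^l inverts q, and the integer (q x) q^l is congruent to x.\<close>
  have FV: "\<exists>f\<in>F. \<exists>y\<in>V. x = f + 2 * y" if x: "x \<in> V" for x
  proof -
    obtain q where q: "q \<in> oK" "q \<notin> M" "q * x \<in> oK" using VE[OF x] by blast
    have "\<exists>m n f. m < n \<and> f \<in> F \<and> (\<exists>y\<in>oK. q ^ m = f + 2 * y) \<and> (\<exists>y\<in>oK. q ^ n = f + 2 * y)"
      by (rule pigeonhole_mod[OF F(1), of "\<lambda>x f. \<exists>y\<in>oK. x = f + 2 * y" "\<lambda>n. q ^ n"])
        (use F(3)[OF oK_power[OF q(1)]] in simp)
    then obtain m n f y z where mn: "m < n" and yz: "y \<in> oK" "z \<in> oK" "q ^ m = f + 2 * y" "q ^ n = f + 2 * z"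
      by blast
    define l where "l = n - m - 1"
    have n: "n = m + Suc l" using mn by (simp add: l_def)
    have "q ^ m * (1 - q ^ Suc l) = q ^ m - q ^ n"
      by (simp only: n power_add right_diff_distrib mult_1_right)
    also have "\<dots> = 2 * (y - z)" by (simp only: yz(3,4) right_diff_distrib) simp
    finally have E1: "q ^ m * (1 - q ^ Suc l) = 2 * (y - z)" .
    have E2: "(1 / q) ^ m * q ^ m = 1"
      using V_unit(2)[OF q(1,2)] by (simp flip: power_mult_distrib)
    have "1 - q ^ Suc l = ((1 / q) ^ m * q ^ m) * (1 - q ^ Suc l)" by (simp only: E2 mult_1)
    also have "\<dots> = (1 / q) ^ m * (q ^ m * (1 - q ^ Suc l))" by (rule mult.assoc)
    also have "\<dots> = 2 * ((y - z) * (1 / q) ^ m)" unfolding E1 by (simp only: mult_ac)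
    finally have E3: "1 - q ^ Suc l = 2 * ((y - z) * (1 / q) ^ m)" .
    define A where "A = x * ((y - z) * (1 / q) ^ m)"
    define C where "C = (q * x) * q ^ l"
    have "x - C = x * (1 - q ^ Suc l)"
      unfolding C_def by (simp only: right_diff_distrib mult_1_right mult_1_left power_Suc mult_ac)
    also have "\<dots> = 2 * A" unfolding E3 A_def by (simp only: mult_ac)
    finally have x_eq: "x = C + 2 * A" by (simp add: diff_eq_eq add.commute)
    have "C \<in> oK" unfolding C_def by (rule oK_mult[OF q(3) oK_power[OF q(1)]])
    from F(3)[OF this] obtain g u where g: "g \<in> F" "u \<in> oK" "C = g + 2 * u" by (elim bexE)
    have "A + u \<in> V"
      unfolding A_def by (intro V_add V_mult V_power V_diff x oV yz g V_unit(1)[OF q(1,2)])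
    moreover have "x = g + 2 * (A + u)"
      unfolding x_eq g(3) by (simp only: distrib_left add.assoc add.commute[of "2 * A"])
    ultimately show ?thesis using g(1) by blast
  qed
  \<comment> \<open>Every nonunit is 0 or a nonunit representative, plus a multiple of 2. So a
    member of \<open>P\<close> that divides all of \<open>P\<close> divides all nonunits and is a
    uniformizer.\<close>
  define P where "P = insert 2 {f\<in>F. f \<in> N \<and> f \<noteq> 0}"
  have "\<exists>p\<in>Q. \<forall>x\<in>Q. x / p \<in> V" if "finite Q" "Q \<noteq> {}" "0 \<notin> Q" for Q
    using that
  proof (induction Q rule: finite_ne_induct)
    case (singleton x)
    then show ?case using oV[OF oK_1] by simp
  next
    case (insert y Q)
    then obtain c where c: "c \<in> Q" "\<forall>x\<in>Q. x / c \<in> V" by auto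
    then have "c \<noteq> 0" using insert by auto
    show ?case
    proof (cases "y / c \<in> V")
      case True
      then show ?thesis using c by blast
    next
      case False
      then have cy: "c / y \<in> V" using V_total[of "y / c"] by simp
      have "x / y \<in> V" if "x \<in> Q" for x
        using V_mult[OF _ cy, of "x / c"] c that \<open>c \<noteq> 0\<close> by simp
      moreover have "y / y \<in> V" using oV insert by auto
      ultimately show ?thesis by blast
    qed
  qed
  moreover have "finite P" "P \<noteq> {}" "0 \<notin> P" using F(1) by (auto simp: P_def)
  ultimately have "\<exists>p\<in>P. \<forall>x\<in>P. x / p \<in> V" by blast
  then obtain p where p: "p \<in> P" and pP: "\<And>x. x \<in> P \<Longrightarrow> x / p \<in> V" by blast
  have pN: "p \<in> N" "p \<noteq> 0" using p \<open>2 \<in> N\<close> by (auto simp: P_def)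
  have two_p: "2 / p \<in> V" using pP by (simp add: P_def)
  have p_div: "x / p \<in> V" if x: "x \<in> N" for x
  proof -
    obtain f y where f: "f \<in> F" "y \<in> V" "x = f + 2 * y" using FV x unfolding N_def by blast
    have py: "p * ((2 / p) * y) = 2 * y" using pN by simp
    have "f / p \<in> V"
    proof (cases "f = 0")
      case True
      then show ?thesis using oV by simp
    next
      case False
      \<comment> \<open>Whichever of \<open>x\<close> and 2 divides the other, \<open>f\<close> is a
        multiple of a nonunit.\<close>
      have "f \<in> N"
      proof (rule ccontr)
        assume "f \<notin> N"
        then have f': "1 / f \<in> V" "f \<in> V" using F(2) f(1) oV by (auto simp: N_def)
        show False
        proof (cases "x = 0")
          case True
          then have "f = 2 * (- y)" using f(3) by (simp add: eq_neg_iff_add_eq_0)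
          then have "f \<in> N" using N_mult[OF V_uminus[OF f(2)] \<open>2 \<in> N\<close>] by (simp add: mult.commute)
          then show False using \<open>f \<notin> N\<close> by simp
        next
          case xn0: False
          show False
          proof (cases "x / 2 \<in> V")
            case True
            have "2 * (x / 2 - y) = x - 2 * y" by (simp add: right_diff_distrib)
            then have "f = 2 * (x / 2 - y)" using f(3) by (metis add_diff_cancel_right')
            moreover have "(x / 2 - y) * 2 \<in> N" using N_mult[OF V_diff[OF True f(2)] \<open>2 \<in> N\<close>] .
            ultimately show False using \<open>f \<notin> N\<close> by (simp add: mult.commute)
          next
            case no: False
            then have "2 / x \<in> V" using V_total[of "x / 2"] by simp
            then have "1 - (2 / x) * y \<in> V" using oV f(2) by (intro V_diff V_mult) auto
            then have "(1 - (2 / x) * y) * x \<in> N" using N_mult x by blast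
            moreover have "(1 - (2 / x) * y) * x = f" using xn0 f(3) by (simp add: field_simps)
            ultimately show False using \<open>f \<notin> N\<close> by simp
          qed
        qed
      qed
      then show ?thesis using pP f(1) False by (simp add: P_def)
    qed
    then have "f / p + (2 / p) * y \<in> V" using two_p f(2) by (intro V_add V_mult)
    then show ?thesis by (simp add: f(3) add_divide_distrib)
  qed
  have p_nonunit: "1 / p \<notin> V" using pN by (auto simp: N_def)
  \<comment> \<open>Injectivity of the iterated Frobenius modulo p: since p divides 2, z z agrees
    modulo p with the difference of the squares.\<close>
  have root: "(u - v) / p \<in> V" if uv: "u \<in> V" "v \<in> V" "(u ^ (2 ^ n) - v ^ (2 ^ n)) / p \<in> V" for u v n
    using uv(3)
  proof (induction n)
    case (Suc n)
    define z where "z = u ^ (2 ^ n) - v ^ (2 ^ n)"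
    have zV: "z \<in> V" unfolding z_def using uv by (intro V_diff V_power)
    define U W where "U = u ^ (2 ^ n)" and "W = v ^ (2 ^ n)"
    have "u ^ (2 ^ Suc n) = U * U" "v ^ (2 ^ Suc n) = W * W"
      unfolding U_def W_def by (simp_all only: power_Suc mult_2 power_add)
    moreover have "z * z = (U * U - W * W) - 2 * (W * z)"
      unfolding z_def U_def[symmetric] W_def[symmetric] by (simp add: algebra_simps)
    ultimately have "z * z = (u ^ (2 ^ Suc n) - v ^ (2 ^ Suc n)) - 2 * (v ^ (2 ^ n) * z)"
      by (simp only: W_def)
    then have "z * z / p = (u ^ (2 ^ Suc n) - v ^ (2 ^ Suc n)) / p - (2 / p) * (v ^ (2 ^ n) * z)"
      by (simp add: diff_divide_distrib)
    then have zz: "z * z / p \<in> V"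
      using Suc.prems two_p uv zV by (simp only: V_diff V_mult V_power)
    have "z \<in> N"
    proof (rule ccontr)
      assume "z \<notin> N"
      then have "z \<noteq> 0" "1 / z \<in> V" using zV by (auto simp: N_def)
      then have "(z * z / p) * ((1 / z) * (1 / z)) \<in> V" using zz V_mult by blast
      then show False using p_nonunit \<open>z \<noteq> 0\<close> by simp
    qed
    then show ?case using p_div Suc.IH unfolding z_def by blast
  qed simp
  \<comment> \<open>The iterated squares of x collide modulo 2, at exponents 2^m and 2^n. Cancelling
    m squarings modulo p exhibits x as the square of x^(2^l) with l = n - m - 1.\<close>
  have square: "\<exists>y\<in>V. (x - y ^ 2) / p \<in> V" if x: "x \<in> V" for x
  proof -
    have "\<exists>m n f. m < n \<and> f \<in> F \<and> (\<exists>y\<in>V. x ^ (2 ^ m) = f + 2 * y) \<and> (\<exists>y\<in>V. x ^ (2 ^ n) = f + 2 * y)"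
      by (rule pigeonhole_mod[OF F(1), of "\<lambda>x f. \<exists>y\<in>V. x = f + 2 * y" "\<lambda>n. x ^ (2 ^ n)"])
        (rule FV[OF V_power[OF x]])
    then obtain m n f y z where mn: "m < n" and yz: "y \<in> V" "z \<in> V" "x ^ (2 ^ m) = f + 2 * y" "x ^ (2 ^ n) = f + 2 * z"
      by blast
    define l where "l = n - m - 1"
    have n: "n = Suc l + m" using mn by (simp add: l_def)
    let ?y = "x ^ (2 ^ l)"
    have "(?y ^ 2) ^ (2 ^ m) = x ^ (2 ^ n)"
      by (simp add: n power_mult[symmetric] power_add mult_ac)
    then have "(x ^ (2 ^ m) - (?y ^ 2) ^ (2 ^ m)) / p = (2 / p) * (y - z)"
      using yz by (simp add: algebra_simps diff_divide_distrib)
    then have "(x ^ (2 ^ m) - (?y ^ 2) ^ (2 ^ m)) / p \<in> V"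
      using two_p yz by (simp only: V_mult V_diff)
    then have "(x - ?y ^ 2) / p \<in> V" using x by (intro root[of x "?y ^ 2" m] V_power)
    then show ?thesis using V_power[OF x] by blast
  qed
  have denominators: "\<exists>q\<in>oK. q \<noteq> 0 \<and> 1 / q \<in> V \<and> (\<forall>x\<in>X. q * x \<in> oK)" if "finite X" "X \<subseteq> V" for X
  proof -
    have "\<exists>q\<in>oK. q \<notin> M \<and> (\<forall>x\<in>X. q * x \<in> oK)"
      using that
    proof (induction X)
      case empty
      then show ?case using M(2) by (intro bexI[of _ 1]) auto
    next
      case (insert x X)
      then obtain q where q: "q \<in> oK" "q \<notin> M" "\<forall>x\<in>X. q * x \<in> oK" by auto
      obtain r where r: "r \<in> oK" "r \<notin> M" "r * x \<in> oK" using VE[of x] insert.prems by auto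
      have "q * r \<in> oK" "q * r \<notin> M" using q r prime by auto
      moreover have "q * r * y \<in> oK" if "y \<in> insert x X" for y
      proof (cases "y = x")
        case True
        then show ?thesis using oK_mult[OF q(1) r(3)] by (simp add: mult.assoc)
      next
        case False
        then have "q * y \<in> oK" using q(3) that by blast
        from oK_mult[OF r(1) this] show ?thesis by (simp add: mult_ac)
      qed
      ultimately show ?case by blast
    qed
    then show ?thesis using V_unit by blast
  qed
  have "t \<notin> V"
  proof
    assume "t \<in> V"
    then obtain q where "q \<in> oK" "q \<notin> M" "q * t \<in> oK" using VE by blast
    then show False using DM by (auto simp: D_def)
  qed
  moreover have "dyadic_valuation V p"
  proof unfold_locales
    show "is_subring V" unfolding is_subring_def using oV V_add V_mult V_uminus by simp
    show "oK \<subseteq> V" using oV by blast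
    show "p \<in> V" "p \<noteq> 0" "1 / p \<notin> V" using pN p_nonunit by (auto simp: N_def)
    show "x / p \<in> V" if "x \<in> V" "x = 0 \<or> 1 / x \<notin> V" for x
      using p_div that by (simp add: N_def)
    show "1 / x \<in> V" if "x \<notin> V" for x using V_total[OF that] .
    show "2 / p \<in> V" by (rule two_p)
    show "\<exists>y\<in>V. (x - y ^ 2) / p \<in> V" if "x \<in> V" for x using square[OF that] .
    show "\<exists>q\<in>oK. q \<noteq> 0 \<and> 1 / q \<in> V \<and> (\<forall>x\<in>X. q * x \<in> oK)" if "finite X" "X \<subseteq> V" for X
      using denominators[OF that] .
  qed
  ultimately show thesis by (intro that)
qed

section \<open>Maximal orders at a dyadic place\<close>

text \<open>\<open>L\<close> is a localized maximal order whose fixed part \<open>\<langle>1, u, v\<rangle>\<close> does not generate \<open>L\<close>, hence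
  is commutative modulo \<open>p\<close>. It turns out that \<open>L\<close> consists of all integral quaternions.\<close>

locale dyadic_special = involution_quaternion scaleK s i j a b + dyadic_valuation V p
  for scaleK :: "'k::field_char_0 \<Rightarrow> 'h::ring_1 \<Rightarrow> 'h" and s :: "'h \<Rightarrow> 'h" and i j :: 'h and a b :: 'k
    and V :: "'k set" and p :: 'k +
  fixes L :: "'h set" and u v :: 'h
  assumes L_sub: "rsub V L" and L_one: "1 \<in> L" and L_mult: "x \<in> L \<Longrightarrow> y \<in> L \<Longrightarrow> x * y \<in> L"
    and L_trd: "x \<in> L \<Longrightarrow> trd x \<in> V"
    and u_in: "u \<in> L" "c3 u = 0" "c2 u = 0" "c1 u \<noteq> 0" and v_in: "v \<in> L" "c3 v = 0" "c2 v \<noteq> 0"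
    and L_basis: "x \<in> L \<Longrightarrow> c3 x = 0 \<Longrightarrow>
      \<exists>\<alpha> \<beta> \<gamma>. \<alpha> \<in> V \<and> \<beta> \<in> V \<and> \<gamma> \<in> V \<and> x = scaleK \<alpha> 1 + scaleK \<beta> u + scaleK \<gamma> v"
    and L_indep: "scaleK \<alpha> 1 + scaleK \<beta> u + scaleK \<gamma> v \<in> L \<Longrightarrow> \<alpha> \<in> V \<and> \<beta> \<in> V \<and> \<gamma> \<in> V"
    and L_closed: "\<exists>r\<in>L. c3 r = 0 \<and> scaleK (1 / p) (u * v - r) \<in> L"
    and L_commute: "scaleK (1 / p) (u * v - v * u) \<in> L"
    and L_absorbs: "c3 z = 0 \<Longrightarrow> nrd z \<in> V \<Longrightarrow> (\<And>x. x \<in> L \<Longrightarrow> trd (z * x) \<in> V) \<Longrightarrow> z \<in> L"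
    and trd_u: "trd u \<in> pideal 1" and trd_v: "trd v \<in> pideal 1" and trd_uv: "trd (u * v) \<in> pideal 1"
    and nrd_u: "nrd u \<in> pideal 1" and nrd_v: "nrd v \<in> pideal 1"
begin

lemmas L_0 = rsub_0[OF V_subring L_sub] and L_add = rsub_add[OF V_subring L_sub]
  and L_scale = rsub_scale[OF V_subring L_sub] and L_uminus = rsub_uminus[OF V_subring L_sub]
  and L_diff = rsub_diff[OF V_subring L_sub]

text \<open>Membership in p L. By \<open>L_indep\<close> the images of 1, u, v in L / p L are
  independent over the residue field, and the arguments below compare coefficients there.\<close>

definition P :: "'h \<Rightarrow> bool" where "P x \<longleftrightarrow> scaleK (1 / p) x \<in> L"

lemma P_add: "P x \<Longrightarrow> P y \<Longrightarrow> P (x + y)" and P_diff: "P x \<Longrightarrow> P y \<Longrightarrow> P (x - y)"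
  and P_uminus: "P x \<Longrightarrow> P (- x)"
  using L_add[of "scaleK (1 / p) x" "scaleK (1 / p) y"] L_diff[of "scaleK (1 / p) x" "scaleK (1 / p) y"]
    L_uminus[of "scaleK (1 / p) x"]
  by (simp_all add: P_def scale_right_distrib scale_right_diff_distrib)

lemma P_left: "y \<in> L \<Longrightarrow> P x \<Longrightarrow> P (y * x)" and P_right: "P x \<Longrightarrow> y \<in> L \<Longrightarrow> P (x * y)"
  using L_mult[of y "scaleK (1 / p) x"] L_mult[of "scaleK (1 / p) x" y]
  by (simp_all add: P_def scale_mult_left scale_mult_right)

lemma P_scale: "c \<in> V \<Longrightarrow> P x \<Longrightarrow> P (scaleK c x)"
  using L_scale[of c "scaleK (1 / p) x"] by (simp add: P_def)

lemma P_pideal: "c \<in> pideal 1 \<Longrightarrow> x \<in> L \<Longrightarrow> P (scaleK c x)"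
  using L_scale[of "c / p" x] unfolding P_def pideal_1 by simp

lemma P_basis:
  assumes "P (scaleK \<alpha> 1 + scaleK \<beta> u + scaleK \<gamma> v)"
  shows "\<alpha> \<in> pideal 1 \<and> \<beta> \<in> pideal 1 \<and> \<gamma> \<in> pideal 1"
proof -
  have "scaleK (\<alpha> / p) 1 + scaleK (\<beta> / p) u + scaleK (\<gamma> / p) v \<in> L"
    using assms by (simp add: P_def scale_right_distrib)
  from L_indep[OF this] show ?thesis unfolding pideal_1 .
qed

lemma P_uu: "P (u * u)" and P_vv: "P (v * v)"
  unfolding square_eq[of u] square_eq[of v]
  by (intro P_diff P_pideal trd_u trd_v nrd_u nrd_v u_in v_in L_one)+

text \<open>Modulo p L the product u v is a combination r of 1, u, v, while u u and v v vanish. So u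
  r and r v vanish too. Expanding them, with u v replaced by r again, shows first that \<gamma> *
  \<gamma> and \<beta> * \<beta> are nonunits and then that all coefficients of r are.\<close>

lemma P_uv: "P (u * v)"
proof -
  obtain r where r: "r \<in> L" "c3 r = 0" "P (u * v - r)" using L_closed unfolding P_def by blast
  obtain \<alpha> \<beta> \<gamma> where V: "\<alpha> \<in> V" "\<beta> \<in> V" "\<gamma> \<in> V" and r_eq: "r = scaleK \<alpha> 1 + scaleK \<beta> u + scaleK \<gamma> v"
    using L_basis[OF r(1,2)] by (elim exE conjE)
  have "P ((u * u) * v - u * (u * v - r) - scaleK \<beta> (u * u) - scaleK \<gamma> (u * v - r))"
    by (intro P_diff P_left P_right P_scale P_uu r(3) u_in v_in V)
  also have "(u * u) * v - u * (u * v - r) - scaleK \<beta> (u * u) - scaleK \<gamma> (u * v - r)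
      = scaleK (\<gamma> * \<alpha>) 1 + scaleK (\<alpha> + \<gamma> * \<beta>) u + scaleK (\<gamma> * \<gamma>) v"
    unfolding r_eq by (rule coords_eqI; simp add: coords algebra_simps)
  finally have "\<gamma> * \<gamma> \<in> pideal 1" "\<alpha> + \<gamma> * \<beta> \<in> pideal 1" using P_basis by blast+
  then have \<gamma>: "\<gamma> \<in> pideal 1" using pideal_square V by blast
  have "P ((u * v) * v - (u * v - r) * v - scaleK \<beta> (u * v - r) - scaleK \<gamma> (v * v))"
  proof -
    have "P (u * (v * v))" by (intro P_left P_vv u_in)
    then have "P ((u * v) * v)" by (simp only: mult.assoc)
    then show ?thesis
      by (rule P_diff[OF P_diff[OF P_diff[OF _ P_right[OF r(3) v_in(1)]] P_scale[OF V(2) r(3)]] P_scale[OF V(3) P_vv]])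
  qed
  also have "(u * v) * v - (u * v - r) * v - scaleK \<beta> (u * v - r) - scaleK \<gamma> (v * v)
      = scaleK (\<beta> * \<alpha>) 1 + scaleK (\<beta> * \<beta>) u + scaleK (\<alpha> + \<beta> * \<gamma>) v"
    unfolding r_eq by (rule coords_eqI; simp add: coords algebra_simps)
  finally have "\<beta> * \<beta> \<in> pideal 1" "\<alpha> + \<beta> * \<gamma> \<in> pideal 1" using P_basis by blast+
  then have \<beta>: "\<beta> \<in> pideal 1" using pideal_square V by blast
  have "\<alpha> + \<beta> * \<gamma> - \<beta> * \<gamma> \<in> pideal 1"
    using \<open>\<alpha> + \<beta> * \<gamma> \<in> pideal 1\<close> pideal_V[OF V(2) \<gamma>] by (rule pideal_diff)
  then have \<alpha>: "\<alpha> \<in> pideal 1" by simp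
  have "P r" unfolding r_eq by (intro P_add P_pideal \<alpha> \<beta> \<gamma> L_one u_in v_in)
  from P_add[OF r(3) this] show ?thesis by simp
qed

text \<open>Let y' be the conjugate of y. Carrying y through the product turns y u v - u v y into
  trd (y u) v + trd (y' v) u, up to terms with a factor trd u or trd v. By \<open>P_uv\<close>
  everything else lies in p L, so both coefficients are nonunits.\<close>

lemma trd_mult_L:
  assumes y: "y \<in> L" shows "trd (y * u) \<in> pideal 1" "trd (y * v) \<in> pideal 1"
proof -
  have *: "trd (y * u) \<in> pideal 1 \<and> trd ((scaleK (trd y) 1 - y) * v) \<in> pideal 1" if y: "y \<in> L" for y
  proof -
    have y': "scaleK (trd y) 1 - y \<in> L" by (intro L_diff L_scale L_trd y L_one)
    have "P (y * (u * v) - (u * v) * y + scaleK (trd u) ((scaleK (trd y) 1 - y) * v) + scaleK (trd v) (u * y))"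
      by (intro P_add P_diff P_left P_right P_pideal L_mult P_uv trd_u trd_v y y' u_in v_in)
    also have "y * (u * v) - (u * v) * y + scaleK (trd u) ((scaleK (trd y) 1 - y) * v) + scaleK (trd v) (u * y)
      = scaleK 0 1 + scaleK (trd ((scaleK (trd y) 1 - y) * v)) u + scaleK (trd (y * u)) v"
      by (rule coords_eqI; simp add: trd_def coords algebra_simps)
    finally show ?thesis using P_basis by blast
  qed
  then show "trd (y * u) \<in> pideal 1" using y by blast
  define y' where "y' = scaleK (trd y) 1 - y"
  have "y' \<in> L" unfolding y'_def by (intro L_diff L_scale L_trd y L_one)
  then have "trd ((scaleK (trd y') 1 - y') * v) \<in> pideal 1" using * by blast
  moreover have "scaleK (trd y') 1 - y' = y"
    unfolding y'_def by (rule coords_eqI; simp add: trd_def coords)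
  ultimately show "trd (y * v) \<in> pideal 1" by simp
qed

lemma trd_mult_uv:
  assumes "y \<in> L" "\<beta> \<in> V" "\<gamma> \<in> V"
  shows "trd ((scaleK \<beta> u + scaleK \<gamma> v) * y) \<in> pideal 1"
proof -
  have "\<beta> * trd (y * u) + \<gamma> * trd (y * v) \<in> pideal 1"
    by (intro pideal_add pideal_V trd_mult_L assms)
  then show ?thesis
    by (simp add: trd_commute[of _ y] distrib_left scale_mult_right trd_add trd_scale)
qed

text \<open>If p^2 divides the norm, then (\<beta> u + \<gamma> v) / p has integral norm and
  integral trace pairing with \<open>L\<close>, and maximality puts it into \<open>L\<close>. In
  other words, the norm divided by p is anisotropic on the residue plane of u and v.\<close>

lemma nrd_anisotropic:
  assumes V: "\<beta> \<in> V" "\<gamma> \<in> V" and n: "nrd (scaleK \<beta> u + scaleK \<gamma> v) \<in> pideal 2"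
  shows "\<beta> \<in> pideal 1 \<and> \<gamma> \<in> pideal 1"
proof -
  define z where "z = scaleK (1 / p) (scaleK \<beta> u + scaleK \<gamma> v)"
  have "z \<in> L"
  proof (rule L_absorbs)
    show "c3 z = 0" by (simp add: z_def coords u_in v_in)
    show "nrd z \<in> V"
      using n unfolding z_def nrd_scale by (simp add: pideal_def power_divide)
    fix x assume "x \<in> L"
    from trd_mult_uv[OF this V] show "trd (z * x) \<in> V"
      unfolding z_def scale_mult_left trd_scale pideal_1 by simp
  qed
  then have "P (scaleK 0 1 + scaleK \<beta> u + scaleK \<gamma> v)" by (simp add: P_def z_def)
  from P_basis[OF this] show ?thesis by blast
qed

lemma V_product_pideal2: "x \<in> pideal 1 \<Longrightarrow> y \<in> pideal 1 \<Longrightarrow> x * y \<in> pideal 2"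
  using pideal_mult[of x 1 y 1] by (simp add: numeral_2_eq_2)

lemma nrd_uv: "nrd u \<notin> pideal 2" "nrd v \<notin> pideal 2"
  using nrd_anisotropic[of 1 0] nrd_anisotropic[of 0 1] one_notin_pideal by auto

text \<open>When every residue is a square, a diagonal binary form in residue characteristic 2 has a
  nontrivial zero. An anisotropic form needs its cross term, which modulo p^2 is - trd (u
  v).\<close>

lemma trd_uv_unit: "trd (u * v) \<notin> pideal 2"
proof
  assume t: "trd (u * v) \<in> pideal 2"
  define n1 n2 where "n1 = nrd u / p" and "n2 = nrd v / p"
  have n: "nrd u = p * n1" "nrd v = p * n2" using p_nonzero by (simp_all add: n1_def n2_def)
  have nV: "n1 \<in> V" "n2 \<in> V" using nrd_u nrd_v unfolding pideal_1 n1_def n2_def .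
  have "n1 \<notin> pideal 1"
  proof
    assume "n1 \<in> pideal 1"
    then have "nrd u \<in> pideal 2"
      using p_nonzero unfolding n pideal_1 by (simp add: pideal_def power2_eq_square)
    then show False using nrd_uv by blast
  qed
  then have n1: "n1 \<noteq> 0" "1 / n1 \<in> V" using unit_or_pideal nV by blast+
  \<comment> \<open>A square root \<alpha> of - n2 / n1 in the residue field makes the norm of
    \<alpha> u + v divisible by p^2.\<close>
  have "- (n2 * (1 / n1)) \<in> V" by (intro V_uminus V_mult nV n1)
  then obtain \<alpha> where \<alpha>: "\<alpha> \<in> V" "(- (n2 * (1 / n1)) - \<alpha> ^ 2) / p \<in> V"
    using square_residue by blast
  have "- n1 * (- (n2 * (1 / n1)) - \<alpha> ^ 2) \<in> pideal 1"
    by (intro pideal_V V_uminus nV) (use \<alpha> in \<open>simp only: pideal_1\<close>)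
  also have "- n1 * (- (n2 * (1 / n1)) - \<alpha> ^ 2) = \<alpha> ^ 2 * n1 + n2"
    using n1 by (simp add: field_simps)
  finally have "p * (\<alpha> ^ 2 * n1 + n2) \<in> pideal 2"
    using p_nonzero unfolding pideal_1 by (simp add: pideal_def power2_eq_square)
  moreover have "\<alpha> * (trd u * trd v) \<in> pideal 2" "\<alpha> * trd (u * v) \<in> pideal 2"
    by (intro pideal_V V_product_pideal2 trd_u trd_v t \<alpha>)+
  ultimately have "p * (\<alpha> ^ 2 * n1 + n2) + \<alpha> * (trd u * trd v) - \<alpha> * trd (u * v) \<in> pideal 2"
    by (intro pideal_add pideal_diff)
  also have "p * (\<alpha> ^ 2 * n1 + n2) + \<alpha> * (trd u * trd v) - \<alpha> * trd (u * v) = nrd (scaleK \<alpha> u + scaleK 1 v)"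
    unfolding nrd_add nrd_scale trd_scale scale_mult_left n scale_one by (simp add: algebra_simps)
  finally have "1 \<in> pideal 1" using nrd_anisotropic[OF \<alpha>(1) V_1] by blast
  then show False using one_notin_pideal by blast
qed

text \<open>The missing fourth basis vector. Its trace is a unit, whereas all of V + V u + V v has
  nonunit traces; so \<open>y\<close> is not fixed, and the trace isolates its coefficient modulo
  p.\<close>

definition y where "y = scaleK (1 / p) (u * v)"

lemma y_in: "y \<in> L" using P_uv by (simp add: P_def y_def)

lemma trd_y: "trd y \<in> V" "trd y \<notin> pideal 1"
proof -
  show "trd y \<in> V" by (intro L_trd y_in)
  show "trd y \<notin> pideal 1"
    using trd_uv_unit unfolding y_def trd_scale pideal_1 by (simp add: pideal_def power2_eq_square)
qed

lemma nrd_y: "nrd y \<in> V"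
proof -
  have "nrd y = (nrd u / p) * (nrd v / p)" by (simp add: y_def nrd_scale nrd_mult power2_eq_square)
  then show ?thesis using V_mult[OF nrd_u[unfolded pideal_1] nrd_v[unfolded pideal_1]] by (simp only:)
qed

lemma c3_y: "c3 y \<noteq> 0"
proof
  assume "c3 y = 0"
  then obtain \<alpha> \<beta> \<gamma> where V: "\<alpha> \<in> V" "\<beta> \<in> V" "\<gamma> \<in> V" and y: "y = scaleK \<alpha> 1 + scaleK \<beta> u + scaleK \<gamma> v"
    using L_basis[OF y_in \<open>c3 y = 0\<close>] by (elim exE conjE)
  have "\<alpha> * 2 + \<beta> * trd u + \<gamma> * trd v \<in> pideal 1"
    by (intro pideal_add pideal_V V trd_u trd_v two_pideal)
  then have "trd y \<in> pideal 1" by (simp add: y trd_add trd_scale trd_one)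
  then show False using trd_y by blast
qed

lemma span_1_u_v_y: "\<exists>\<alpha> \<beta> \<gamma> \<eta>. x = scaleK \<alpha> 1 + scaleK \<beta> u + scaleK \<gamma> v + scaleK \<eta> y"
proof -
  define \<eta> where "\<eta> = c3 x / c3 y"
  define x1 where "x1 = x - scaleK \<eta> y"
  define \<gamma> where "\<gamma> = c2 x1 / c2 v"
  define x2 where "x2 = x1 - scaleK \<gamma> v"
  define \<beta> where "\<beta> = c1 x2 / c1 u"
  define x3 where "x3 = x2 - scaleK \<beta> u"
  have 1: "c3 x1 = 0" using c3_y by (simp add: x1_def \<eta>_def coords)
  have 2: "c3 x2 = 0" "c2 x2 = 0" using v_in 1 by (simp_all add: x2_def \<gamma>_def coords)
  have 3: "c3 x3 = 0" "c2 x3 = 0" "c1 x3 = 0" using u_in 2 by (simp_all add: x3_def \<beta>_def coords)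
  have x3: "scaleK (c0 x3) 1 = x3" by (rule coords_eqI; simp add: coords 3)
  have "x = scaleK (c0 x3) 1 + scaleK \<beta> u + scaleK \<gamma> v + scaleK \<eta> y"
    unfolding x3 by (simp add: x1_def x2_def x3_def)
  then show ?thesis by blast
qed

text \<open>The coefficients are peeled off in turn. The trace modulo p yields \<eta>, since only y
  has unit trace; the norm modulo p then yields \<alpha>; what is left of the norm modulo p^2 is
  that of \<beta> u + \<gamma> v, which is anisotropic.\<close>

lemma primitive_integral:
  assumes V: "\<alpha> \<in> V" "\<beta> \<in> V" "\<gamma> \<in> V" "\<eta> \<in> V"
    and x: "x = scaleK \<alpha> 1 + scaleK \<beta> u + scaleK \<gamma> v + scaleK \<eta> y"
    and t: "trd x \<in> pideal 1" and n: "nrd x \<in> pideal 2"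
  shows "\<alpha> \<in> pideal 1 \<and> \<beta> \<in> pideal 1 \<and> \<gamma> \<in> pideal 1 \<and> \<eta> \<in> pideal 1"
proof -
  define m where "m = scaleK \<beta> u + scaleK \<gamma> v"
  have tm: "trd m \<in> pideal 1"
    using trd_mult_uv[OF L_one V(2,3)] by (simp add: m_def)
  have tmy: "trd (m * y) \<in> pideal 1" unfolding m_def by (rule trd_mult_uv[OF y_in V(2,3)])
  have nm: "nrd m \<in> pideal 1"
  proof -
    have "trd (u * v) \<in> pideal 1" by (rule trd_uv)
    then have "\<beta> ^ 2 * nrd u + \<gamma> ^ 2 * nrd v + (\<beta> * trd u) * (\<gamma> * trd v) - \<beta> * (\<gamma> * trd (u * v)) \<in> pideal 1"
      using V by (intro pideal_add pideal_diff pideal_V nrd_u nrd_v trd_uv trd_v V_mult)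
        (auto simp: power2_eq_square intro: V_mult pideal_sub_V[OF trd_u])
    then show ?thesis
      by (simp add: m_def nrd_add nrd_scale trd_scale scale_mult_left scale_mult_right mult_ac)
  qed
  have trd_x: "trd x = \<alpha> * 2 + trd m + \<eta> * trd y"
    unfolding x m_def by (simp add: trd_add trd_scale trd_one)
  have "trd x - (\<alpha> * 2 + trd m) \<in> pideal 1"
    by (intro pideal_diff pideal_add pideal_V V tm t two_pideal)
  then have "trd y * \<eta> \<in> pideal 1" by (simp add: trd_x mult.commute)
  then have \<eta>: "\<eta> \<in> pideal 1" by (rule pideal_cancel_unit[OF trd_y])
  have nrd_x: "nrd x = \<alpha> * \<alpha> + nrd m + \<eta> * \<eta> * nrd y + \<alpha> * trd m + \<alpha> * (\<eta> * trd y)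
      + trd m * (\<eta> * trd y) - \<eta> * trd (m * y)"
  proof -
    have "x = (scaleK \<alpha> 1 + m) + scaleK \<eta> y" by (simp add: x m_def add.assoc)
    then show ?thesis
      by (simp add: nrd_add nrd_scale trd_add trd_scale trd_one scale_mult_left scale_mult_right distrib_right
          power2_eq_square algebra_simps)
  qed
  have e1: "\<eta> * \<eta> * nrd y \<in> pideal 2"
    using pideal_V[OF nrd_y V_product_pideal2[OF \<eta> \<eta>]] by (simp add: mult.commute)
  have e2: "trd m * (\<eta> * trd y) \<in> pideal 2"
    using V_product_pideal2[OF tm pideal_V[OF trd_y(1) \<eta>]] by (simp add: mult.commute)
  have e3: "\<eta> * trd (m * y) \<in> pideal 2" by (rule V_product_pideal2[OF \<eta> tmy])
  have le: "z \<in> pideal 2 \<Longrightarrow> z \<in> pideal 1" for z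
    using pideal_Suc[of z 1] by (simp add: numeral_2_eq_2)
  have ety: "\<eta> * trd y \<in> pideal 1" using pideal_V[OF trd_y(1) \<eta>] by (simp add: mult.commute)
  have "nrd x - nrd m - \<eta> * \<eta> * nrd y - \<alpha> * trd m - \<alpha> * (\<eta> * trd y) - trd m * (\<eta> * trd y) + \<eta> * trd (m * y) \<in> pideal 1"
    by (intro pideal_add pideal_diff le[OF n] nm le[OF e1] le[OF e2] le[OF e3] pideal_V[OF V(1)] tm ety)
  then have "\<alpha> * \<alpha> \<in> pideal 1" by (simp add: nrd_x)
  then have \<alpha>: "\<alpha> \<in> pideal 1" by (rule pideal_square[OF V(1)])
  have "nrd x - \<alpha> * \<alpha> - \<eta> * \<eta> * nrd y - \<alpha> * trd m - \<alpha> * (\<eta> * trd y) - trd m * (\<eta> * trd y) + \<eta> * trd (m * y) \<in> pideal 2"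
    by (intro pideal_add pideal_diff n e1 e2 e3 V_product_pideal2 \<alpha> tm ety)
  then have "nrd m \<in> pideal 2" by (simp add: nrd_x)
  then show ?thesis using nrd_anisotropic[OF V(2,3)] \<alpha> \<eta> unfolding m_def by blast
qed

text \<open>Divide \<open>x\<close> by a coefficient c of least valuation. If c were outside
  \<open>V\<close>, the quotient would have trace in p V and norm in p^2 V, so all its coefficients
  would be nonunits, although one of them is 1.\<close>

theorem integral_in_L:
  assumes "trd x \<in> V" "nrd x \<in> V" shows "x \<in> L"
proof -
  obtain \<alpha> \<beta> \<gamma> \<eta> where x: "x = scaleK \<alpha> 1 + scaleK \<beta> u + scaleK \<gamma> v + scaleK \<eta> y"
    using span_1_u_v_y by blast
  define X where "X = {\<alpha>, \<beta>, \<gamma>, \<eta>}"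
  have "X \<subseteq> V"
  proof (rule ccontr)
    assume neg: "\<not> X \<subseteq> V"
    have "\<exists>c\<in>X. c \<noteq> 0"
    proof (rule ccontr)
      assume "\<not> ?thesis"
      then have "X \<subseteq> {0}" by auto
      then have "X \<subseteq> V" using V_0 by auto
      then show False using neg by simp
    qed
    moreover have "finite X" by (simp add: X_def)
    ultimately have "\<exists>c\<in>X. c \<noteq> 0 \<and> (\<forall>z\<in>X. z / c \<in> V)" by (intro max_coefficient)
    then obtain c where c: "c \<in> X" "c \<noteq> 0" "\<forall>z\<in>X. z / c \<in> V" by (elim bexE conjE)
    have "c \<notin> V"
    proof
      assume "c \<in> V"
      then have "z \<in> V" if "z \<in> X" for z using V_mult[of c "z / c"] c that by simp
      then show False using neg by blast
    qed
    then have c': "1 / c \<in> V" "1 / c \<in> pideal 1"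
      using V_total[of c] p_divides[of "1 / c"] unfolding pideal_1 by simp_all
    define x0 where "x0 = scaleK (1 / c) x"
    have "trd x0 \<in> pideal 1"
      using pideal_V[OF assms(1) c'(2)] by (simp add: x0_def trd_scale)
    moreover have "nrd x0 \<in> pideal 2"
      using pideal_V[OF assms(2) V_product_pideal2[OF c'(2) c'(2)]]
      by (simp add: x0_def nrd_scale power2_eq_square)
    moreover have "x0 = scaleK (\<alpha> / c) 1 + scaleK (\<beta> / c) u + scaleK (\<gamma> / c) v + scaleK (\<eta> / c) y"
      by (simp add: x0_def x scale_right_distrib)
    moreover have "\<alpha> / c \<in> V" "\<beta> / c \<in> V" "\<gamma> / c \<in> V" "\<eta> / c \<in> V" using c(3) by (auto simp: X_def)
    ultimately have "\<alpha> / c \<in> pideal 1 \<and> \<beta> / c \<in> pideal 1 \<and> \<gamma> / c \<in> pideal 1 \<and> \<eta> / c \<in> pideal 1"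
      by (intro primitive_integral)
    then have "c / c \<in> pideal 1" using c(1) unfolding X_def by auto
    then show False using c(2) one_notin_pideal by simp
  qed
  then have "\<alpha> \<in> V" "\<beta> \<in> V" "\<gamma> \<in> V" "\<eta> \<in> V" by (auto simp: X_def)
  then show ?thesis unfolding x by (intro L_add L_scale L_one u_in v_in y_in)
qed

end

section \<open>Localized orders and the dyadic dichotomy\<close>

locale dyadic_order = involution_quaternion scaleK s i j a b + dyadic_valuation V p
  for scaleK :: "'k::field_char_0 \<Rightarrow> 'h::ring_1 \<Rightarrow> 'h" and s :: "'h \<Rightarrow> 'h" and i j :: 'h and a b :: 'k
    and V :: "'k set" and p :: 'k
begin

definition units :: "'k set" where "units = {q\<in>oK. q \<noteq> 0 \<and> 1 / q \<in> V}"

lemma units_mult: "q \<in> units \<Longrightarrow> r \<in> units \<Longrightarrow> q * r \<in> units"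
  using V_mult[of "1 / q" "1 / r"] by (auto simp: units_def)

lemma units_one: "1 \<in> units" by (simp add: units_def)

definition loc :: "'h set \<Rightarrow> 'h set" where "loc S = {x. \<exists>q\<in>units. scaleK q x \<in> S}"

lemma locI: "q \<in> units \<Longrightarrow> scaleK q x \<in> S \<Longrightarrow> x \<in> loc S"
  by (auto simp: loc_def)

lemma locE: assumes "x \<in> loc S" obtains q where "q \<in> units" "scaleK q x \<in> S"
  using assms by (auto simp: loc_def)

lemma loc_base: "x \<in> S \<Longrightarrow> x \<in> loc S"
  using locI[OF units_one] by simp

lemma loc_rsub:
  assumes S: "osub S" shows "rsub V (loc S)"
  unfolding rsub_def
proof (intro conjI ballI)
  show "0 \<in> loc S" by (rule loc_base[OF osub_0[OF S]])
next
  fix x y assume "x \<in> loc S" "y \<in> loc S"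
  then obtain q r where q: "q \<in> units" "scaleK q x \<in> S" and r: "r \<in> units" "scaleK r y \<in> S"
    by (elim locE)
  have "scaleK r (scaleK q x) + scaleK q (scaleK r y) \<in> S"
    by (rule osub_add[OF S osub_scale[OF S _ q(2)] osub_scale[OF S _ r(2)]])
      (use q(1) r(1) in \<open>simp_all add: units_def\<close>)
  also have "scaleK r (scaleK q x) + scaleK q (scaleK r y) = scaleK (q * r) (x + y)"
    by (simp add: scale_right_distrib mult.commute)
  finally show "x + y \<in> loc S" by (rule locI[OF units_mult[OF q(1) r(1)]])
next
  fix c x assume "c \<in> V" "x \<in> loc S"
  then obtain q where q: "q \<in> units" "scaleK q x \<in> S" by (elim locE)
  obtain r where r: "r \<in> units" "r * c \<in> oK"
    using V_denominator[of "{c}"] \<open>c \<in> V\<close> by (auto simp: units_def)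
  have "scaleK (r * c) (scaleK q x) \<in> S" by (rule osub_scale[OF S r(2) q(2)])
  then have "scaleK (q * r) (scaleK c x) \<in> S" by (simp add: mult_ac)
  then show "scaleK c x \<in> loc S" by (rule locI[OF units_mult[OF q(1) r(1)]])
qed

lemma loc_mult:
  assumes S: "is_order scaleK S" and "x \<in> loc S" "y \<in> loc S" shows "x * y \<in> loc S"
proof -
  obtain q r where q: "q \<in> units" "scaleK q x \<in> S" and r: "r \<in> units" "scaleK r y \<in> S"
    using assms(2,3) by (elim locE)
  have "scaleK q x * scaleK r y \<in> S" by (rule order_mult[OF S q(2) r(2)])
  then have "scaleK (q * r) (x * y) \<in> S" by (simp add: scale_mult_left scale_mult_right mult.commute)
  then show ?thesis by (rule locI[OF units_mult[OF q(1) r(1)]])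
qed

lemma units_cancel: "q \<in> units \<Longrightarrow> q * x \<in> V \<Longrightarrow> x \<in> V"
  using V_mult[of "1 / q" "q * x"] by (auto simp: units_def)

lemma loc_trd: assumes S: "is_order scaleK S" and x: "x \<in> loc S" shows "trd x \<in> V"
proof -
  obtain q where q: "q \<in> units" "scaleK q x \<in> S" using x by (elim locE)
  have "q * trd x \<in> V" using trd_integral[OF S q(2)] oK_subset by (auto simp: trd_scale)
  then show ?thesis by (rule units_cancel[OF q(1)])
qed

lemma loc_nrd: assumes S: "is_order scaleK S" and x: "x \<in> loc S" shows "nrd x \<in> V"
proof -
  obtain q where q: "q \<in> units" "scaleK q x \<in> S" using x by (elim locE)
  have "q * q * nrd x \<in> V"
    using nrd_integral[OF S q(2)] oK_subset by (auto simp: nrd_scale power2_eq_square)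
  then show ?thesis by (rule units_cancel[OF units_mult[OF q(1) q(1)]])
qed

lemma loc_ospan:
  assumes B: "finite B" shows "loc (ospan B) = rspan V B"
proof
  show "rspan V B \<subseteq> loc (ospan B)"
    using ospan_base[OF B] loc_base by (intro rspan_minimal[OF V_subring loc_rsub[OF osub_ospan]]) auto
  show "loc (ospan B) \<subseteq> rspan V B"
  proof
    fix x assume "x \<in> loc (ospan B)"
    then obtain q where q: "q \<in> units" "scaleK q x \<in> ospan B" by (elim locE)
    have "ospan B \<subseteq> rspan V B" using oK_subset unfolding rspan_def by blast
    then have "scaleK q x \<in> rspan V B" using q(2) by blast
    then have "scaleK (1 / q) (scaleK q x) \<in> rspan V B"
      by (rule rsub_scale[OF V_subring rsub_rspan[OF V_subring], rotated])
        (use q(1) in \<open>simp add: units_def\<close>)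
    then show "x \<in> rspan V B" using q(1) by (simp add: units_def)
  qed
qed

text \<open>Over a valuation ring a linear functional attains its largest value on a finitely generated
  module, and the kernel is again finitely generated.\<close>

lemma split_functional:
  assumes C: "finite C" and add: "\<And>x y. \<phi> (x + y) = \<phi> x + \<phi> y" and scale: "\<And>r x. \<phi> (scaleK r x) = r * \<phi> x"
    and nz: "\<exists>x\<in>rspan V C. \<phi> x \<noteq> 0"
  shows "\<exists>m C'. m \<in> rspan V C \<and> \<phi> m \<noteq> 0 \<and> (\<forall>x\<in>rspan V C. \<phi> x / \<phi> m \<in> V) \<and> finite C' \<and>
    rspan V C' = {x\<in>rspan V C. \<phi> x = 0}"
proof -
  note sub = rsub_rspan[OF V_subring]
  have \<phi>0: "\<phi> 0 = 0" using scale[of 0 0] by simp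
  have \<phi>_diff: "\<phi> (x - y) = \<phi> x - \<phi> y" for x y
    using add[of x "scaleK (-1) y"] scale[of "-1" y] by simp
  have "\<exists>x\<in>\<phi> ` C. x \<noteq> 0"
  proof (rule ccontr)
    assume "\<not> ?thesis"
    then have "C \<subseteq> {x. \<phi> x = 0}" by auto
    moreover have "rsub V {x. \<phi> x = 0}" by (simp add: rsub_def add scale \<phi>0)
    ultimately have "rspan V C \<subseteq> {x. \<phi> x = 0}" using rspan_minimal[OF V_subring] by blast
    then show False using nz by blast
  qed
  then have "\<exists>c\<in>\<phi> ` C. c \<noteq> 0 \<and> (\<forall>x\<in>\<phi> ` C. x / c \<in> V)" using C by (intro max_coefficient) auto
  then obtain m where m: "m \<in> C" "\<phi> m \<noteq> 0" and mC: "\<And>x. x \<in> C \<Longrightarrow> \<phi> x / \<phi> m \<in> V" by blast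
  have mS: "m \<in> rspan V C" by (rule rspan_base[OF V_subring C m(1)])
  have ratio: "\<phi> x / \<phi> m \<in> V" if "x \<in> rspan V C" for x
  proof -
    have "rsub V {x. \<phi> x / \<phi> m \<in> V}"
      using V_add V_mult by (auto simp: rsub_def add scale \<phi>0 add_divide_distrib times_divide_eq_right[symmetric]
        simp del: times_divide_eq_right)
    moreover have "C \<subseteq> {x. \<phi> x / \<phi> m \<in> V}" using mC by blast
    ultimately have "rspan V C \<subseteq> {x. \<phi> x / \<phi> m \<in> V}" by (rule rspan_minimal[OF V_subring])
    then show ?thesis using that by blast
  qed
  \<comment> \<open>Subtracting the multiple of \<open>m\<close> that cancels the functional maps
    generators of the module to generators of the kernel.\<close>
  define pr where "pr x = x - scaleK (\<phi> x / \<phi> m) m" for x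
  define C' where "C' = pr ` C"
  have fin: "finite C'" using C by (simp add: C'_def)
  have \<phi>_pr: "\<phi> (pr x) = 0" for x using m by (simp add: pr_def \<phi>_diff scale)
  have pr_in: "pr x \<in> rspan V C" if "x \<in> rspan V C" for x
    unfolding pr_def by (intro rsub_diff[OF V_subring sub] rsub_scale[OF V_subring sub] that ratio mS)
  have "rspan V C' \<subseteq> {x\<in>rspan V C. \<phi> x = 0}"
  proof (rule rspan_minimal[OF V_subring])
    show "rsub V {x\<in>rspan V C. \<phi> x = 0}"
      using rsub_0[OF V_subring sub] rsub_add[OF V_subring sub] rsub_scale[OF V_subring sub]
      by (auto simp: rsub_def add scale \<phi>0)
    show "C' \<subseteq> {x\<in>rspan V C. \<phi> x = 0}"
      using \<phi>_pr pr_in rspan_base[OF V_subring C] by (auto simp: C'_def)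
  qed
  moreover have "x \<in> rspan V C'" if x: "x \<in> rspan V C" "\<phi> x = 0" for x
  proof -
    have "rsub V {x. pr x \<in> rspan V C'}"
    proof -
      have "pr (x + y) = pr x + pr y" for x y
        by (simp add: pr_def add add_divide_distrib scale_left_distrib)
      moreover have "pr (scaleK c x) = scaleK c (pr x)" for c x
        by (simp add: pr_def scale scale_right_diff_distrib)
      moreover have "pr 0 = 0" by (simp add: pr_def \<phi>0)
      ultimately show ?thesis
        using rsub_0[OF V_subring sub] rsub_add[OF V_subring sub] rsub_scale[OF V_subring sub]
        by (simp add: rsub_def)
    qed
    moreover have "C \<subseteq> {x. pr x \<in> rspan V C'}"
      using rspan_base[OF V_subring fin] by (auto simp: C'_def)
    ultimately have "rspan V C \<subseteq> {x. pr x \<in> rspan V C'}" by (rule rspan_minimal[OF V_subring])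
    then have "pr x \<in> rspan V C'" using x(1) by blast
    then show ?thesis using x(2) by (simp add: pr_def)
  qed
  ultimately have "rspan V C' = {x\<in>rspan V C. \<phi> x = 0}" by blast
  then show ?thesis using mS m(2) ratio fin by blast
qed

text \<open>On the localized order L the functional \<open>c3\<close> attains its least valuation at
  some \<open>w0\<close>; the dichotomy is whether a product of two fixed elements attains it too.
  If so, w is a fixed element plus a multiple of that product, hence in the localization of
  \<open>R'\<close>. If not, the fixed part of L satisfies the axioms of
  \<open>dyadic_special\<close>, and x, having integral trace and norm, lies in L. Either way x w
  lies in one localized order.\<close>

lemma trace_integral:
  assumes max: "maximal_involution_order scaleK s R" and R': "is_order scaleK R'"
    and fixed: "\<And>x. x \<in> R \<Longrightarrow> s x = x \<Longrightarrow> x \<in> R'" and x: "x \<in> R'" and w: "w \<in> R"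
  shows "trd (x * w) \<in> V"
proof -
  have R: "is_order scaleK R" and sR: "\<And>x. x \<in> R \<Longrightarrow> s x \<in> R"
    using max unfolding maximal_involution_order_def involution_order_def by blast+
  obtain B where B: "finite B" "R = ospan B" using order_generators[OF R] .
  have spanR: "span R = UNIV" using R by (simp add: is_order_def)
  define L where "L = loc R"
  define L' where "L' = loc R'"
  have L_eq: "L = rspan V B" unfolding L_def B(2) by (rule loc_ospan[OF B(1)])
  have L_sub: "rsub V L" unfolding L_def by (rule loc_rsub[OF order_osub[OF R]])
  have L'_sub: "rsub V L'" unfolding L'_def by (rule loc_rsub[OF order_osub[OF R']])
  note L_add = rsub_add[OF V_subring L_sub] and L_diff = rsub_diff[OF V_subring L_sub]
    and L_scale = rsub_scale[OF V_subring L_sub]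
  note L'_add = rsub_add[OF V_subring L'_sub] and L'_diff = rsub_diff[OF V_subring L'_sub]
    and L'_scale = rsub_scale[OF V_subring L'_sub]
  have L_mult: "y * z \<in> L" if "y \<in> L" "z \<in> L" for y z using loc_mult[OF R] that unfolding L_def .
  have L'_mult: "y * z \<in> L'" if "y \<in> L'" "z \<in> L'" for y z using loc_mult[OF R'] that unfolding L'_def .
  have L_one: "1 \<in> L" unfolding L_def by (rule loc_base[OF order_one[OF R]])
  have L_trd: "trd y \<in> V" if "y \<in> L" for y using loc_trd[OF R] that unfolding L_def .
  have L_nrd: "nrd y \<in> V" if "y \<in> L" for y using loc_nrd[OF R] that unfolding L_def .
  have L_s: "s y \<in> L" if y: "y \<in> L" for y
  proof -
    obtain q where q: "q \<in> units" "scaleK q y \<in> R" using y unfolding L_def by (elim locE)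
    have "scaleK q (s y) \<in> R" using sR[OF q(2)] by (simp only: s_scale)
    then show ?thesis unfolding L_def by (rule locI[OF q(1)])
  qed
  have s_fixed: "s y = y \<longleftrightarrow> c3 y = 0" for y
  proof
    assume "s y = y"
    then have "- c3 y = c3 y" by (metis coords_s(4))
    then show "c3 y = 0" by simp
  next
    assume "c3 y = 0"
    then show "s y = y" by (intro coords_eqI) (simp_all add: coords)
  qed
  have LL': "y \<in> L'" if y: "y \<in> L" "c3 y = 0" for y
  proof -
    obtain q where q: "q \<in> units" "scaleK q y \<in> R" using y(1) unfolding L_def by (elim locE)
    have "scaleK q y \<in> R'" using y(2) by (intro fixed[OF q(2)]) (simp add: s_fixed coords)
    then show ?thesis unfolding L'_def by (rule locI[OF q(1)])
  qed
  have multiple: "\<exists>n>0. scaleK (of_nat n) y \<in> L" for y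
    using order_contains_multiple[OF spanR order_osub[OF R], of y] loc_base unfolding L_def by blast
  have "\<exists>y\<in>L. c3 y \<noteq> 0"
  proof -
    obtain n where n: "n > 0" "scaleK (of_nat n) (i * j) \<in> L" using multiple by blast
    then show ?thesis by (intro bexI[OF _ n(2)]) (simp add: coords)
  qed
  then have "\<exists>m C'. m \<in> L \<and> c3 m \<noteq> 0 \<and> (\<forall>y\<in>L. c3 y / c3 m \<in> V) \<and> finite C' \<and> rspan V C' = {y\<in>L. c3 y = 0}"
    unfolding L_eq by (intro split_functional[OF B(1)]) (simp_all add: coords)
  then obtain w0 C1 where w0: "w0 \<in> L" "c3 w0 \<noteq> 0" and w0_ratio: "\<forall>y\<in>L. c3 y / c3 w0 \<in> V"
    and C1: "finite C1" "rspan V C1 = {y\<in>L. c3 y = 0}" by (elim exE conjE)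
  have xL': "x \<in> L'" unfolding L'_def by (rule loc_base[OF x])
  have wL: "w \<in> L" unfolding L_def by (rule loc_base[OF w])
  have L'_goal: ?thesis if "w \<in> L'"
    using loc_trd[OF R' loc_mult[OF R']] xL' that unfolding L'_def by blast
  show ?thesis
  proof (cases "\<exists>u v. u \<in> L \<and> v \<in> L \<and> c3 u = 0 \<and> c3 v = 0 \<and> c3 (u * v) \<noteq> 0 \<and> c3 w0 / c3 (u * v) \<in> V")
    case True
    then obtain u v where uv: "u \<in> L" "v \<in> L" "c3 u = 0" "c3 v = 0" "c3 (u * v) \<noteq> 0" "c3 w0 / c3 (u * v) \<in> V"
      by (elim exE conjE)
    have "c3 w / c3 (u * v) = (c3 w / c3 w0) * (c3 w0 / c3 (u * v))" using w0(2) by simp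
    then have r: "c3 w / c3 (u * v) \<in> V" using V_mult[OF bspec[OF w0_ratio wL] uv(6)] by (simp only:)
    define z where "z = w - scaleK (c3 w / c3 (u * v)) (u * v)"
    have "z \<in> L" unfolding z_def by (intro L_diff L_scale L_mult wL r uv)
    moreover have "c3 z = 0" using uv(5) by (simp add: z_def coords_diff coords_scale)
    ultimately have "z \<in> L'" by (rule LL')
    then have "z + scaleK (c3 w / c3 (u * v)) (u * v) \<in> L'"
      by (rule L'_add[OF _ L'_scale[OF r L'_mult[OF LL'[OF uv(1,3)] LL'[OF uv(2,4)]]]])
    then have "w \<in> L'" by (simp add: z_def)
    then show ?thesis by (rule L'_goal)
  next
    case False
    have small: "c3 (u * v) / c3 w0 \<in> pideal 1" if uv: "u \<in> L" "v \<in> L" "c3 u = 0" "c3 v = 0" for u v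
    proof (rule ccontr)
      assume n: "c3 (u * v) / c3 w0 \<notin> pideal 1"
      have "c3 (u * v) / c3 w0 \<in> V" using w0_ratio L_mult[OF uv(1,2)] by blast
      from unit_or_pideal[OF this n] have "c3 (u * v) \<noteq> 0" "c3 w0 / c3 (u * v) \<in> V" by auto
      then show False using False uv by blast
    qed
    have "\<exists>y\<in>rspan V C1. c2 y \<noteq> 0"
    proof -
      obtain n where n: "n > 0" "scaleK (of_nat n) j \<in> L" using multiple by blast
      then have "scaleK (of_nat n) j \<in> rspan V C1" unfolding C1(2) by (simp add: coords)
      then show ?thesis by (rule bexI[rotated]) (use n(1) in \<open>simp add: coords\<close>)
    qed
    then have "\<exists>m C'. m \<in> rspan V C1 \<and> c2 m \<noteq> 0 \<and> (\<forall>y\<in>rspan V C1. c2 y / c2 m \<in> V) \<and> finite C' \<and>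
        rspan V C' = {y\<in>rspan V C1. c2 y = 0}"
      by (intro split_functional[OF C1(1)]) (simp_all add: coords)
    then obtain v0 C2 where v0: "v0 \<in> rspan V C1" "c2 v0 \<noteq> 0" "\<forall>y\<in>rspan V C1. c2 y / c2 v0 \<in> V"
      and C2: "finite C2" "rspan V C2 = {y\<in>rspan V C1. c2 y = 0}" by (elim exE conjE)
    have "\<exists>y\<in>rspan V C2. c1 y \<noteq> 0"
    proof -
      obtain n where n: "n > 0" "scaleK (of_nat n) i \<in> L" using multiple by blast
      then have "scaleK (of_nat n) i \<in> rspan V C2" unfolding C2(2) C1(2) by (simp add: coords)
      then show ?thesis by (rule bexI[rotated]) (use n(1) in \<open>simp add: coords\<close>)
    qed
    then have "\<exists>m C'. m \<in> rspan V C2 \<and> c1 m \<noteq> 0 \<and> (\<forall>y\<in>rspan V C2. c1 y / c1 m \<in> V) \<and> finite C' \<and>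
        rspan V C' = {y\<in>rspan V C2. c1 y = 0}"
      by (intro split_functional[OF C2(1)]) (simp_all add: coords)
    then obtain u0 where u0: "u0 \<in> rspan V C2" "c1 u0 \<noteq> 0" "\<forall>y\<in>rspan V C2. c1 y / c1 u0 \<in> V"
      by (elim exE conjE)
    have v0L: "v0 \<in> L" "c3 v0 = 0" using v0(1) unfolding C1(2) by simp_all
    have u0L: "u0 \<in> L" "c3 u0 = 0" "c2 u0 = 0" using u0(1) unfolding C2(2) C1(2) by simp_all
    \<comment> \<open>Triangular elimination: \<open>v0\<close> clears \<open>c2\<close>,
      \<open>u0\<close> clears \<open>c1\<close>, and a scalar remains. Its norm is its square, and
      \<open>V\<close> is closed under square roots.\<close>
    have decomp: "\<exists>\<alpha> \<beta> \<gamma>. \<alpha> \<in> V \<and> \<beta> \<in> V \<and> \<gamma> \<in> V \<and> y = scaleK \<alpha> 1 + scaleK \<beta> u0 + scaleK \<gamma> v0"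
      if y: "y \<in> L" "c3 y = 0" for y
    proof -
      define \<gamma> where "\<gamma> = c2 y / c2 v0"
      define y1 where "y1 = y - scaleK \<gamma> v0"
      have "\<gamma> \<in> V" using v0(3) y unfolding C1(2) \<gamma>_def by simp
      then have "y1 \<in> L" unfolding y1_def by (intro L_diff L_scale v0L y)
      moreover have "c3 y1 = 0" "c2 y1 = 0" using y v0L v0(2) by (simp_all add: y1_def \<gamma>_def coords)
      ultimately have y1: "y1 \<in> rspan V C2" unfolding C2(2) C1(2) by simp
      define \<beta> where "\<beta> = c1 y1 / c1 u0"
      define y2 where "y2 = y1 - scaleK \<beta> u0"
      have "\<beta> \<in> V" using u0(3) y1 unfolding \<beta>_def by blast
      then have "y2 \<in> L" unfolding y2_def by (intro L_diff L_scale u0L \<open>y1 \<in> L\<close>)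
      have y2: "scaleK (c0 y2) 1 = y2"
        using \<open>c3 y1 = 0\<close> \<open>c2 y1 = 0\<close> u0L u0(2)
        by (intro coords_eqI) (simp_all add: y2_def \<beta>_def coords)
      have "nrd (scaleK (c0 y2) 1) \<in> V" unfolding y2 by (rule L_nrd[OF \<open>y2 \<in> L\<close>])
      then have "c0 y2 * c0 y2 \<in> V" by (simp add: nrd_scale power2_eq_square)
      then have "c0 y2 \<in> V" by (rule V_square)
      moreover have "y = scaleK (c0 y2) 1 + scaleK \<beta> u0 + scaleK \<gamma> v0"
        unfolding y2 by (simp add: y2_def y1_def)
      ultimately show ?thesis using \<open>\<beta> \<in> V\<close> \<open>\<gamma> \<in> V\<close> by blast
    qed
    have indep: "\<alpha> \<in> V \<and> \<beta> \<in> V \<and> \<gamma> \<in> V" if e: "scaleK \<alpha> 1 + scaleK \<beta> u0 + scaleK \<gamma> v0 \<in> L" for \<alpha> \<beta> \<gamma>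
    proof -
      let ?y = "scaleK \<alpha> 1 + scaleK \<beta> u0 + scaleK \<gamma> v0"
      have "c3 ?y = 0" using u0L v0L by (simp add: coords)
      from decomp[OF e this] obtain \<alpha>' \<beta>' \<gamma>' where *: "\<alpha>' \<in> V" "\<beta>' \<in> V" "\<gamma>' \<in> V"
        and y: "?y = scaleK \<alpha>' 1 + scaleK \<beta>' u0 + scaleK \<gamma>' v0" by (elim exE conjE)
      have "\<gamma> = \<gamma>'" using arg_cong[OF y, of c2] u0L v0(2) by (simp add: coords)
      moreover from this have "\<beta> = \<beta>'" using arg_cong[OF y, of c1] u0(2) by (simp add: coords)
      ultimately have "\<alpha> = \<alpha>'" using arg_cong[OF y, of c0] by (simp add: coords)
      then show ?thesis using * \<open>\<beta> = \<beta>'\<close> \<open>\<gamma> = \<gamma>'\<close> by simp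
    qed
    \<comment> \<open>For fixed u and v the commutator is a multiple of i * j, and so is
      \<open>w0 - s w0\<close>. Comparing \<open>c3\<close>, which is doubled on both sides, gives
      the ratio c3 (u v) / c3 w0, a nonunit by assumption of this case.\<close>
    have commute: "scaleK (1 / p) (u * v - v * u) \<in> L" if uv: "u \<in> L" "v \<in> L" "c3 u = 0" "c3 v = 0" for u v
    proof -
      have "scaleK (c3 (u * v) / c3 w0 / p) (w0 - s w0) \<in> L"
        using small[OF uv] unfolding pideal_1 by (intro L_scale L_diff L_s w0)
      also have "scaleK (c3 (u * v) / c3 w0 / p) (w0 - s w0) = scaleK (1 / p) (scaleK (c3 (u * v) / c3 w0) (w0 - s w0))"
        by simp
      also have "scaleK (c3 (u * v) / c3 w0) (w0 - s w0) = u * v - v * u"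
      proof -
        define \<rho> where "\<rho> = c3 (u * v) / c3 w0"
        have \<rho>: "\<rho> * c3 w0 = c1 u * c2 v - c1 v * c2 u"
          using uv(3,4) w0(2) by (simp add: \<rho>_def coords mult.commute)
        have "\<rho> * (2 * c3 w0) = 2 * (\<rho> * c3 w0)" by simp
        then have "\<rho> * (2 * c3 w0) = 2 * (c1 u * c2 v) - 2 * (c1 v * c2 u)"
          unfolding \<rho> right_diff_distrib .
        then show ?thesis
          unfolding \<rho>_def[symmetric] using uv(3,4) by (intro coords_eqI) (simp_all add: coords mult.commute)
      qed
      finally show ?thesis .
    qed
    have closed: "\<exists>r\<in>L. c3 r = 0 \<and> scaleK (1 / p) (u * v - r) \<in> L" if uv: "u \<in> L" "v \<in> L" "c3 u = 0" "c3 v = 0" for u v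
    proof -
      define r where "r = u * v - scaleK (c3 (u * v) / c3 w0) w0"
      have "c3 (u * v) / c3 w0 \<in> V" using w0_ratio L_mult[OF uv(1,2)] by blast
      then have "r \<in> L" unfolding r_def by (intro L_diff L_mult L_scale uv w0)
      moreover have "c3 r = 0" using w0(2) by (simp add: r_def coords_diff coords_scale)
      moreover have "scaleK (c3 (u * v) / c3 w0 / p) w0 \<in> L"
        using small[OF uv] unfolding pideal_1 by (intro L_scale w0)
      then have "scaleK (1 / p) (u * v - r) \<in> L" by (simp add: r_def mult.commute)
      ultimately show ?thesis by blast
    qed
    \<comment> \<open>This element is (u0 v0 + v0 u0) / p, which the polarized Cayley-Hamilton
      identity expands in 1, u0, v0. By \<open>indep\<close> its coefficients are in
      \<open>V\<close>, so the traces are divisible by p.\<close>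
    have "scaleK (2 / p) (u0 * v0) - scaleK (1 / p) (u0 * v0 - v0 * u0) \<in> L"
      by (intro L_diff L_scale L_mult two_nonunit commute u0L v0L)
    also have "scaleK (2 / p) (u0 * v0) - scaleK (1 / p) (u0 * v0 - v0 * u0)
        = scaleK ((trd (u0 * v0) - trd u0 * trd v0) / p) 1 + scaleK (trd v0 / p) u0 + scaleK (trd u0 / p) v0"
      using p_nonzero by (intro coords_eqI) (simp_all add: trd_def coords field_simps)
    finally have "scaleK ((trd (u0 * v0) - trd u0 * trd v0) / p) 1 + scaleK (trd v0 / p) u0 + scaleK (trd u0 / p) v0 \<in> L" .
    from indep[OF this] have t0: "trd v0 \<in> pideal 1" "trd u0 \<in> pideal 1"
      and t1: "trd (u0 * v0) - trd u0 * trd v0 \<in> pideal 1"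
      unfolding pideal_1 by simp_all
    have "trd u0 \<in> V" by (rule L_trd[OF u0L(1)])
    then have "(trd (u0 * v0) - trd u0 * trd v0) + trd u0 * trd v0 \<in> pideal 1"
      by (rule pideal_add[OF t1 pideal_V[OF _ t0(1)]])
    then have tuv0: "trd (u0 * v0) \<in> pideal 1" by simp
    obtain \<alpha> where \<alpha>: "\<alpha> \<in> V" "(nrd u0 - \<alpha> ^ 2) / p \<in> V" using square_residue[OF L_nrd[OF u0L(1)]] by blast
    obtain \<beta> where \<beta>: "\<beta> \<in> V" "(nrd v0 - \<beta> ^ 2) / p \<in> V" using square_residue[OF L_nrd[OF v0L(1)]] by blast
    \<comment> \<open>Modulo p the norm of u0 - \<alpha> is nrd u0 - \<alpha> * \<alpha>, because
      trd u0 and 2 are nonunits. Subtracting a square root of the residue of the norm therefore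
      makes the norm a nonunit; likewise for v0.\<close>
    define u where "u = u0 - scaleK \<alpha> 1"
    define v where "v = v0 - scaleK \<beta> 1"
    have u: "u \<in> L" "c3 u = 0" "c2 u = 0" "c1 u \<noteq> 0"
      unfolding u_def using u0L u0(2) \<alpha> by (auto intro!: L_diff L_scale L_one simp: coords)
    have v: "v \<in> L" "c3 v = 0" "c2 v \<noteq> 0"
      unfolding v_def using v0L v0(2) \<beta> by (auto intro!: L_diff L_scale L_one simp: coords)
    have "dyadic_special scaleK s i j a b V p L u v"
    proof unfold_locales
      show "\<exists>\<alpha>' \<beta>' \<gamma>. \<alpha>' \<in> V \<and> \<beta>' \<in> V \<and> \<gamma> \<in> V \<and> y = scaleK \<alpha>' 1 + scaleK \<beta>' u + scaleK \<gamma> v"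
        if y: "y \<in> L" "c3 y = 0" for y
      proof -
        obtain \<alpha>' \<beta>' \<gamma> where *: "\<alpha>' \<in> V" "\<beta>' \<in> V" "\<gamma> \<in> V" and y_eq: "y = scaleK \<alpha>' 1 + scaleK \<beta>' u0 + scaleK \<gamma> v0"
          using decomp[OF y] by (elim exE conjE)
        have "\<alpha>' + \<beta>' * \<alpha> + \<gamma> * \<beta> \<in> V" by (intro V_add V_mult * \<alpha>(1) \<beta>(1))
        moreover have "y = scaleK (\<alpha>' + \<beta>' * \<alpha> + \<gamma> * \<beta>) 1 + scaleK \<beta>' u + scaleK \<gamma> v"
          unfolding y_eq u_def v_def by (simp add: scale_left_distrib scale_right_diff_distrib)
        ultimately show ?thesis using *(2,3) by (intro exI conjI)
      qed
      show "\<alpha>' \<in> V \<and> \<beta>' \<in> V \<and> \<gamma> \<in> V" if e: "scaleK \<alpha>' 1 + scaleK \<beta>' u + scaleK \<gamma> v \<in> L" for \<alpha>' \<beta>' \<gamma>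
      proof -
        have "scaleK \<alpha>' 1 + scaleK \<beta>' u + scaleK \<gamma> v
            = scaleK (\<alpha>' - \<beta>' * \<alpha> - \<gamma> * \<beta>) 1 + scaleK \<beta>' u0 + scaleK \<gamma> v0"
          unfolding u_def v_def by (simp add: scale_left_diff_distrib scale_right_diff_distrib)
        from indep[OF e[unfolded this]] have *: "\<alpha>' - \<beta>' * \<alpha> - \<gamma> * \<beta> \<in> V" "\<beta>' \<in> V" "\<gamma> \<in> V" by blast+
        then have "\<alpha>' - \<beta>' * \<alpha> - \<gamma> * \<beta> + \<beta>' * \<alpha> + \<gamma> * \<beta> \<in> V" by (intro V_add V_mult \<alpha>(1) \<beta>(1))
        then show ?thesis using * by simp
      qed
      show "z \<in> L" if z: "c3 z = 0" "nrd z \<in> V" "\<And>y. y \<in> L \<Longrightarrow> trd (z * y) \<in> V" for z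
      proof -
        \<comment> \<open>An integer q that is a unit of \<open>V\<close> clears the denominators of
          the norm and of finitely many traces. Then q z meets the hypotheses of
          \<open>maximal_absorbs\<close>, the one on \<open>s\<close> because q z is fixed.\<close>
        have BL: "B \<subseteq> L" unfolding L_eq using rspan_base[OF V_subring B(1)] by blast
        define X where "X = insert (nrd z) ((\<lambda>b. trd (z * b)) ` B)"
        have "finite X" "X \<subseteq> V" using B(1) BL z by (auto simp: X_def)
        from V_denominator[OF this]
        obtain q where q: "q \<in> oK" "q \<noteq> 0" "1 / q \<in> V" "\<forall>x\<in>X. q * x \<in> oK" by (elim bexE conjE)
        have "scaleK q z \<in> R"
        proof (rule maximal_absorbs[OF max])
          have "q * (q * nrd z) \<in> oK" by (rule oK_mult[OF q(1)]) (use q(4) in \<open>simp add: X_def\<close>)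
          then show "nrd (scaleK q z) \<in> oK" by (simp add: nrd_scale power2_eq_square mult.assoc)
          have "osub {y. q * trd (z * y) \<in> oK}"
          proof -
            have "trd 0 = 0" by (simp add: trd_def coords)
            then show ?thesis
              by (auto simp: rsub_def distrib_left scale_mult_right trd_add trd_scale mult.left_commute)
          qed
          then have "R \<subseteq> {y. q * trd (z * y) \<in> oK}"
            unfolding B(2) using q(4) by (intro ospan_minimal) (auto simp: X_def)
          then show "trd (scaleK q z * y) \<in> oK" if "y \<in> R" for y
            using that by (auto simp: scale_mult_left trd_scale)
          have "s (scaleK q z) = 0 + 1 * scaleK q z"
            using z(1) s_fixed[of "scaleK q z"] by (simp add: coords)
          then show "\<exists>r\<in>R. \<exists>r'\<in>R. s (scaleK q z) = r + r' * scaleK q z"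
            by (intro bexI[of _ 0] bexI[of _ 1] osub_0[OF order_osub[OF R]] order_one[OF R])
        qed
        then show ?thesis unfolding L_def by (rule locI[rotated]) (use q in \<open>simp add: units_def\<close>)
      qed
      show "trd u \<in> pideal 1"
      proof -
        have "trd u0 - \<alpha> * 2 \<in> pideal 1" by (intro pideal_diff pideal_V t0 \<alpha>(1) two_pideal)
        then show ?thesis by (simp add: u_def trd_diff trd_scale trd_one)
      qed
      show "trd v \<in> pideal 1"
      proof -
        have "trd v0 - \<beta> * 2 \<in> pideal 1" by (intro pideal_diff pideal_V t0 \<beta>(1) two_pideal)
        then show ?thesis by (simp add: v_def trd_diff trd_scale trd_one)
      qed
      show "trd (u * v) \<in> pideal 1"
      proof -
        have "trd (u0 * v0) - \<beta> * trd u0 - \<alpha> * trd v0 + (\<alpha> * \<beta>) * 2 \<in> pideal 1"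
          by (intro pideal_add pideal_diff pideal_V V_mult tuv0 t0 \<alpha>(1) \<beta>(1) two_pideal)
        also have "trd (u0 * v0) - \<beta> * trd u0 - \<alpha> * trd v0 + (\<alpha> * \<beta>) * 2 = trd (u * v)"
          by (simp add: u_def v_def trd_def coords algebra_simps)
        finally show ?thesis .
      qed
      show "nrd u \<in> pideal 1"
      proof -
        have "nrd u0 - \<alpha> ^ 2 \<in> pideal 1" using \<alpha>(2) unfolding pideal_1 .
        then have "nrd u0 - \<alpha> ^ 2 - \<alpha> * trd u0 + (\<alpha> * \<alpha>) * 2 \<in> pideal 1"
          by (intro pideal_add[OF pideal_diff[OF _ pideal_V[OF \<alpha>(1) t0(2)]] pideal_V[OF V_mult[OF \<alpha>(1) \<alpha>(1)] two_pideal]])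
        also have "nrd u0 - \<alpha> ^ 2 - \<alpha> * trd u0 + (\<alpha> * \<alpha>) * 2 = nrd u"
          by (simp add: u_def nrd_def trd_def coords power2_eq_square algebra_simps)
        finally show ?thesis .
      qed
      show "nrd v \<in> pideal 1"
      proof -
        have "nrd v0 - \<beta> ^ 2 \<in> pideal 1" using \<beta>(2) unfolding pideal_1 .
        then have "nrd v0 - \<beta> ^ 2 - \<beta> * trd v0 + (\<beta> * \<beta>) * 2 \<in> pideal 1"
          by (intro pideal_add[OF pideal_diff[OF _ pideal_V[OF \<beta>(1) t0(1)]] pideal_V[OF V_mult[OF \<beta>(1) \<beta>(1)] two_pideal]])
        also have "nrd v0 - \<beta> ^ 2 - \<beta> * trd v0 + (\<beta> * \<beta>) * 2 = nrd v"
          by (simp add: v_def nrd_def trd_def coords power2_eq_square algebra_simps)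
        finally show ?thesis .
      qed
      show "rsub V L" by (rule L_sub)
      show "1 \<in> L" by (rule L_one)
      show "y * z \<in> L" if "y \<in> L" "z \<in> L" for y z using L_mult[OF that] .
      show "trd y \<in> V" if "y \<in> L" for y using L_trd[OF that] .
      show "u \<in> L" "c3 u = 0" "c2 u = 0" "c1 u \<noteq> 0" by (fact u)+
      show "v \<in> L" "c3 v = 0" "c2 v \<noteq> 0" by (fact v)+
      show "\<exists>r\<in>L. c3 r = 0 \<and> scaleK (1 / p) (u * v - r) \<in> L" by (rule closed[OF u(1) v(1) u(2) v(2)])
      show "scaleK (1 / p) (u * v - v * u) \<in> L" by (rule commute[OF u(1) v(1) u(2) v(2)])
    qed
    then interpret special: dyadic_special scaleK s i j a b V p L u v .
    have "trd x \<in> V" "nrd x \<in> V" using trd_integral[OF R' x] nrd_integral[OF R' x] oK_subset by blast+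
    then have "x \<in> L" by (rule special.integral_in_L)
    then show ?thesis by (intro L_trd L_mult wL)
  qed
qed

end

section \<open>The fixed part determines the maximal order\<close>

context involution_quaternion
begin

text \<open>A multiple of i * j pairs to 0 with fixed elements, so \<open>w\<close> may be replaced
  by half of \<open>w - s w\<close>; for two multiples of i * j the squared trace is determined by
  the norms. The second identity moves \<open>s\<close> across the trace.\<close>

lemma skew_trace_square:
  "trd ((x - s x) * w) ^ 2 = nrd (x - s x) * nrd (w - s w)"
  "trd (x * (w - s w)) = trd ((x - s x) * w)"
  by (simp_all add: trd_def nrd_def coords power2_eq_square algebra_simps)

theorem order_containing_fixed_part:
  assumes max: "maximal_involution_order scaleK s R" and R': "is_order scaleK R'" and sR': "\<And>x. x \<in> R' \<Longrightarrow> s x \<in> R'"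
    and fixed: "\<And>x. x \<in> R \<Longrightarrow> s x = x \<Longrightarrow> x \<in> R'"
  shows "R' \<subseteq> R"
proof
  fix x assume x: "x \<in> R'"
  have R: "is_order scaleK R" and sR: "\<And>x. x \<in> R \<Longrightarrow> s x \<in> R"
    using max unfolding maximal_involution_order_def involution_order_def by blast+
  note sub = osubD[OF order_osub[OF R]] and sub' = osubD[OF order_osub[OF R']]
  define y where "y = x - s x"
  have nrd_y: "nrd y \<in> oK" unfolding y_def by (intro nrd_integral[OF R'] sub'(5) x sR')
  have trd_yw: "trd (y * w) \<in> oK" if w: "w \<in> R" for w
  proof (rule oK_sqrt)
    have "nrd (w - s w) \<in> oK" by (intro nrd_integral[OF R] sub(5) w sR)
    then show "trd (y * w) ^ 2 \<in> oK" unfolding y_def skew_trace_square using nrd_y[unfolded y_def] by auto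
  qed
  have "y \<in> R"
  proof (rule maximal_absorbs[OF max nrd_y trd_yw])
    have "s y = 0 + - 1 * y" by (simp add: y_def s_diff)
    then show "\<exists>r\<in>R. \<exists>r'\<in>R. s y = r + r' * y"
      by (intro bexI[of _ 0] bexI[of _ "- 1"] sub(1) sub(4)[OF order_one[OF R]])
  qed
  have trd_xw: "trd (x * w) \<in> oK" if w: "w \<in> R" for w
  proof (rule ccontr)
    assume neg: "trd (x * w) \<notin> oK"
    \<comment> \<open>2 w is the sum of \<open>w + s w\<close>, which is fixed and so lies in
      \<open>R'\<close>, and \<open>w - s w\<close>, whose pairing with \<open>x\<close> is that of
      \<open>x - s x\<close> with \<open>w\<close>.\<close>
    have "w + s w \<in> R'" by (intro fixed sub(2) w sR) (simp add: s_add add.commute)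
    then have "trd (x * (w + s w)) \<in> oK" by (intro trd_integral[OF R'] order_mult[OF R'] x)
    moreover have "trd (x * (w - s w)) \<in> oK"
      using trd_yw[OF w] unfolding skew_trace_square(2) y_def .
    ultimately have "trd (x * (w + s w)) + trd (x * (w - s w)) \<in> oK" by auto
    then have "2 * trd (x * w) \<in> oK" by (simp add: trd_def coords algebra_simps)
    then obtain V p where V: "dyadic_valuation V p" "trd (x * w) \<notin> V"
      using dyadic_valuation_exists[OF number_field neg] by metis
    interpret dyadic_valuation V p by (rule V(1))
    interpret dyadic_order scaleK s i j a b V p by unfold_locales
    show False using trace_integral[OF max R' fixed x w] V(2) by blast
  qed
  show "x \<in> R"
  proof (rule maximal_absorbs[OF max nrd_integral[OF R' x] trd_xw])
    have "s x = - y + 1 * x" by (simp add: y_def)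
    then show "\<exists>r\<in>R. \<exists>r'\<in>R. s x = r + r' * x"
      by (intro bexI[of _ "- y"] bexI[of _ 1] sub(4)[OF \<open>y \<in> R\<close>] order_one[OF R])
  qed
qed

end

section \<open>The twisted special linear group\<close>

no_notation Matrix.vec_index (infixl "$" 100)
hide_const (open) Matrix.mat

section \<open>Cosets, two by two matrices and the adjoint\<close>

lemma rcosets_finite:
  fixes G (structure)
  assumes "group G" "subgroup H G" "A \<subseteq> carrier G" and fin: "finite (f ` A)"
    and f: "\<And>x y. x \<in> A \<Longrightarrow> y \<in> A \<Longrightarrow> f x = f y \<Longrightarrow> \<exists>h\<in>H. y = h \<otimes> x"
  shows "finite (rcosets\<^bsub>G\<lparr>carrier := A\<rparr>\<^esub> H)"
proof -
  interpret group G by fact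
  interpret H: subgroup H G by fact
  define C where "C x = H #>\<^bsub>G\<lparr>carrier := A\<rparr>\<^esub> x" for x
  have C: "C x = (\<lambda>h. h \<otimes> x) ` H" for x
    by (auto simp: C_def r_coset_def)
  have C_eq: "C x = C y" if xy: "x \<in> A" "y \<in> A" "f x = f y" for x y
  proof -
    obtain h where h: "h \<in> H" "y = h \<otimes> x" using f[OF xy] by blast
    have x: "x \<in> carrier G" using xy assms(3) by blast
    have "k \<otimes> y \<in> C x" if "k \<in> H" for k
    proof -
      have "k \<otimes> y = (k \<otimes> h) \<otimes> x" using h that x by (simp add: m_assoc)
      then show ?thesis unfolding C using h that by blast
    qed
    moreover have "k \<otimes> x \<in> C y" if "k \<in> H" for k
    proof -
      have "k \<otimes> x = (k \<otimes> inv h) \<otimes> y" using h that x by (simp add: m_assoc[symmetric])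
        (simp add: m_assoc)
      moreover have "k \<otimes> inv h \<in> H" using h that by simp
      ultimately show ?thesis unfolding C by blast
    qed
    ultimately show ?thesis unfolding C by blast
  qed
  have "rcosets\<^bsub>G\<lparr>carrier := A\<rparr>\<^esub> H = C ` A"
    by (auto simp: RCOSETS_def C_def)
  moreover have "finite (C ` A)"
  proof -
    have "C ` A \<subseteq> (\<lambda>c. C (SOME x. x \<in> A \<and> f x = c)) ` (f ` A)"
    proof
      fix D assume "D \<in> C ` A"
      then obtain x where x: "x \<in> A" "D = C x" by blast
      define y where "y = (SOME y. y \<in> A \<and> f y = f x)"
      have "y \<in> A \<and> f y = f x" unfolding y_def by (rule someI[of _ x]) (use x in simp)
      then have "D = C y" using C_eq[of x y] x by simp
      then show "D \<in> (\<lambda>c. C (SOME x. x \<in> A \<and> f x = c)) ` (f ` A)"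
        using x(1) unfolding y_def by blast
    qed
    then show ?thesis using fin finite_surj by blast
  qed
  ultimately show ?thesis by simp
qed

lemma rcosets_representatives:
  fixes G (structure)
  assumes "group G" "subgroup H G" "A \<subseteq> carrier G" "finite (rcosets\<^bsub>G\<lparr>carrier := A\<rparr>\<^esub> H)"
  obtains T where "finite T" "T \<subseteq> A" "\<And>x. x \<in> A \<Longrightarrow> \<exists>t\<in>T. \<exists>h\<in>H. x = h \<otimes> t"
proof -
  interpret group G by fact
  interpret H: subgroup H G by fact
  define C where "C x = H #>\<^bsub>G\<lparr>carrier := A\<rparr>\<^esub> x" for x
  have C: "C x = (\<lambda>h. h \<otimes> x) ` H" for x
    by (auto simp: C_def r_coset_def)
  have "rcosets\<^bsub>G\<lparr>carrier := A\<rparr>\<^esub> H = C ` A"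
    by (auto simp: RCOSETS_def C_def)
  then have fin: "finite (C ` A)" using assms(4) by simp
  then obtain T where T: "T \<subseteq> A" "finite T" "C ` A = C ` T"
    using finite_subset_image[OF fin subset_refl] by metis
  have "\<exists>t\<in>T. \<exists>h\<in>H. x = h \<otimes> t" if x: "x \<in> A" for x
  proof -
    have "C x \<in> C ` T" using T(3) x by blast
    then obtain t where t: "t \<in> T" "C x = C t" by blast
    have "\<one> \<otimes> x \<in> C x" unfolding C by (rule imageI) simp
    then have "x \<in> C t" using x assms(3) t by (simp add: subset_iff)
    then show ?thesis using t(1) unfolding C by blast
  qed
  then show thesis using that T by blast
qed

lemma matrix_2_eq_iff: "(M :: 'a^2^2) = N \<longleftrightarrow>
    M$1$1 = N$1$1 \<and> M$1$2 = N$1$2 \<and> M$2$1 = N$2$1 \<and> M$2$2 = N$2$2"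
  by (simp add: Finite_Cartesian_Product.vec_eq_iff forall_2)

lemma matrix_mult_2: "((M :: 'a::semiring_1^2^2) ** N) $ p $ q = M$p$1 * N$1$q + M$p$2 * N$2$q"
  by (simp add: matrix_matrix_mult_def sum_2)

lemma hat_components: "hat s M $ 1 $ 1 = s (M$2$2)" "hat s M $ 1 $ 2 = - s (M$1$2)"
    "hat s M $ 2 $ 1 = - s (M$2$1)" "hat s M $ 2 $ 2 = s (M$1$1)"
  by (simp_all add: hat_def)

lemma one_components: "(mat 1 :: 'a::semiring_1^2^2) $ 1 $ 1 = 1" "(mat 1 :: 'a^2^2) $ 1 $ 2 = 0"
    "(mat 1 :: 'a^2^2) $ 2 $ 1 = 0" "(mat 1 :: 'a^2^2) $ 2 $ 2 = 1"
  by (simp_all add: Finite_Cartesian_Product.mat_def)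

lemmas matrix_2 = matrix_2_eq_iff matrix_mult_2 hat_components one_components

lemma GL_group: "group (GL_group :: ('k::field^'n^'n) monoid)"
proof (rule groupI)
  fix x y :: "'k^'n^'n" assume "x \<in> carrier GL_group" "y \<in> carrier GL_group"
  then show "x \<otimes>\<^bsub>GL_group\<^esub> y \<in> carrier GL_group" by (simp add: GL_group_def invertible_mult)
next
  fix x :: "'k^'n^'n" assume "x \<in> carrier GL_group"
  then obtain y where "x ** y = mat 1" "y ** x = mat 1" by (auto simp: GL_group_def invertible_def)
  then show "\<exists>y\<in>carrier GL_group. y \<otimes>\<^bsub>GL_group\<^esub> x = \<one>\<^bsub>GL_group\<^esub>"
    by (intro bexI[of _ y]) (auto simp: GL_group_def invertible_def intro: exI[of _ x])
qed (auto simp: GL_group_def matrix_mul_assoc invertible_def intro: exI[of _ "mat 1"])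

context involution_quaternion
begin

lemma indexed_basis_exists: "\<exists>e. indexed_basis scaleK e"
proof -
  define e :: "4 \<Rightarrow> 'h" where "e k = (if k = 1 then 1 else if k = 2 then i else if k = 3 then j else i * j)" for k
  have e: "e 1 = 1" "e 2 = i" "e 3 = j" "e 4 = i * j" by (simp_all add: e_def)
  have range: "range e = {1, i, j, i * j}" unfolding UNIV_4 by (simp add: e)
  have indep: "independent {1, i, j, i * j}" "1 \<notin> {i, j, i * j}" "i \<notin> {j, i * j}" "j \<noteq> i * j"
    by (rule four_independent, erule quaternion_span[OF ii a0 jj b0 ij_ji])+
  have "inj e"
  proof (rule injI)
    fix k l assume "e k = e l"
    with indep(2-4) exhaust_4[of k] exhaust_4[of l] show "k = l" by (elim disjE) (simp_all add: e)
  qed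
  then show ?thesis
    unfolding indexed_basis_def using range indep(1) independent_span_eq_UNIV[OF indep(1)] indep(2-4)
    by (intro exI[of _ e]) simp
qed

lemma hat_mult: "hat s (M ** N) = hat s N ** hat s M"
  by (simp add: matrix_2 s_add s_mult s_uminus)

lemma hat_hat: "hat s (hat s M) = M"
  by (simp add: matrix_2 s_uminus)

lemma hat_one: "hat s (mat 1) = mat 1"
  by (simp add: matrix_2)

end

text \<open>Two integral structures meet here: the free lattice \<Lambda> of an arbitrary basis
  \<open>e\<close>, which defines arithmeticity, and the order \<open>R\<close>, which need not be
  free. Each contains a multiple of the other.\<close>

locale lattice_basis = involution_quaternion scaleK s i j a b
  for scaleK :: "'k::field_char_0 \<Rightarrow> 'h::ring_1 \<Rightarrow> 'h" and s :: "'h \<Rightarrow> 'h" and i j :: 'h and a b :: 'k +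
  fixes e :: "4 \<Rightarrow> 'h" and R :: "'h set"
  assumes e: "indexed_basis scaleK e" and R: "is_order scaleK R" and sR: "x \<in> R \<Longrightarrow> s x \<in> R"
begin

abbreviation "rep \<equiv> regular_rep scaleK e"

definition co :: "4 \<Rightarrow> 'h \<Rightarrow> 'k" where "co l v = representation (range e) v (e l)"

lemma e_basis: "inj e" "independent (range e)" "span (range e) = UNIV"
  using e unfolding indexed_basis_def by blast+

lemma co_expand: "(\<Sum>l\<in>UNIV. scaleK (co l v) (e l)) = v"
proof -
  have "(\<Sum>b\<in>range e. scaleK (representation (range e) v b) b) = v"
    by (rule sum_representation_eq) (use e_basis in auto)
  then show ?thesis by (simp add: sum.reindex[OF e_basis(1)] co_def)
qed

lemma co_add: "co l (v + w) = co l v + co l w" and co_scale: "co l (scaleK c v) = c * co l v"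
  using e_basis by (simp_all add: co_def representation_add representation_scale)

lemma co_diff: "co l (v - w) = co l v - co l w"
  using co_add[of l v "scaleK (-1) w"] co_scale[of l "-1" w] by simp

lemma co_e: "co l (e m) = (if l = m then 1 else 0)"
  using e_basis by (simp add: co_def representation_basis inj_eq)

lemma rep_entry: "rep M $ (p, l) $ (q, m) = co l (M$p$q * e m)"
  by (simp add: regular_rep_def co_def)

definition \<Lambda> :: "'h set" where "\<Lambda> = {v. \<forall>l. co l v \<in> oK}"

lemma \<Lambda>_osub: "osub \<Lambda>"
proof -
  have "co l 0 = 0" for l using co_scale[of l 0 0] by simp
  then show ?thesis by (auto simp: rsub_def \<Lambda>_def co_add co_scale)
qed

lemma e_in_\<Lambda>: "e l \<in> \<Lambda>"
  by (simp add: \<Lambda>_def co_e)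

text \<open>Membership in the left order of \<Lambda>, tested on the basis.\<close>

definition stab :: "'h \<Rightarrow> bool" where "stab z \<longleftrightarrow> (\<forall>l. z * e l \<in> \<Lambda>)"

lemma stab_mult: assumes "stab z" "v \<in> \<Lambda>" shows "z * v \<in> \<Lambda>"
proof -
  have "z * v = (\<Sum>l\<in>UNIV. scaleK (co l v) (z * e l))"
    by (subst co_expand[of v, symmetric]) (simp add: sum_distrib_left scale_mult_right)
  also have "\<dots> \<in> \<Lambda>"
    using assms by (intro osub_sum[OF \<Lambda>_osub] osub_scale[OF \<Lambda>_osub]) (auto simp: stab_def \<Lambda>_def)
  finally show ?thesis .
qed

lemma rep_integral_iff: "(\<forall>r c. rep M $ r $ c \<in> oK) \<longleftrightarrow> (\<forall>p q. stab (M$p$q))"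
  by (simp add: stab_def \<Lambda>_def split_paired_all rep_entry) blast

lemma rep_mult: "rep (M ** N) = rep M ** rep N"
  by (rule regular_rep_mult[OF e])

lemma rep_inj: "rep M = rep N \<longleftrightarrow> M = N"
  using regular_rep_inj[OF e] by (auto dest: injD)

lemma rep_one: "rep (mat 1) = mat 1"
proof -
  have "rep (mat 1) $ r $ c = mat 1 $ r $ c" for r c
  proof -
    obtain p l where r: "r = (p, l)" by (cases r)
    obtain q m where c: "c = (q, m)" by (cases c)
    have "co l 0 = 0" using co_scale[of l 0 0] by simp
    then show ?thesis unfolding r c rep_entry by (simp add: Finite_Cartesian_Product.mat_def co_e)
  qed
  then show ?thesis by (simp add: Finite_Cartesian_Product.vec_eq_iff)
qed

text \<open>Although \<open>H\<close> is noncommutative, the regular representation reduces this to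
  square matrices over a field.\<close>

lemma left_inverse:
  fixes M N :: "'h^2^2"
  assumes "M ** N = mat 1" shows "N ** M = mat 1"
proof -
  have "rep M ** rep N = mat 1" by (simp add: rep_mult[symmetric] assms rep_one)
  then have "rep N ** rep M = mat 1" by (rule matrix_left_right_inverse[THEN iffD1])
  then have "rep (N ** M) = rep (mat 1)" by (simp add: rep_mult rep_one)
  then show ?thesis by (simp only: rep_inj)
qed

abbreviation "SL \<equiv> SL_inv s UNIV"

lemma SL_iff: "M \<in> SL \<longleftrightarrow> M ** hat s M = mat 1"
  by (simp add: SL_inv_def)

lemma SL_right: "M \<in> SL \<Longrightarrow> M ** hat s M = mat 1" and SL_left: "M \<in> SL \<Longrightarrow> hat s M ** M = mat 1"
  using left_inverse by (auto simp: SL_iff)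

lemma SL_hat: "M \<in> SL \<Longrightarrow> hat s M \<in> SL"
  using SL_left by (simp add: SL_iff hat_hat)

lemma SL_mult: "M \<in> SL \<Longrightarrow> N \<in> SL \<Longrightarrow> M ** N \<in> SL"
  unfolding SL_iff hat_mult by (metis matrix_mul_assoc matrix_mul_rid)

lemma SL_one: "mat 1 \<in> SL"
  by (simp add: SL_iff hat_one)

lemma SL_inv_group_simps: "carrier (SL_inv_group s) = SL" "M \<otimes>\<^bsub>SL_inv_group s\<^esub> N = M ** N"
    "\<one>\<^bsub>SL_inv_group s\<^esub> = mat 1"
  by (simp_all add: SL_inv_group_def)

lemma SL_group: "group (SL_inv_group s)"
proof (rule groupI, goal_cases)
  case (5 M)
  then show ?case using SL_left SL_hat by (auto simp: SL_inv_group_simps)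
qed (auto simp: SL_inv_group_simps SL_mult SL_one matrix_mul_assoc)

lemma SL_inv: "M \<in> SL \<Longrightarrow> inv\<^bsub>SL_inv_group s\<^esub> M = hat s M"
  by (rule group.inv_equality[OF SL_group]) (auto simp: SL_inv_group_simps SL_left SL_hat)

lemma subgroup_SL_iff: "subgroup \<Gamma> (SL_inv_group s) \<longleftrightarrow>
  \<Gamma> \<subseteq> SL \<and> mat 1 \<in> \<Gamma> \<and> (\<forall>M\<in>\<Gamma>. \<forall>N\<in>\<Gamma>. M ** N \<in> \<Gamma>) \<and> (\<forall>M\<in>\<Gamma>. hat s M \<in> \<Gamma>)"
proof
  assume "subgroup \<Gamma> (SL_inv_group s)"
  then interpret subgroup \<Gamma> "SL_inv_group s" .
  have sub: "\<Gamma> \<subseteq> SL" using subset by (simp add: SL_inv_group_simps)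
  have "hat s M \<in> \<Gamma>" if "M \<in> \<Gamma>" for M
  proof -
    have "M \<in> SL" using that sub by blast
    then show ?thesis using m_inv_closed[OF that] by (simp only: SL_inv)
  qed
  with sub show "\<Gamma> \<subseteq> SL \<and> mat 1 \<in> \<Gamma> \<and> (\<forall>M\<in>\<Gamma>. \<forall>N\<in>\<Gamma>. M ** N \<in> \<Gamma>) \<and> (\<forall>M\<in>\<Gamma>. hat s M \<in> \<Gamma>)"
    using one_closed m_closed by (simp add: SL_inv_group_simps)
next
  assume *: "\<Gamma> \<subseteq> SL \<and> mat 1 \<in> \<Gamma> \<and> (\<forall>M\<in>\<Gamma>. \<forall>N\<in>\<Gamma>. M ** N \<in> \<Gamma>) \<and> (\<forall>M\<in>\<Gamma>. hat s M \<in> \<Gamma>)"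
  have "inv\<^bsub>SL_inv_group s\<^esub> M \<in> \<Gamma>" if "M \<in> \<Gamma>" for M
  proof -
    have "M \<in> SL" using that * by blast
    then show ?thesis using that * by (simp only: SL_inv)
  qed
  with * show "subgroup \<Gamma> (SL_inv_group s)"
    by unfold_locales (simp_all add: SL_inv_group_simps)
qed

lemma rep_GL: "M \<in> SL \<Longrightarrow> rep M \<in> carrier GL_group"
  using SL_left[of M] SL_right[of M]
  by (auto simp: GL_group_def invertible_def rep_mult[symmetric] rep_one intro!: exI[of _ "rep (hat s M)"])

lemma rep_inv: "M \<in> SL \<Longrightarrow> inv\<^bsub>GL_group\<^esub> (rep M) = rep (hat s M)"
  using rep_GL[of "hat s M"] rep_GL[of M] SL_hat
  by (intro group.inv_equality[OF GL_group])
    (auto simp: GL_group_def rep_mult[symmetric] rep_one SL_left)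

lemma rep_subgroup:
  assumes "subgroup \<Gamma> (SL_inv_group s)" shows "subgroup (rep ` \<Gamma>) GL_group"
proof -
  have \<Gamma>: "\<Gamma> \<subseteq> SL" "mat 1 \<in> \<Gamma>" "\<And>M N. M \<in> \<Gamma> \<Longrightarrow> N \<in> \<Gamma> \<Longrightarrow> M ** N \<in> \<Gamma>" "\<And>M. M \<in> \<Gamma> \<Longrightarrow> hat s M \<in> \<Gamma>"
    using assms unfolding subgroup_SL_iff by blast+
  show ?thesis
  proof
    show "rep ` \<Gamma> \<subseteq> carrier GL_group" using \<Gamma>(1) rep_GL by blast
    show "x \<otimes>\<^bsub>GL_group\<^esub> y \<in> rep ` \<Gamma>" if xy: "x \<in> rep ` \<Gamma>" "y \<in> rep ` \<Gamma>" for x y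
    proof -
      obtain M N where "M \<in> \<Gamma>" "N \<in> \<Gamma>" "x = rep M" "y = rep N" using xy by blast
      then show ?thesis using \<Gamma>(3) by (simp add: GL_group_def rep_mult[symmetric])
    qed
    show "\<one>\<^bsub>GL_group\<^esub> \<in> rep ` \<Gamma>" using \<Gamma>(2) rep_one by (metis GL_group_def image_eqI monoid.select_convs(2))
    show "inv\<^bsub>GL_group\<^esub> x \<in> rep ` \<Gamma>" if x: "x \<in> rep ` \<Gamma>" for x
    proof -
      obtain M where M: "M \<in> \<Gamma>" "x = rep M" using x by blast
      then have "inv\<^bsub>GL_group\<^esub> x = rep (hat s M)" using rep_inv \<Gamma>(1) by blast
      then show ?thesis using \<Gamma>(4)[OF M(1)] by simp
    qed
  qed
qed

text \<open>\<open>hat s M\<close> is the inverse of \<open>M\<close>; the condition on it mirrors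
  the integral inverse demanded by \<open>GL_integers\<close>.\<close>

definition SL\<Lambda> where "SL\<Lambda> = {M \<in> SL. (\<forall>p q. stab (M$p$q)) \<and> (\<forall>p q. stab (hat s M$p$q))}"

lemma integral_points: "rep ` SL \<inter> GL_integers = rep ` SL\<Lambda>"
proof
  show "rep ` SL\<Lambda> \<subseteq> rep ` SL \<inter> GL_integers"
  proof
    fix x assume "x \<in> rep ` SL\<Lambda>"
    then obtain M where M: "M \<in> SL\<Lambda>" "x = rep M" by blast
    then have MS: "M \<in> SL" by (simp add: SL\<Lambda>_def)
    have 1: "\<forall>r c. rep M $ r $ c \<in> oK" "\<forall>r c. rep (hat s M) $ r $ c \<in> oK"
      using M(1) unfolding rep_integral_iff SL\<Lambda>_def by blast+
    have "rep M ** rep (hat s M) = mat 1" "rep (hat s M) ** rep M = mat 1"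
      using SL_left[OF MS] SL_right[OF MS] by (simp_all add: rep_mult[symmetric] rep_one)
    then have "rep M \<in> GL_integers" unfolding GL_integers_def using 1 by blast
    then show "x \<in> rep ` SL \<inter> GL_integers" using M(2) MS by blast
  qed
  show "rep ` SL \<inter> GL_integers \<subseteq> rep ` SL\<Lambda>"
  proof
    fix x assume "x \<in> rep ` SL \<inter> GL_integers"
    then obtain M B where M: "M \<in> SL" "x = rep M" and B: "\<forall>r c. rep M $ r $ c \<in> oK" "\<forall>r c. B $ r $ c \<in> oK"
      "rep M ** B = mat 1" "B ** rep M = mat 1"
      unfolding GL_integers_def by blast
    have "B = B ** (rep M ** rep (hat s M))"
      using SL_right[OF M(1)] by (simp add: rep_mult[symmetric] rep_one)
    also have "\<dots> = rep (hat s M)" by (simp add: matrix_mul_assoc B(4))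
    finally have "M \<in> SL\<Lambda>" using B(1,2) M(1) unfolding SL\<Lambda>_def rep_integral_iff[symmetric] by simp
    then show "x \<in> rep ` SL\<Lambda>" using M(2) by blast
  qed
qed

lemma stab_add: "stab x \<Longrightarrow> stab y \<Longrightarrow> stab (x + y)" and stab_prod: "stab x \<Longrightarrow> stab y \<Longrightarrow> stab (x * y)"
  and stab_one: "stab 1" and stab_zero: "stab 0"
  using osub_add[OF \<Lambda>_osub] stab_mult e_in_\<Lambda> osub_0[OF \<Lambda>_osub]
  by (auto simp: stab_def distrib_right mult.assoc)

lemma SL\<Lambda>_subgroup: "subgroup SL\<Lambda> (SL_inv_group s)"
  unfolding subgroup_SL_iff
proof (intro conjI ballI)
  show "SL\<Lambda> \<subseteq> SL" by (auto simp: SL\<Lambda>_def)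
  show "mat 1 \<in> SL\<Lambda>" by (auto simp: SL\<Lambda>_def SL_one hat_one stab_one stab_zero forall_2 one_components)
  show "M ** N \<in> SL\<Lambda>" if "M \<in> SL\<Lambda>" "N \<in> SL\<Lambda>" for M N
    using that by (auto simp: SL\<Lambda>_def SL_mult hat_mult matrix_mult_2 stab_add stab_prod)
  show "hat s M \<in> SL\<Lambda>" if "M \<in> SL\<Lambda>" for M
    using that by (auto simp: SL\<Lambda>_def SL_hat hat_hat)
qed

lemma SLR_subgroup: "subgroup (SL_inv s R) (SL_inv_group s)"
proof -
  note sub = osubD[OF order_osub[OF R]]
  show ?thesis
    unfolding subgroup_SL_iff
  proof (intro conjI ballI)
    show "SL_inv s R \<subseteq> SL" by (auto simp: SL_inv_def)
    show "mat 1 \<in> SL_inv s R"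
      using SL_one sub(1) order_one[OF R] by (auto simp: SL_inv_def forall_2 one_components)
    show "M ** N \<in> SL_inv s R" if "M \<in> SL_inv s R" "N \<in> SL_inv s R" for M N
      using that SL_mult[of M N] by (auto simp: SL_inv_def matrix_mult_2 intro!: sub(2) order_mult[OF R])
    show "hat s M \<in> SL_inv s R" if "M \<in> SL_inv s R" for M
      using that SL_hat[of M] sub(4) sR by (auto simp: SL_inv_def forall_2 hat_components)
  qed
qed

section \<open>Commensurability of the two integral structures\<close>

lemma R_in_\<Lambda>: "\<exists>N>0. \<forall>x\<in>R. scaleK (of_nat N) x \<in> \<Lambda>"
proof -
  obtain B where B: "finite B" "R = ospan B" using order_generators[OF R] .
  obtain N where N: "N > 0" "\<forall>x\<in>(\<lambda>(l, b). co l b) ` (UNIV \<times> B). of_nat N * x \<in> oK"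
    using common_denominator[OF number_field, of "(\<lambda>(l, b). co l b) ` (UNIV \<times> B)"] B(1) by auto
  have "osub {x. scaleK (of_nat N) x \<in> \<Lambda>}"
    using osubD[OF \<Lambda>_osub]
    by (auto simp: rsub_def scale_right_distrib) (metis mult.commute scale_scale)
  moreover have "B \<subseteq> {x. scaleK (of_nat N) x \<in> \<Lambda>}"
    using N(2) by (auto simp: \<Lambda>_def co_scale)
  ultimately have "R \<subseteq> {x. scaleK (of_nat N) x \<in> \<Lambda>}"
    unfolding B(2) by (rule ospan_minimal)
  then show ?thesis using N(1) by blast
qed

lemma \<Lambda>_in_R: "\<exists>N>0. \<forall>x\<in>\<Lambda>. scaleK (of_nat N) x \<in> R"
proof -
  have "\<exists>N>0. \<forall>b\<in>range e. scaleK (of_nat N) b \<in> R"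
  proof (rule common_multiple_exists)
    show "\<exists>n>0. scaleK (of_nat n) b \<in> R" for b
      using R order_contains_multiple[OF _ order_osub[OF R]] by (simp add: is_order_def)
    show "scaleK (of_nat (n * m)) b \<in> R" if "scaleK (of_nat n) b \<in> R" for b n m
      using osub_scale[OF order_osub[OF R] oK_of_nat[of m] that] by (simp add: mult.commute)
  qed simp
  then obtain N where N: "N > 0" "\<And>l. scaleK (of_nat N) (e l) \<in> R" by blast
  have "scaleK (of_nat N) v \<in> R" if v: "v \<in> \<Lambda>" for v
  proof -
    have "scaleK (of_nat N) v = (\<Sum>l\<in>UNIV. scaleK (co l v) (scaleK (of_nat N) (e l)))"
      by (subst co_expand[of v, symmetric]) (simp add: scale_sum_right mult.commute)
    also have "\<dots> \<in> R"
      using v by (intro osub_sum[OF order_osub[OF R]] osub_scale[OF order_osub[OF R] _ N(2)])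
        (simp add: \<Lambda>_def)
    finally show ?thesis .
  qed
  then show ?thesis using N(1) by blast
qed

text \<open>Two matrices that are congruent modulo a sufficiently divisible \<open>N\<close> differ by a factor that
  preserves both \<open>R\<close> and \<open>\<Lambda>\<close>.\<close>

lemma SLR_arithmetic: "arithmetic_subgroup scaleK s (SL_inv s R)"
proof -
  obtain N1 where N1: "N1 > 0" "\<And>x. x \<in> R \<Longrightarrow> scaleK (of_nat N1) x \<in> \<Lambda>" using R_in_\<Lambda> by blast
  obtain N2 where N2: "N2 > 0" "\<And>x. x \<in> \<Lambda> \<Longrightarrow> scaleK (of_nat N2) x \<in> R" using \<Lambda>_in_R by blast
  \<comment> \<open>N R preserves \<Lambda>, and N times the left order of \<Lambda> lies in R; so
    congruences modulo N pass between both structures.\<close>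
  define N where "N = N1 * N2"
  have N: "N > 0" using N1(1) N2(1) by (simp add: N_def)
  let ?n = "of_nat N :: 'k"
  note subR = osubD[OF order_osub[OF R]]
  have NR: "stab (scaleK ?n x)" if x: "x \<in> R" for x
    unfolding stab_def
  proof
    fix l
    have "scaleK (of_nat N1) (x * scaleK (of_nat N2) (e l)) \<in> \<Lambda>"
      by (intro N1(2) order_mult[OF R x] N2(2) e_in_\<Lambda>)
    then show "scaleK ?n x * e l \<in> \<Lambda>" by (simp add: scale_mult_left scale_mult_right N_def)
  qed
  have N\<Lambda>: "scaleK ?n x \<in> R" if x: "stab x" for x
  proof -
    have "scaleK (of_nat N1) 1 \<in> \<Lambda>" by (rule N1(2)[OF order_one[OF R]])
    then have "x * scaleK (of_nat N1) 1 \<in> \<Lambda>" by (rule stab_mult[OF x])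
    then have "scaleK (of_nat N2) (x * scaleK (of_nat N1) 1) \<in> R" by (rule N2(2))
    then show ?thesis by (simp add: scale_mult_right N_def mult.commute)
  qed
  \<comment> \<open>If M' = M + N Y, then M' M^(-1) = 1 + N Y M^(-1), with \<open>hat s M\<close> as
    the inverse.\<close>
  have quotient: "M' ** hat s M = mat 1 + (\<chi> p q. scaleK ?n (Y$p$1 * hat s M$1$q + Y$p$2 * hat s M$2$q))"
    if M: "M \<in> SL" and Y: "\<And>p q. M'$p$q = M$p$q + scaleK ?n (Y$p$q)" for M M' Y
  proof -
    have "M' ** hat s M = M ** hat s M + (\<chi> p q. scaleK ?n (Y$p$1 * hat s M$1$q + Y$p$2 * hat s M$2$q))"
      by (simp add: Finite_Cartesian_Product.vec_eq_iff matrix_mult_2 Y scale_mult_left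
          scale_right_distrib distrib_right)
    then show ?thesis by (simp only: SL_right[OF M])
  qed
  let ?S = "SL_inv s R"
  let ?I = "?S \<inter> SL\<Lambda>"
  have SS: "?S \<subseteq> SL" "SL\<Lambda> \<subseteq> SL" by (auto simp: SL_inv_def SL\<Lambda>_def)
  have groups: "subgroup (rep ` ?S) GL_group" "subgroup (rep ` SL\<Lambda>) GL_group"
    by (intro rep_subgroup SLR_subgroup SL\<Lambda>_subgroup)+
  have inter: "rep ` ?S \<inter> rep ` SL\<Lambda> = rep ` ?I" by (rule image_Int[symmetric, OF regular_rep_inj[OF e]])
  have "subgroup ?I (SL_inv_group s)"
    by (rule group.subgroups_Inter_pair[OF SL_group SLR_subgroup SL\<Lambda>_subgroup])
  then have I: "subgroup (rep ` ?I) GL_group" by (rule rep_subgroup)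
  have hat_quot: "hat s (M' ** hat s M) = M ** hat s M'" for M M' by (simp add: hat_mult hat_hat)
  have mult_back: "rep M' = rep (M' ** hat s M) \<otimes>\<^bsub>GL_group\<^esub> rep M" if "M \<in> SL" for M M'
    by (simp add: GL_group_def rep_mult[symmetric] matrix_mul_assoc[symmetric] SL_left[OF that])
  have fin1: "finite (rcosets\<^bsub>GL_group\<lparr>carrier := rep ` ?S\<rparr>\<^esub> (rep ` ?I))"
  proof -
    obtain F where F: "finite F" "\<And>x. x \<in> R \<Longrightarrow> \<exists>f\<in>F. \<exists>y\<in>R. x = f + scaleK ?n y"
      using finite_quotient_osub[OF order_osub[OF R] N] by metis
    have "\<forall>x. \<exists>f. x \<in> R \<longrightarrow> f \<in> F \<and> (\<exists>y\<in>R. x = f + scaleK ?n y)" using F(2) by blast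
    then obtain g where g: "\<And>x. x \<in> R \<Longrightarrow> g x \<in> F \<and> (\<exists>y\<in>R. x = g x + scaleK ?n y)" by metis
    \<comment> \<open>The invariant that separates cosets: residues modulo N R of the four entries,
      read back through the injective representation.\<close>
    define f where "f x = (let M = inv_into UNIV rep x in (g (M$1$1), g (M$1$2), g (M$2$1), g (M$2$2)))" for x
    have f_rep: "f (rep M) = (g (M$1$1), g (M$1$2), g (M$2$1), g (M$2$2))" for M
      by (simp add: f_def inv_into_f_f[OF regular_rep_inj[OF e]] Let_def)
    have diff: "\<exists>Y. \<forall>p q. Y$p$q \<in> R \<and> M'$p$q = M$p$q + scaleK ?n (Y$p$q)"
      if M: "\<And>p q. M$p$q \<in> R" "\<And>p q. M'$p$q \<in> R" "f (rep M) = f (rep M')" for M M'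
    proof -
      have "\<exists>y. y \<in> R \<and> M'$p$q = M$p$q + scaleK ?n y" for p q
      proof -
        have same: "g (M$p$q) = g (M'$p$q)"
          using M(3) exhaust_2[of p] exhaust_2[of q] unfolding f_rep by auto
        obtain y where y: "y \<in> R" "M$p$q = g (M$p$q) + scaleK ?n y" using g[OF M(1)] by blast
        obtain y' where y': "y' \<in> R" "M'$p$q = g (M'$p$q) + scaleK ?n y'" using g[OF M(2)] by blast
        have "M'$p$q = g (M$p$q) + scaleK ?n y'" unfolding same by (rule y'(2))
        also have "g (M$p$q) = M$p$q - scaleK ?n y" by (rule eq_diff_eq[THEN iffD2, OF y(2)[symmetric]])
        finally have "M'$p$q = M$p$q + scaleK ?n (y' - y)" by (simp add: scale_right_diff_distrib)
        then show ?thesis using subR(5)[OF y'(1) y(1)] by blast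
      qed
      then obtain y where "\<And>p q. y p q \<in> R \<and> M'$p$q = M$p$q + scaleK ?n (y p q)" by metis
      then show ?thesis by (intro exI[of _ "\<chi> p q. y p q"]) simp
    qed
    show ?thesis
    proof (rule rcosets_finite[OF GL_group I])
      show "rep ` ?S \<subseteq> carrier GL_group" using SS rep_GL by blast
      have "f ` rep ` ?S \<subseteq> F \<times> F \<times> F \<times> F" using g by (auto simp: f_rep SL_inv_def)
      then show "finite (f ` rep ` ?S)" using F(1) by (simp add: finite_subset)
      fix x y assume "x \<in> rep ` ?S" "y \<in> rep ` ?S" and fxy: "f x = f y"
      then obtain M M' where M: "M \<in> ?S" "x = rep M" and M': "M' \<in> ?S" "y = rep M'" by blast
      have in_\<Lambda>: "stab ((M1 ** hat s M2)$p$q)" if M12: "M1 \<in> ?S" "M2 \<in> ?S" "f (rep M1) = f (rep M2)" for M1 M2 p q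
      proof -
        have R12: "\<And>p q. M1$p$q \<in> R" "\<And>p q. M2$p$q \<in> R" "\<And>p q. hat s M2$p$q \<in> R" and M2S: "M2 \<in> SL"
          using M12 SLR_subgroup unfolding subgroup_SL_iff by (auto simp: SL_inv_def)
        obtain Y where Y: "\<forall>p q. Y$p$q \<in> R \<and> M1$p$q = M2$p$q + scaleK ?n (Y$p$q)"
          using diff[OF R12(2,1)] M12(3) by metis
        have "Y$p$1 * hat s M2$1$q + Y$p$2 * hat s M2$2$q \<in> R"
          using Y R12(3) by (intro subR(2) order_mult[OF R]) auto
        then have "stab (scaleK ?n (Y$p$1 * hat s M2$1$q + Y$p$2 * hat s M2$2$q))" by (rule NR)
        then have "stab ((mat 1 :: 'h^2^2)$p$q + scaleK ?n (Y$p$1 * hat s M2$1$q + Y$p$2 * hat s M2$2$q))"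
          by (intro stab_add) (simp add: Finite_Cartesian_Product.mat_def stab_one stab_zero)
        then show ?thesis using quotient[OF M2S, of M1 Y] Y by simp
      qed
      have quot: "M' ** hat s M \<in> ?S" using M M' SLR_subgroup unfolding subgroup_SL_iff by blast
      have f_eq: "f (rep M) = f (rep M')" using fxy M(2) M'(2) by simp
      \<comment> \<open>The inverse of the quotient is the quotient with M and M' exchanged, hence
        the two instances of the stability fact.\<close>
      have "M' ** hat s M \<in> SL\<Lambda>"
        using quot SS(1) in_\<Lambda>[OF M'(1) M(1) f_eq[symmetric]] in_\<Lambda>[OF M(1) M'(1) f_eq]
        unfolding SL\<Lambda>_def mem_Collect_eq hat_quot by blast
      then show "\<exists>h\<in>rep ` ?I. y = h \<otimes>\<^bsub>GL_group\<^esub> x"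
        using quot mult_back[of M M'] M M' SS(1) by blast
    qed
  qed
  have fin2: "finite (rcosets\<^bsub>GL_group\<lparr>carrier := rep ` SL\<Lambda>\<rparr>\<^esub> (rep ` ?I))"
  proof -
    obtain F :: "'k set" where F: "finite F" "\<And>x. x \<in> oK \<Longrightarrow> \<exists>f\<in>F. \<exists>y\<in>oK. x = f + ?n * y"
      using finite_quotient_oK[OF number_field N] by metis
    have "\<forall>x. \<exists>f. x \<in> oK \<longrightarrow> f \<in> F \<and> (\<exists>y\<in>oK. x = f + ?n * y)" using F(2) by blast
    then obtain g where g: "\<And>x. x \<in> oK \<Longrightarrow> g x \<in> F \<and> (\<exists>y\<in>oK. x = g x + ?n * y)" by metis
    \<comment> \<open>Here integrality is a condition on the entries over K, so the invariant
      collects their residues modulo N.\<close>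
    define f where "f x = (\<lambda>(r, c). g (x $ r $ c))" for x :: "'k^(2 \<times> 4)^(2 \<times> 4)"
    have diff: "\<exists>Y. \<forall>p q. stab (Y$p$q) \<and> M'$p$q = M$p$q + scaleK ?n (Y$p$q)"
      if M: "\<And>p q. stab (M$p$q)" "\<And>p q. stab (M'$p$q)" "f (rep M) = f (rep M')" for M M'
    proof -
      define Y :: "'h^2^2" where "Y = (\<chi> p q. scaleK (1 / ?n) (M'$p$q - M$p$q))"
      have n0: "?n \<noteq> 0" using N by simp
      have "co l (Y$p$q * e m) \<in> oK" for p q l m
      proof -
        have o: "rep M $ (p, l) $ (q, m) \<in> oK" "rep M' $ (p, l) $ (q, m) \<in> oK"
          using M(1,2) rep_integral_iff by blast+
        have same: "g (rep M $ (p, l) $ (q, m)) = g (rep M' $ (p, l) $ (q, m))"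
          using fun_cong[OF M(3), of "((p, l), (q, m))"] by (simp add: f_def)
        obtain y where y: "y \<in> oK" "rep M $ (p, l) $ (q, m) = g (rep M $ (p, l) $ (q, m)) + ?n * y"
          using g[OF o(1)] by blast
        obtain y' where y': "y' \<in> oK" "rep M' $ (p, l) $ (q, m) = g (rep M' $ (p, l) $ (q, m)) + ?n * y'"
          using g[OF o(2)] by blast
        have "rep M' $ (p, l) $ (q, m) = g (rep M $ (p, l) $ (q, m)) + ?n * y'"
          unfolding same by (rule y'(2))
        also have "g (rep M $ (p, l) $ (q, m)) = rep M $ (p, l) $ (q, m) - ?n * y"
          by (rule eq_diff_eq[THEN iffD2, OF y(2)[symmetric]])
        finally have "rep M' $ (p, l) $ (q, m) - rep M $ (p, l) $ (q, m) = ?n * (y' - y)"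
          by (simp add: right_diff_distrib)
        then have "co l (Y$p$q * e m) = y' - y"
          using n0 by (simp add: Y_def rep_entry scale_mult_left left_diff_distrib co_scale co_diff)
        then show ?thesis using y(1) y'(1) by auto
      qed
      then have "stab (Y$p$q)" for p q by (simp add: stab_def \<Lambda>_def)
      moreover have "M'$p$q = M$p$q + scaleK ?n (Y$p$q)" for p q using n0 by (simp add: Y_def)
      ultimately show ?thesis by blast
    qed
    show ?thesis
    proof (rule rcosets_finite[OF GL_group I])
      show "rep ` SL\<Lambda> \<subseteq> carrier GL_group" using SS rep_GL by blast
      have "f ` rep ` SL\<Lambda> \<subseteq> Pi\<^sub>E UNIV (\<lambda>_. F)"
      proof
        fix h assume "h \<in> f ` rep ` SL\<Lambda>"
        then obtain M where M: "M \<in> SL\<Lambda>" "h = f (rep M)" by blast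
        then have "rep M $ r $ c \<in> oK" for r c
          using rep_integral_iff[of M] unfolding SL\<Lambda>_def mem_Collect_eq by blast
        then show "h \<in> Pi\<^sub>E UNIV (\<lambda>_. F)" using g M(2) by (auto simp: f_def)
      qed
      then show "finite (f ` rep ` SL\<Lambda>)" by (rule finite_subset) (simp add: finite_PiE F(1))
      fix x y assume "x \<in> rep ` SL\<Lambda>" "y \<in> rep ` SL\<Lambda>" and fxy: "f x = f y"
      then obtain M M' where M: "M \<in> SL\<Lambda>" "x = rep M" and M': "M' \<in> SL\<Lambda>" "y = rep M'" by blast
      have MS: "M \<in> SL" using M(1) SS(2) by (rule subsetD[rotated])
      have st: "\<And>p q. stab (M$p$q)" "\<And>p q. stab (M'$p$q)" "\<And>p q. stab (hat s M$p$q)"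
        using M(1) M'(1) unfolding SL\<Lambda>_def by blast+
      obtain Y where Y: "\<forall>p q. stab (Y$p$q) \<and> M'$p$q = M$p$q + scaleK ?n (Y$p$q)"
        using diff[OF st(1,2)] fxy M(2) M'(2) by metis
      have \<Lambda>: "M' ** hat s M \<in> SL\<Lambda>" using M M' SL\<Lambda>_subgroup unfolding subgroup_SL_iff by blast
      have "(M' ** hat s M)$p$q \<in> R" for p q
      proof -
        have "stab (Y$p$1 * hat s M$1$q + Y$p$2 * hat s M$2$q)"
          using Y st(3) by (intro stab_add stab_prod) auto
        then have "scaleK ?n (Y$p$1 * hat s M$1$q + Y$p$2 * hat s M$2$q) \<in> R" by (rule N\<Lambda>)
        then have "(mat 1 :: 'h^2^2)$p$q + scaleK ?n (Y$p$1 * hat s M$1$q + Y$p$2 * hat s M$2$q) \<in> R"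
          by (intro subR(2)) (simp add: Finite_Cartesian_Product.mat_def subR(1) order_one[OF R])
        then show ?thesis using quotient[OF MS, of M' Y] Y by simp
      qed
      then have "M' ** hat s M \<in> ?S" using \<Lambda> SS(2) by (auto simp: SL_inv_def)
      then show "\<exists>h\<in>rep ` ?I. y = h \<otimes>\<^bsub>GL_group\<^esub> x"
        using mult_back[OF MS, of M'] M M' \<Lambda> by blast
    qed
  qed
  have "commensurable GL_group (rep ` ?S) (rep ` SL\<Lambda>)"
    unfolding commensurable_def inter using groups fin1 fin2 by blast
  then have "arithmetic_in_GL (rep ` SL) (rep ` ?S)"
    unfolding arithmetic_in_GL_def integral_points using SS by blast
  then show ?thesis
    unfolding arithmetic_subgroup_def using SLR_subgroup e by blast
qed

text \<open>Finite index yields finitely many t such that every M in \<Gamma> is h t with h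
  preserving \<Lambda>. A common multiple brings the entries of all t into \<Lambda>, and the
  entries of h keep them there.\<close>

lemma arithmetic_bounded:
  assumes \<Gamma>: "subgroup \<Gamma> (SL_inv_group s)" and ar: "arithmetic_in_GL (rep ` SL) (rep ` \<Gamma>)"
  shows "\<exists>N>0. \<forall>M\<in>\<Gamma>. \<forall>p q. scaleK (of_nat N) (M$p$q) \<in> R"
proof -
  have SL: "\<Gamma> \<subseteq> SL" using \<Gamma> unfolding subgroup_SL_iff by blast
  have "subgroup (\<Gamma> \<inter> SL\<Lambda>) (SL_inv_group s)"
    by (rule group.subgroups_Inter_pair[OF SL_group \<Gamma> SL\<Lambda>_subgroup])
  then have I: "subgroup (rep ` (\<Gamma> \<inter> SL\<Lambda>)) GL_group" by (rule rep_subgroup)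
  have inter: "rep ` \<Gamma> \<inter> rep ` SL\<Lambda> = rep ` (\<Gamma> \<inter> SL\<Lambda>)" by (rule image_Int[symmetric, OF regular_rep_inj[OF e]])
  have "finite (rcosets\<^bsub>GL_group\<lparr>carrier := rep ` \<Gamma>\<rparr>\<^esub> (rep ` (\<Gamma> \<inter> SL\<Lambda>)))"
    using ar unfolding arithmetic_in_GL_def integral_points commensurable_def inter by blast
  moreover have "rep ` \<Gamma> \<subseteq> carrier GL_group" using SL rep_GL by blast
  ultimately obtain T where T: "finite T" "T \<subseteq> rep ` \<Gamma>"
    "\<And>x. x \<in> rep ` \<Gamma> \<Longrightarrow> \<exists>t\<in>T. \<exists>h\<in>rep ` (\<Gamma> \<inter> SL\<Lambda>). x = h \<otimes>\<^bsub>GL_group\<^esub> t"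
    using rcosets_representatives[OF GL_group I] by metis
  obtain T' where T': "finite T'" "T' \<subseteq> \<Gamma>" "T = rep ` T'"
    using finite_subset_image[OF T(1,2)] by metis
  define X where "X = (\<lambda>(t, p, q). t$p$q :: 'h) ` (T' \<times> UNIV \<times> UNIV)"
  have "finite X" unfolding X_def using T'(1) by simp
  obtain N1 where N1: "N1 > 0" "\<And>x. x \<in> R \<Longrightarrow> scaleK (of_nat N1) x \<in> \<Lambda>" using R_in_\<Lambda> by blast
  obtain N2 where N2: "N2 > 0" "\<And>x. x \<in> \<Lambda> \<Longrightarrow> scaleK (of_nat N2) x \<in> R" using \<Lambda>_in_R by blast
  have "\<exists>N>0. \<forall>x\<in>X. scaleK (of_nat N) x \<in> \<Lambda>"
  proof (rule common_multiple_exists[OF \<open>finite X\<close>])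
    show "\<exists>n>0. scaleK (of_nat n) x \<in> \<Lambda>" for x
    proof -
      obtain n where n: "n > 0" "scaleK (of_nat n) x \<in> R"
        using R order_contains_multiple[OF _ order_osub[OF R], of x] by (auto simp: is_order_def)
      have "scaleK (of_nat N1) (scaleK (of_nat n) x) \<in> \<Lambda>" by (rule N1(2)[OF n(2)])
      then have "scaleK (of_nat (N1 * n)) x \<in> \<Lambda>" by simp
      then show ?thesis using n(1) N1(1) by (intro exI[of _ "N1 * n"]) simp
    qed
    show "scaleK (of_nat (n * m)) x \<in> \<Lambda>" if "scaleK (of_nat n) x \<in> \<Lambda>" for x n m
      using osub_scale[OF \<Lambda>_osub oK_of_nat[of m] that] by (simp add: mult.commute)
  qed
  then obtain N3 where N3: "N3 > 0" "\<And>x. x \<in> X \<Longrightarrow> scaleK (of_nat N3) x \<in> \<Lambda>" by blast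
  have "scaleK (of_nat (N2 * N3)) (M$p$q) \<in> R" if M: "M \<in> \<Gamma>" for M p q
  proof -
    obtain t h where t: "t \<in> T" "h \<in> rep ` (\<Gamma> \<inter> SL\<Lambda>)" "rep M = h \<otimes>\<^bsub>GL_group\<^esub> t"
      using T(3)[of "rep M"] M by blast
    obtain t' where t': "t' \<in> T'" "t = rep t'" using t(1) T'(3) by blast
    obtain h' where h': "h' \<in> SL\<Lambda>" "h = rep h'" using t(2) by blast
    have "rep M = rep (h' ** t')" using t(3) t' h' by (simp add: GL_group_def rep_mult)
    then have M_eq: "M = h' ** t'" by (simp only: rep_inj)
    have X: "t'$m$q \<in> X" for m unfolding X_def by (rule image_eqI[of _ _ "(t', m, q)"]) (use t'(1) in auto)
    have "h'$p$1 * scaleK (of_nat N3) (t'$1$q) + h'$p$2 * scaleK (of_nat N3) (t'$2$q) \<in> \<Lambda>"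
      using h'(1) by (intro osub_add[OF \<Lambda>_osub] stab_mult N3(2) X) (auto simp: SL\<Lambda>_def)
    then have "scaleK (of_nat N3) (M$p$q) \<in> \<Lambda>"
      unfolding M_eq matrix_mult_2 by (simp add: scale_mult_right scale_right_distrib)
    then have "scaleK (of_nat N2) (scaleK (of_nat N3) (M$p$q)) \<in> R" by (rule N2(2))
    then show ?thesis by simp
  qed
  then show ?thesis using N2(1) N3(1) by (intro exI[of _ "N2 * N3"]) simp
qed

text \<open>Since \<open>\<Gamma>\<close> contains all elementary matrices over the fixed part
  of \<open>R\<close>, its linear span over the ring of integers is the full matrix ring over an order.\<close>

lemma bounded_overgroup:
  assumes max: "maximal_involution_order scaleK s R" and \<Gamma>: "subgroup \<Gamma> (SL_inv_group s)" and sub: "SL_inv s R \<subseteq> \<Gamma>"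
    and N: "0 < N" "\<And>M p q. M \<in> \<Gamma> \<Longrightarrow> scaleK (of_nat N) (M$p$q) \<in> R"
  shows "\<Gamma> \<subseteq> SL_inv s R"
proof -
  have G: "\<Gamma> \<subseteq> SL" "mat 1 \<in> \<Gamma>" "\<And>M N. M \<in> \<Gamma> \<Longrightarrow> N \<in> \<Gamma> \<Longrightarrow> M ** N \<in> \<Gamma>" "\<And>M. M \<in> \<Gamma> \<Longrightarrow> hat s M \<in> \<Gamma>"
    using \<Gamma> unfolding subgroup_SL_iff by blast+
  note subR = osubD[OF order_osub[OF R]]
  define ms :: "'k \<Rightarrow> 'h^2^2 \<Rightarrow> 'h^2^2" where "ms c M = (\<chi> p q. scaleK c (M$p$q))" for c M
  have ms: "ms c M $ p $ q = scaleK c (M$p$q)" for c M p q by (simp add: ms_def)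
  define closed where "closed X \<longleftrightarrow> \<Gamma> \<subseteq> X \<and> (\<forall>M\<in>X. \<forall>N\<in>X. M + N \<in> X) \<and> (\<forall>c\<in>oK. \<forall>M\<in>X. ms c M \<in> X)" for X
  \<comment> \<open>The span of \<Gamma> over the integers, as an intersection: its properties
    follow by exhibiting closed sets.\<close>
  define W where "W = \<Inter>{X. closed X}"
  have W_min: "W \<subseteq> X" if "closed X" for X using that unfolding W_def by blast
  have W\<Gamma>: "M \<in> W" if "M \<in> \<Gamma>" for M using that unfolding W_def closed_def by blast
  have W_add: "M + M' \<in> W" if "M \<in> W" "M' \<in> W" for M M'
    using that unfolding W_def closed_def by blast
  have W_scale: "ms c M \<in> W" if "c \<in> oK" "M \<in> W" for c M
    using that unfolding W_def closed_def by blast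
  have W_diff: "M - M' \<in> W" if "M \<in> W" "M' \<in> W" for M M'
  proof -
    have "M + ms (-1) M' \<in> W" using that by (intro W_add W_scale) auto
    moreover have "M + ms (-1) M' = M - M'" by (simp add: Finite_Cartesian_Product.vec_eq_iff ms)
    ultimately show ?thesis by simp
  qed
  have ms_left: "g ** ms c M = ms c (g ** M)" and ms_right: "ms c M ** g = ms c (M ** g)" for g M c
    by (simp_all add: Finite_Cartesian_Product.vec_eq_iff ms matrix_mult_2 scale_mult_right scale_mult_left scale_right_distrib)
  have gW: "g ** M \<in> W" if g: "g \<in> \<Gamma>" and M: "M \<in> W" for g M
  proof -
    have "closed {M. g ** M \<in> W}"
      unfolding closed_def using W\<Gamma> G(3)[OF g] W_add W_scale
      by (auto simp: matrix_add_ldistrib ms_left)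
    from subsetD[OF W_min[OF this] M] show ?thesis by simp
  qed
  have matrix_add_mult: "(A + B) ** C = A ** C + B ** C" for A B C :: "'h^2^2"
    by (simp add: Finite_Cartesian_Product.vec_eq_iff matrix_mult_2 distrib_right)
  have W_mult: "M ** M' \<in> W" if M: "M \<in> W" and M': "M' \<in> W" for M M'
  proof -
    have "closed {M. M ** M' \<in> W}"
      unfolding closed_def
    proof (intro conjI ballI)
      show "\<Gamma> \<subseteq> {M. M ** M' \<in> W}" using gW[OF _ M'] by blast
      show "A + B \<in> {M. M ** M' \<in> W}" if "A \<in> {M. M ** M' \<in> W}" "B \<in> {M. M ** M' \<in> W}" for A B
        using that W_add[of "A ** M'" "B ** M'"] by (simp add: matrix_add_mult)
      show "ms c A \<in> {M. M ** M' \<in> W}" if "c \<in> oK" "A \<in> {M. M ** M' \<in> W}" for c A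
        using that W_scale by (simp add: ms_right)
    qed
    from subsetD[OF W_min[OF this] M] show ?thesis by simp
  qed
  have W_hat: "hat s M \<in> W" if M: "M \<in> W" for M
  proof -
    have "hat s (A + B) = hat s A + hat s B" for A B
      by (simp add: matrix_2 s_add)
    moreover have "hat s (ms c A) = ms c (hat s A)" for c A
      by (simp add: matrix_2 ms s_scale)
    ultimately have "closed {M. hat s M \<in> W}"
      unfolding closed_def using W\<Gamma> G(4) W_add W_scale by auto
    from subsetD[OF W_min[OF this] M] show ?thesis by simp
  qed
  have W_bounded: "scaleK (of_nat N) (M$p$q) \<in> R" if M: "M \<in> W" for M p q
  proof -
    have "closed {M. \<forall>p q. scaleK (of_nat N) (M$p$q) \<in> R}"
      unfolding closed_def
    proof (intro conjI ballI)
      show "\<Gamma> \<subseteq> {M. \<forall>p q. scaleK (of_nat N) (M$p$q) \<in> R}" using N(2) by blast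
      show "A + B \<in> {M. \<forall>p q. scaleK (of_nat N) (M$p$q) \<in> R}"
        if "A \<in> {M. \<forall>p q. scaleK (of_nat N) (M$p$q) \<in> R}" "B \<in> {M. \<forall>p q. scaleK (of_nat N) (M$p$q) \<in> R}" for A B
        using that subR(2) by (simp add: scale_right_distrib)
      show "ms c A \<in> {M. \<forall>p q. scaleK (of_nat N) (M$p$q) \<in> R}"
        if "c \<in> oK" "A \<in> {M. \<forall>p q. scaleK (of_nat N) (M$p$q) \<in> R}" for c A
      proof -
        have "scaleK c (scaleK (of_nat N) (A$p$q)) \<in> R" for p q using that subR(3) by blast
        then show ?thesis by (simp add: ms mult.commute)
      qed
    qed
    from subsetD[OF W_min[OF this] M] show ?thesis by simp
  qed
  define E :: "2 \<Rightarrow> 2 \<Rightarrow> 'h \<Rightarrow> 'h^2^2" where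
    "E p q x = (\<chi> p' q'. if p' = p \<and> q' = q then x else 0)" for p q x
  have E: "E p q x $ p' $ q' = (if p' = p \<and> q' = q then x else 0)" for p q x p' q' by (simp add: E_def)
  have E_mult: "E p q x ** E q r y = E p r (x * y)" for p q r x y
    using exhaust_2[of q] by (auto simp: Finite_Cartesian_Product.vec_eq_iff matrix_mult_2 E)
  have E_entry: "E 1 p 1 ** M ** E q 1 1 = E 1 1 (M$p$q)" for M p q
    using exhaust_2[of p] exhaust_2[of q] by (auto simp: Finite_Cartesian_Product.vec_eq_iff matrix_mult_2 E)
  have E_add: "E p q (x + y) = E p q x + E p q y" and E_diff: "E p q (x - y) = E p q x - E p q y"
    and E_scale: "E p q (scaleK c x) = ms c (E p q x)" for p q x y c
    by (simp_all add: Finite_Cartesian_Product.vec_eq_iff E ms)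
  \<comment> \<open>For fixed x the elementary matrices belong to SL over R, and subtracting the
    identity isolates the entry. Products of the two cases with x = 1 are the diagonal matrix
    units.\<close>
  have E12: "E 1 2 x \<in> W" and E21: "E 2 1 x \<in> W" if x: "x \<in> R" "s x = x" for x
  proof -
    have "mat 1 + E 1 2 x \<in> SL_inv s R" "mat 1 + E 2 1 x \<in> SL_inv s R"
      using x subR(1) order_one[OF R] by (auto simp: SL_inv_def forall_2 matrix_2 E)
    then have *: "mat 1 + E 1 2 x \<in> W" "mat 1 + E 2 1 x \<in> W" using sub W\<Gamma> by blast+
    show "E 1 2 x \<in> W" using W_diff[OF *(1) W\<Gamma>[OF G(2)]] by simp
    show "E 2 1 x \<in> W" using W_diff[OF *(2) W\<Gamma>[OF G(2)]] by simp
  qed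
  have E1: "E 1 2 1 \<in> W" "E 2 1 1 \<in> W" using E12 E21 order_one[OF R] by simp_all
  have E_one: "E p q 1 \<in> W" for p q
    using E1 W_mult[OF E1] W_mult[OF E1(2,1)] exhaust_2[of p] exhaust_2[of q] by (auto simp: E_mult)
  \<comment> \<open>The upper left corner suffices, since matrix units move every entry of
    \<open>W\<close> there.\<close>
  define R' where "R' = {x. E 1 1 x \<in> W}"
  have entry: "M$p$q \<in> R'" if "M \<in> W" for M p q
  proof -
    have "E 1 p 1 ** M ** E q 1 1 \<in> W" by (intro W_mult E_one that)
    then show ?thesis unfolding R'_def E_entry by simp
  qed
  have fixed: "x \<in> R'" if "x \<in> R" "s x = x" for x
    using W_mult[OF E12[OF that] E1(2)] by (simp add: R'_def E_mult)
  have osubR': "osub R'"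
  proof -
    have "E 1 1 0 = ms 0 (E 1 1 1)" by (simp add: Finite_Cartesian_Product.vec_eq_iff E ms)
    then have "E 1 1 0 \<in> W" using W_scale[OF oK_0 E_one] by simp
    then show ?thesis unfolding rsub_def R'_def by (auto simp: E_add E_scale W_add W_scale)
  qed
  have R'_mult: "x * y \<in> R'" if "x \<in> R'" "y \<in> R'" for x y
    using that W_mult[of "E 1 1 x" "E 1 1 y"] by (simp add: R'_def E_mult)
  \<comment> \<open>\<open>hat\<close> exchanges the diagonal positions and applies
    \<open>s\<close>; \<open>entry\<close> brings the result back to the corner.\<close>
  have R'_s: "s x \<in> R'" if x: "x \<in> R'" for x
  proof -
    have "hat s (E 1 1 x) = E 2 2 (s x)" by (simp add: matrix_2 E)
    then have "E 2 2 (s x) \<in> W" using W_hat x unfolding R'_def by (metis mem_Collect_eq)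
    from entry[OF this, of 2 2] show ?thesis by (simp add: E)
  qed
  have R'_one: "1 \<in> R'" by (rule fixed[OF order_one[OF R] s_one])
  have R'_bounded: "scaleK (of_nat N) x \<in> R" if "x \<in> R'" for x
    using W_bounded[of "E 1 1 x" 1 1] that by (simp add: R'_def E)
  \<comment> \<open>The element i * j is skew, so it is reached as a product of multiples of the
    fixed elements i and j.\<close>
  have "span R' = UNIV"
  proof -
    have spanR: "span R = UNIV" using R by (simp add: is_order_def)
    obtain n where n: "n > 0" "scaleK (of_nat n) i \<in> R" using order_contains_multiple[OF spanR order_osub[OF R]] by blast
    obtain m where m: "m > 0" "scaleK (of_nat m) j \<in> R" using order_contains_multiple[OF spanR order_osub[OF R]] by blast
    have ni: "scaleK (of_nat n) i \<in> R'" and mj: "scaleK (of_nat m) j \<in> R'"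
      using fixed n m by (simp_all add: s_scale s_i s_j)
    have nmij: "scaleK (of_nat n * of_nat m) (i * j) \<in> R'"
      using R'_mult[OF ni mj] by (simp add: scale_mult_left scale_mult_right mult.commute)
    have in_span: "x \<in> span R'" if "scaleK c x \<in> R'" "c \<noteq> 0" for c x
      using span_scale[OF span_base[OF that(1)], of "1 / c"] that(2) by simp
    have "i \<in> span R'" "j \<in> span R'" "i * j \<in> span R'" "1 \<in> span R'"
      using in_span[OF ni] in_span[OF mj] in_span[OF nmij] n m span_base[OF R'_one] by simp_all
    then have "quat x0 x1 x2 x3 \<in> span R'" for x0 x1 x2 x3
      unfolding quat_def by (intro span_add span_scale)
    then show ?thesis using quat_coords by (metis UNIV_eq_I)
  qed
  moreover have "finitely_generated_over_integers scaleK R'"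
    by (rule finitely_generated_if_sandwiched[OF osubR' \<open>span R' = UNIV\<close> R N(1) R'_bounded])
  ultimately have "is_order scaleK R'"
    unfolding is_order_def using R'_one R'_mult osub_diff[OF osubR'] by blast
  then have "R' \<subseteq> R" by (rule order_containing_fixed_part[OF max _ R'_s fixed])
  then have "M$p$q \<in> R" if "M \<in> \<Gamma>" for M p q using entry[OF W\<Gamma>[OF that]] by blast
  then show ?thesis using G(1) by (auto simp: SL_inv_def)
qed

end

theorem theorem1p6:
  fixes scaleK :: "'k::field_char_0 \<Rightarrow> 'h::ring_1 \<Rightarrow> 'h"
    and s :: "'h \<Rightarrow> 'h"
    and R :: "'h set"
  assumes "number_field TYPE('k)"
    and "quaternion_algebra scaleK"
    and "orthogonal_involution scaleK s"
    and "maximal_involution_order scaleK s R"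
  shows "arithmetic_subgroup scaleK s (SL_inv s R) \<and>
    (\<forall>\<Gamma>. arithmetic_subgroup scaleK s \<Gamma> \<longrightarrow> \<not> SL_inv s R \<subset> \<Gamma>)"
proof -
  interpret quaternion_algebra scaleK by fact
  obtain i j a b where ij: "a \<noteq> 0" "b \<noteq> 0" "i * i = scaleK a 1" "j * j = scaleK b 1" "i * j = - (j * i)"
    "s i = i" "s j = j"
    by (rule orthogonal_involution_basis[OF assms(3)])
  have "Vector_Spaces.linear scaleK scaleK s" "s (s x) = x" "s (x * y) = s y * s x" for x y
    using assms(3) unfolding orthogonal_involution_def by blast+
  then interpret involution_quaternion scaleK s i j a b
    using assms(1,2) ij by (intro involution_quaternion.intro involution_quaternion_axioms.intro)
  have R: "is_order scaleK R" and sR: "\<And>x. x \<in> R \<Longrightarrow> s x \<in> R"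
    using assms(4) unfolding maximal_involution_order_def involution_order_def by blast+
  have basis: "lattice_basis scaleK s i j a b e R" if "indexed_basis scaleK e" for e
    using that R sR
    by (intro lattice_basis.intro lattice_basis_axioms.intro involution_quaternion_axioms)
  show ?thesis
  proof (intro conjI allI impI notI)
    obtain e where "indexed_basis scaleK e" using indexed_basis_exists by blast
    then interpret lattice_basis scaleK s i j a b e R by (rule basis)
    show "arithmetic_subgroup scaleK s (SL_inv s R)" by (rule SLR_arithmetic)
  next
    fix \<Gamma> assume "arithmetic_subgroup scaleK s \<Gamma>" and sub: "SL_inv s R \<subset> \<Gamma>"
    then obtain e where \<Gamma>: "subgroup \<Gamma> (SL_inv_group s)" "indexed_basis scaleK e"
      "arithmetic_in_GL (regular_rep scaleK e ` SL_inv s UNIV) (regular_rep scaleK e ` \<Gamma>)"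
      unfolding arithmetic_subgroup_def by blast
    \<comment> \<open>This is the basis in which \<Gamma> is arithmetic; it may differ from the one
      chosen for the first claim. The bound drawn from it speaks of R alone.\<close>
    interpret lattice_basis scaleK s i j a b e R by (rule basis[OF \<Gamma>(2)])
    obtain N where "0 < N" "\<forall>M\<in>\<Gamma>. \<forall>p q. scaleK (of_nat N) (M$p$q) \<in> R"
      using arithmetic_bounded[OF \<Gamma>(1,3)] by blast
    then have "\<Gamma> \<subseteq> SL_inv s R"
      using assms(4) sub by (intro bounded_overgroup[OF _ \<Gamma>(1)]) auto
    then show False using sub by blast
  qed
qed

end
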